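(* For integers $s,t$ with $2\le s\le t-1$, we have $\varrho_s(K_t)=\pi_s(\mathcal K_t)$.
   Context: $\varrho_s(K_t)=\lim_{\delta\to0}\lim_{n\to\infty}\mathrm{RT}(n,K_s,K_t,\delta n)/\binom ns$, where $\mathrm{RT}(n,K_s,K_t,\ell)$ is the maximum number of copies of $K_s$ in an $n$-vertex $K_t$-free graph with independence number less than $\ell$. A weighted graph $R=(V,w)$ is a finite set $V$ with $w:V\sqcup V^2\to[0,1]$ such that $\sum_{v\in V}w(v)=1$, $w(v,v')=w(v',v)$ and $w(v,v)=0$ for all $v,v'$. $R_{>\alpha}$ is the (unweighted) spanning graph on $V$ whose edges are the pairs of weight $>\alpha$. For a graph $H$ on $[s]$, $d_H(R)=\sum_{\sigma:[s]\to V}\prod_{i=1}^s w(\sigma(i))\prod_{ij\in E(H)}w(\sigma(i),\sigma(j))$. The weighted $t$-clique family $\mathcal K_t$ consists of pairs $(S_1,S_2)$ with $S_2\subseteq S_1\subseteq V$, $|S_1|,|S_2|\ge1$, $|S_1|+|S_2|=t$, such that $S_1$ is a clique in $R_{>0}$ and $S_2$ is a clique in $R_{>1/2}$; $R$ is $\mathcal K_t$-free if it has no such pair. $\pi_s(\mathcal K_t)=\sup\{d_{K_s}(R): R \text{ a } \mathcal K_t\text{-free weighted graph}\}$. *)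

theory Defs
  imports Complex_Main "HOL-Library.FuncSet"
begin

section \<open>Simple graphs\<close>

text \<open>A simple graph is given by its vertex set and its set of edges, the edges being
  two-element sets of vertices.\<close>

definition simple_graph :: "'a set \<Rightarrow> 'a set set \<Rightarrow> bool" where
  "simple_graph V E \<longleftrightarrow> finite V \<and> (\<forall>e\<in>E. e \<subseteq> V \<and> card e = 2)"

definition is_clique :: "'a set \<Rightarrow> 'a set set \<Rightarrow> 'a set \<Rightarrow> bool" where
  "is_clique V E S \<longleftrightarrow> S \<subseteq> V \<and> (\<forall>u\<in>S. \<forall>v\<in>S. u \<noteq> v \<longrightarrow> {u, v} \<in> E)"

definition is_independent :: "'a set \<Rightarrow> 'a set set \<Rightarrow> 'a set \<Rightarrow> bool" where
  "is_independent V E S \<longleftrightarrow> S \<subseteq> V \<and> (\<forall>u\<in>S. \<forall>v\<in>S. {u, v} \<notin> E)"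

definition independence_number :: "'a set \<Rightarrow> 'a set set \<Rightarrow> nat" where
  "independence_number V E = Max {card S | S. is_independent V E S}"

text \<open>A copy of the complete graph on \<open>s\<close> vertices is determined by its vertex set.\<close>

definition clique_count :: "nat \<Rightarrow> 'a set \<Rightarrow> 'a set set \<Rightarrow> nat" where
  "clique_count s V E = card {S. is_clique V E S \<and> card S = s}"

definition clique_free :: "nat \<Rightarrow> 'a set \<Rightarrow> 'a set set \<Rightarrow> bool" where
  "clique_free t V E \<longleftrightarrow> \<not> (\<exists>S. is_clique V E S \<and> card S = t)"

definition complete_edges :: "nat \<Rightarrow> nat set set" where
  "complete_edges s = {e. e \<subseteq> {1..s} \<and> card e = 2}"

section \<open>Ramsey--Turan densities\<close>

text \<open>The set below is finite, so its supremum in the natural numbers is its maximum; it is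
  \<open>0\<close> if there is no admissible graph. For \<open>l = \<delta> n\<close> with \<open>\<delta> > 0\<close> and \<open>t \<ge> 3\<close> the latter
  happens for finitely many \<open>n\<close> only.\<close>

definition RT :: "nat \<Rightarrow> nat \<Rightarrow> nat \<Rightarrow> real \<Rightarrow> nat" where
  "RT n s t l = Sup {clique_count s {..<n} E | E.
     simple_graph {..<n} E \<and> clique_free t {..<n} E \<and>
     real (independence_number {..<n} E) < l}"

definition RT_ratio :: "nat \<Rightarrow> nat \<Rightarrow> real \<Rightarrow> nat \<Rightarrow> real" where
  "RT_ratio s t \<delta> n = real (RT n s t (\<delta> * real n)) / real (n choose s)"

definition RT_density :: "nat \<Rightarrow> nat \<Rightarrow> real" where
  "RT_density s t = Lim (at_right 0) (\<lambda>\<delta>. lim (\<lambda>n. RT_ratio s t \<delta> n))"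

section \<open>Weighted graphs\<close>

record 'a wgraph =
  verts :: "'a set"
  vweight :: "'a \<Rightarrow> real"
  eweight :: "'a \<Rightarrow> 'a \<Rightarrow> real"

definition weighted_graph :: "'a wgraph \<Rightarrow> bool" where
  "weighted_graph R \<longleftrightarrow>
     finite (verts R) \<and>
     (\<forall>v\<in>verts R. vweight R v \<in> {0..1}) \<and>
     (\<forall>u\<in>verts R. \<forall>v\<in>verts R. eweight R u v \<in> {0..1}) \<and>
     (\<Sum>v\<in>verts R. vweight R v) = 1 \<and>
     (\<forall>u\<in>verts R. \<forall>v\<in>verts R. eweight R u v = eweight R v u) \<and>
     (\<forall>v\<in>verts R. eweight R v v = 0)"

definition threshold_edges :: "'a wgraph \<Rightarrow> real \<Rightarrow> 'a set set" where
  "threshold_edges R \<alpha> =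
     {{u, v} | u v. u \<in> verts R \<and> v \<in> verts R \<and> u \<noteq> v \<and> eweight R u v > \<alpha>}"

text \<open>\<open>H\<close> is the edge set of a simple graph on the vertex set \<open>{1..s}\<close>. An edge is read as the
  ordered pair of its minimum and maximum; the order is irrelevant as edge weights are symmetric.\<close>

definition hom_density :: "nat \<Rightarrow> nat set set \<Rightarrow> 'a wgraph \<Rightarrow> real" where
  "hom_density s H R =
     (\<Sum>\<sigma> \<in> {1..s} \<rightarrow>\<^sub>E verts R.
        (\<Prod>i=1..s. vweight R (\<sigma> i)) * (\<Prod>e\<in>H. eweight R (\<sigma> (Min e)) (\<sigma> (Max e))))"

definition weighted_cliques :: "nat \<Rightarrow> 'a wgraph \<Rightarrow> ('a set \<times> 'a set) set" where
  "weighted_cliques t R =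
     {(S1, S2). S2 \<subseteq> S1 \<and> S1 \<subseteq> verts R \<and> card S1 \<ge> 1 \<and> card S2 \<ge> 1 \<and>
        card S1 + card S2 = t \<and>
        is_clique (verts R) (threshold_edges R 0) S1 \<and>
        is_clique (verts R) (threshold_edges R (1/2)) S2}"

definition weighted_clique_free :: "nat \<Rightarrow> 'a wgraph \<Rightarrow> bool" where
  "weighted_clique_free t R \<longleftrightarrow> weighted_cliques t R = {}"

text \<open>Every finite weighted graph is isomorphic to one whose vertices are natural numbers.\<close>

definition weighted_turan_density :: "nat \<Rightarrow> nat \<Rightarrow> real" where
  "weighted_turan_density s t =
     Sup {hom_density s (complete_edges s) R | R :: nat wgraph.
            weighted_graph R \<and> weighted_clique_free t R}"

end

theory Submission
  imports Defs "HOL-Analysis.Convex"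
begin

text \<open>Blowing up an extremal graph preserves \<open>K\<^sub>t\<close>-freeness, the relative independence number
  and the homomorphism density of \<open>K\<^sub>s\<close>; hence for fixed \<open>\<delta>\<close> the limit over \<open>n\<close> exists and is at
  least the density of every \<open>K\<^sub>t\<close>-free graph with vertex weights whose independent sets have
  weight below \<open>\<delta>\<close>.

  Upper bound: a regular partition of a \<open>K\<^sub>t\<close>-free graph yields a weighted graph (irregular, sparse
  and diagonal pairs get weight \<open>0\<close>, all other densities are lowered by \<open>\<eta>\<close>). A pair of parts of density
  above \<open>1/2\<close> allows two adjacent vertices in either part, and every large set spans an edge, so a
  weighted clique \<open>(S\<^sub>1, S\<^sub>2)\<close> would give a \<open>K\<^sub>t\<close>.

  Lower bound: a discrete Bollobas--Erdos graph. Every vertex of the weighted graph becomes a copy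
  of the grid \<open>{-N..N}\<close> to the power \<open>I\<close>, with \<open>N\<close> large compared to the dimension. Inside a copy,
  long vectors \<open>x\<close>, \<open>y\<close> are adjacent if \<open>x + y\<close> is short: this is triangle-free, and it has no large
  independent set because by a dimension-free Poincare inequality every set \<open>A\<close> of positive density
  comes close to \<open>-A\<close>. Between copies joined by a weight in \<open>(0, 1/2]\<close>, \<open>x\<close> and \<open>y\<close> are adjacent if
  their inner product over a block of coordinates reserved for this pair is not too small. If \<open>x + x'\<close> and
  \<open>y + y'\<close> are short then \<open>\<langle>x + x', y + y'\<rangle>\<close> is small, so no two such copies contain an edge each of a
  common clique. Changing signs on one block shows that all sign patterns of the inner products are
  equally likely, so every such pair contributes a factor close to \<open>1/2\<close>.\<close>

section \<open>Homomorphism sums and cliques\<close>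

text \<open>The order of choices shapes the lower bound. \<open>\<delta>\<close> fixes
  \<open>r\<close>, the squared length (in units of \<open>N\<^sup>2\<close>) below which
  \<open>x + y\<close> counts as short, by a concentration bound free of the dimension. Only then is
  the block length \<open>h\<close> taken so large that vectors of squared length at most
  \<open>9 / 4 * r\<close> and inner products of size at most \<open>r / 4\<close> are rare; if
  \<open>r\<close> grew with the dimension, this would be circular. The grid stands in for the
  sphere: it is finite, its coordinates are independent, and it is invariant under sign changes on
  any set of coordinates. The price is a rounding error of order \<open>1\<close> in every
  coordinate, which is harmless once \<open>card I \<le> N\<^sup>2\<close>.

  Weighted cliques see only the thresholds \<open>0\<close> and \<open>1/2\<close>. So positive
  weights may be rounded up to \<open>1/2\<close> or \<open>1\<close>, and nothing between these
  values has to be realised.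

  Clique counts, blow-ups, cluster graphs and weighted densities are all values of the one
  functional \<open>hom_sum\<close>, which is why it has free vertex weights \<open>p\<close> and
  free edge weights \<open>f\<close>.\<close>

definition hom_sum :: "nat \<Rightarrow> 'a set \<Rightarrow> ('a \<Rightarrow> real) \<Rightarrow> ('a \<Rightarrow> 'a \<Rightarrow> real) \<Rightarrow> real" where
  "hom_sum s W p f =
     (\<Sum>\<sigma> \<in> {1..s} \<rightarrow>\<^sub>E W. (\<Prod>i=1..s. p (\<sigma> i)) * (\<Prod>e\<in>complete_edges s. f (\<sigma> (Min e)) (\<sigma> (Max e))))"

definition adj :: "'a set set \<Rightarrow> 'a \<Rightarrow> 'a \<Rightarrow> real" where
  "adj E x y = of_bool ({x, y} \<in> E)"

lemma hom_density_eq_hom_sum: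
  "hom_density s (complete_edges s) R = hom_sum s (verts R) (vweight R) (eweight R)"
  by (simp add: hom_density_def hom_sum_def)

lemma finite_complete_edges [simp]: "finite (complete_edges s)"
  by (rule finite_subset[of _ "Pow {1..s}"]) (auto simp: complete_edges_def)

lemma complete_edgesD:
  assumes "e \<in> complete_edges s"
  shows "Min e \<in> {1..s}" "Max e \<in> {1..s}" "Min e < Max e" "e = {Min e, Max e}"
proof -
  have e: "e \<subseteq> {1..s}" "card e = 2" using assms by (auto simp: complete_edges_def)
  then obtain x y where xy: "e = {x, y}" "x \<noteq> y" by (auto simp: card_2_iff)
  show "Min e \<in> {1..s}" "Max e \<in> {1..s}" "Min e < Max e" "e = {Min e, Max e}"
    using e(1) xy by (auto simp: min_def max_def)
qed

lemma pair_in_complete_edges: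
  assumes "i \<in> {1..s}" "j \<in> {1..s}" "i \<noteq> j"
  shows "{i, j} \<in> complete_edges s"
  using assms by (auto simp: complete_edges_def)

lemma adj_sym: "adj E x y = adj E y x"
  by (simp add: adj_def insert_commute)

lemma adj_nonneg [simp]: "0 \<le> adj E x y" and adj_le_1 [simp]: "adj E x y \<le> 1"
  by (auto simp: adj_def)

section \<open>Cliques as injective edge-preserving maps\<close>

lemma simple_graphD:
  assumes "simple_graph V E"
  shows "finite V" "{x, y} \<in> E \<Longrightarrow> x \<in> V \<and> y \<in> V \<and> x \<noteq> y" "adj E x x = 0"
  using assms by (force simp: simple_graph_def adj_def)+

text \<open>Graphs have no loops, so a map that sends all pairs of indices to edges cannot identify
  two indices.\<close>

lemma prod_adj_eq:
  assumes "simple_graph W E"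
    and "\<sigma> \<in> {1..s} \<rightarrow>\<^sub>E W"
  shows "(\<Prod>e\<in>complete_edges s. adj E (\<sigma> (Min e)) (\<sigma> (Max e))) =
    of_bool (inj_on \<sigma> {1..s} \<and> is_clique W E (\<sigma> ` {1..s}))"
proof (cases "\<forall>e\<in>complete_edges s. {\<sigma> (Min e), \<sigma> (Max e)} \<in> E")
  case True
  have adj: "{\<sigma> i, \<sigma> j} \<in> E" if "i \<in> {1..s}" "j \<in> {1..s}" "i \<noteq> j" for i j
  proof -
    have "{\<sigma> (Min {i,j}), \<sigma> (Max {i,j})} \<in> E"
      using True pair_in_complete_edges[OF that] by blast
    then show ?thesis by (cases "i \<le> j") (auto simp: min_def max_def insert_commute)
  qed
  have "inj_on \<sigma> {1..s}"
    by (rule inj_onI, rule ccontr) (metis adj simple_graphD(2)[OF assms(1)])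
  moreover have "is_clique W E (\<sigma> ` {1..s})"
    using assms(2) adj by (fastforce simp: is_clique_def)
  ultimately show ?thesis using True by (simp add: adj_def)
next
  case False
  then obtain e where e: "e \<in> complete_edges s" "{\<sigma> (Min e), \<sigma> (Max e)} \<notin> E" by blast
  have "\<not> (inj_on \<sigma> {1..s} \<and> is_clique W E (\<sigma> ` {1..s}))"
    using e complete_edgesD[OF e(1)] unfolding is_clique_def inj_on_def
    by (metis image_eqI less_irrefl)
  moreover have "(\<Prod>e\<in>complete_edges s. adj E (\<sigma> (Min e)) (\<sigma> (Max e))) = 0"
    using e by (intro prod_zero) (auto simp: adj_def)
  ultimately show ?thesis by (simp only: of_bool_def simp_thms if_False)
qed

lemma card_bij_PiE:
  assumes "finite S" "card S = s" "S \<subseteq> W"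
  shows "card {\<sigma> \<in> {1..s} \<rightarrow>\<^sub>E W. inj_on \<sigma> {1..s} \<and> \<sigma> ` {1..s} = S} = fact s"
proof -
  have "{\<sigma> \<in> {1..s} \<rightarrow>\<^sub>E W. inj_on \<sigma> {1..s} \<and> \<sigma> ` {1..s} = S}
      = {\<sigma> \<in> {1..s} \<rightarrow>\<^sub>E S. inj_on \<sigma> {1..s}}"
  proof (intro equalityI subsetI)
    fix \<sigma> assume "\<sigma> \<in> {\<sigma> \<in> {1..s} \<rightarrow>\<^sub>E S. inj_on \<sigma> {1..s}}"
    then have s: "\<sigma> \<in> {1..s} \<rightarrow>\<^sub>E S" "inj_on \<sigma> {1..s}" by auto
    then have "\<sigma> ` {1..s} = S"
      using assms by (intro card_subset_eq) (auto simp: card_image)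
    with s assms show "\<sigma> \<in> {\<sigma> \<in> {1..s} \<rightarrow>\<^sub>E W. inj_on \<sigma> {1..s} \<and> \<sigma> ` {1..s} = S}"
      by (auto simp: PiE_iff)
  qed (auto simp: PiE_iff)
  moreover have "card {\<sigma> \<in> {1..s} \<rightarrow>\<^sub>E S. inj_on \<sigma> {1..s}} = fact s"
    using card_inj_on_subset_funcset[of "{1..s}" S "{1..s}"] assms
    by (simp add: fact_prod_rev)
  ultimately show ?thesis by simp
qed

text \<open>Labelled cliques are grouped by their image; every clique has \<open>fact s\<close>
  labellings.\<close>

lemma hom_sum_adj:
  assumes "simple_graph W E"
  shows "hom_sum s W p (adj E) = fact s * (\<Sum>S | is_clique W E S \<and> card S = s. \<Prod>v\<in>S. p v)"
proof -
  have fW: "finite W" using simple_graphD(1)[OF assms] .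
  define A where "A = {\<sigma> \<in> {1..s} \<rightarrow>\<^sub>E W. inj_on \<sigma> {1..s} \<and> is_clique W E (\<sigma> ` {1..s})}"
  have fA: "finite A" unfolding A_def using fW by (simp add: finite_PiE)
  have fC: "finite {S. is_clique W E S \<and> card S = s}"
    by (rule finite_subset[of _ "Pow W"]) (use fW in \<open>auto simp: is_clique_def\<close>)
  have "hom_sum s W p (adj E) = (\<Sum>\<sigma> \<in> {1..s} \<rightarrow>\<^sub>E W. if inj_on \<sigma> {1..s} \<and> is_clique W E (\<sigma> ` {1..s})
      then \<Prod>v\<in>\<sigma> ` {1..s}. p v else 0)"
    unfolding hom_sum_def
    by (intro sum.cong refl, subst prod_adj_eq[OF assms]) (auto simp: prod.reindex)
  also have "\<dots> = (\<Sum>\<sigma>\<in>A. \<Prod>v\<in>\<sigma> ` {1..s}. p v)"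
    unfolding A_def by (subst sum.inter_filter[symmetric]) (use fW in \<open>auto simp: finite_PiE\<close>)
  also have "\<dots> = (\<Sum>S | is_clique W E S \<and> card S = s.
      \<Sum>\<sigma> \<in> {\<sigma>\<in>A. \<sigma> ` {1..s} = S}. \<Prod>v\<in>\<sigma> ` {1..s}. p v)"
    by (rule sum.group[symmetric]) (use fA fC in \<open>auto simp: A_def card_image\<close>)
  also have "\<dots> = (\<Sum>S | is_clique W E S \<and> card S = s. fact s * (\<Prod>v\<in>S. p v))"
  proof (intro sum.cong refl)
    fix S assume "S \<in> {S. is_clique W E S \<and> card S = s}"
    then have S: "is_clique W E S" "card S = s" "S \<subseteq> W" by (auto simp: is_clique_def)
    have fS: "finite S" using S fW finite_subset by blast
    have "{\<sigma>\<in>A. \<sigma> ` {1..s} = S} = {\<sigma> \<in> {1..s} \<rightarrow>\<^sub>E W. inj_on \<sigma> {1..s} \<and> \<sigma> ` {1..s} = S}"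
      unfolding A_def using S by auto
    then have "card {\<sigma>\<in>A. \<sigma> ` {1..s} = S} = fact s"
      using card_bij_PiE[OF fS S(2,3)] by simp
    then show "(\<Sum>\<sigma> \<in> {\<sigma>\<in>A. \<sigma> ` {1..s} = S}. \<Prod>v\<in>\<sigma> ` {1..s}. p v) = fact s * (\<Prod>v\<in>S. p v)"
      by simp
  qed
  finally show ?thesis by (simp add: sum_distrib_left)
qed

lemma hom_sum_adj_uniform:
  assumes "simple_graph W E"
  shows "hom_sum s W (\<lambda>_. c) (adj E) = fact s * real (clique_count s W E) * c ^ s"
  by (simp add: hom_sum_adj[OF assms] clique_count_def)

text \<open>Serves two purposes: counting cliques in a blow-up, and passing from a partitioned graph
  to its cluster graph. Tuples in \<open>V\<close> are grouped by their colour pattern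
  \<open>\<tau>\<close>; each group is a product of colour classes, so its total weight
  factorises.\<close>

lemma hom_sum_pullback:
  assumes "finite V" "finite W" "c ` V \<subseteq> W"
  shows "hom_sum s V p (\<lambda>x y. g (c x) (c y)) = hom_sum s W (\<lambda>w. \<Sum>x | x \<in> V \<and> c x = w. p x) g"
proof -
  have fib: "{\<sigma> \<in> {1..s} \<rightarrow>\<^sub>E V. restrict (c \<circ> \<sigma>) {1..s} = \<tau>} = (\<Pi>\<^sub>E i\<in>{1..s}. {x. x \<in> V \<and> c x = \<tau> i})"
    if "\<tau> \<in> {1..s} \<rightarrow>\<^sub>E W" for \<tau>
  proof (intro equalityI subsetI)
    fix \<sigma> assume s: "\<sigma> \<in> (\<Pi>\<^sub>E i\<in>{1..s}. {x. x \<in> V \<and> c x = \<tau> i})"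
    have "restrict (c \<circ> \<sigma>) {1..s} = \<tau>"
      using s that by (intro extensionalityI[of _ "{1..s}"]) (auto simp: PiE_iff)
    with s show "\<sigma> \<in> {\<sigma> \<in> {1..s} \<rightarrow>\<^sub>E V. restrict (c \<circ> \<sigma>) {1..s} = \<tau>}"
      by (auto simp: PiE_iff)
  qed (auto simp: PiE_iff)
  have "hom_sum s V p (\<lambda>x y. g (c x) (c y)) =
    (\<Sum>\<tau> \<in> {1..s} \<rightarrow>\<^sub>E W. \<Sum>\<sigma> \<in> {\<sigma> \<in> {1..s} \<rightarrow>\<^sub>E V. restrict (c \<circ> \<sigma>) {1..s} = \<tau>}.
      (\<Prod>i=1..s. p (\<sigma> i)) * (\<Prod>e\<in>complete_edges s. g (c (\<sigma> (Min e))) (c (\<sigma> (Max e)))))"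
    unfolding hom_sum_def
    by (rule sum.group[symmetric]) (use assms in \<open>auto simp: finite_PiE PiE_iff\<close>)
  also have "\<dots> = (\<Sum>\<tau> \<in> {1..s} \<rightarrow>\<^sub>E W. \<Sum>\<sigma> \<in> {\<sigma> \<in> {1..s} \<rightarrow>\<^sub>E V. restrict (c \<circ> \<sigma>) {1..s} = \<tau>}.
      (\<Prod>i=1..s. p (\<sigma> i)) * (\<Prod>e\<in>complete_edges s. g (\<tau> (Min e)) (\<tau> (Max e))))"
  proof (intro sum.cong refl arg_cong2[of _ _ _ _ "(*)"] prod.cong)
    fix \<tau> \<sigma> e
    assume "\<sigma> \<in> {\<sigma> \<in> {1..s} \<rightarrow>\<^sub>E V. restrict (c \<circ> \<sigma>) {1..s} = \<tau>}" and e: "e \<in> complete_edges s"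
    then have "\<tau> = restrict (c \<circ> \<sigma>) {1..s}" by simp
    then show "g (c (\<sigma> (Min e))) (c (\<sigma> (Max e))) = g (\<tau> (Min e)) (\<tau> (Max e))"
      using complete_edgesD(1,2)[OF e] by simp
  qed
  also have "\<dots> = (\<Sum>\<tau> \<in> {1..s} \<rightarrow>\<^sub>E W. (\<Prod>i=1..s. \<Sum>x | x \<in> V \<and> c x = \<tau> i. p x) *
      (\<Prod>e\<in>complete_edges s. g (\<tau> (Min e)) (\<tau> (Max e))))"
  proof (intro sum.cong refl)
    fix \<tau> assume t: "\<tau> \<in> {1..s} \<rightarrow>\<^sub>E W"
    have "(\<Prod>i=1..s. \<Sum>x | x \<in> V \<and> c x = \<tau> i. p x) =
        (\<Sum>\<sigma> \<in> (\<Pi>\<^sub>E i\<in>{1..s}. {x. x \<in> V \<and> c x = \<tau> i}). \<Prod>i=1..s. p (\<sigma> i))"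
      by (rule prod_sum_PiE) (use assms(1) in auto)
    then show "(\<Sum>\<sigma> \<in> {\<sigma> \<in> {1..s} \<rightarrow>\<^sub>E V. restrict (c \<circ> \<sigma>) {1..s} = \<tau>}.
        (\<Prod>i=1..s. p (\<sigma> i)) * (\<Prod>e\<in>complete_edges s. g (\<tau> (Min e)) (\<tau> (Max e)))) =
      (\<Prod>i=1..s. \<Sum>x | x \<in> V \<and> c x = \<tau> i. p x) * (\<Prod>e\<in>complete_edges s. g (\<tau> (Min e)) (\<tau> (Max e)))"
      unfolding fib[OF t] by (simp only: sum_distrib_right)
  qed
  finally show ?thesis unfolding hom_sum_def .
qed

lemma tendsto_hom_sum:
  assumes "\<And>w. w \<in> W \<Longrightarrow> ((\<lambda>n. p n w) \<longlongrightarrow> q w) F"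
  shows "((\<lambda>n. hom_sum s W (p n) f) \<longlongrightarrow> hom_sum s W q f) F"
  unfolding hom_sum_def
  by (intro tendsto_sum tendsto_mult tendsto_prod tendsto_const) (use assms in \<open>auto simp: PiE_iff\<close>)

lemma hom_sum_mono:
  assumes "\<And>x. x \<in> W \<Longrightarrow> 0 \<le> p x"
    and "\<And>x y. x \<in> W \<Longrightarrow> y \<in> W \<Longrightarrow> 0 \<le> f x y \<and> f x y \<le> g x y"
  shows "hom_sum s W p f \<le> hom_sum s W p g"
  unfolding hom_sum_def
proof (intro sum_mono mult_left_mono prod_mono prod_nonneg ballI)
  fix \<sigma> e assume "\<sigma> \<in> {1..s} \<rightarrow>\<^sub>E W" "e \<in> complete_edges s"
  then show "0 \<le> f (\<sigma> (Min e)) (\<sigma> (Max e)) \<and> f (\<sigma> (Min e)) (\<sigma> (Max e)) \<le> g (\<sigma> (Min e)) (\<sigma> (Max e))"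
    using assms(2) complete_edgesD(1,2) by (metis PiE_mem)
qed (use assms(1) in \<open>auto simp: PiE_iff\<close>)

lemma hom_sum_nonneg:
  assumes "\<And>x. x \<in> W \<Longrightarrow> 0 \<le> p x" "\<And>x y. x \<in> W \<Longrightarrow> y \<in> W \<Longrightarrow> 0 \<le> f x y"
  shows "0 \<le> hom_sum s W p f"
  unfolding hom_sum_def
proof (intro sum_nonneg mult_nonneg_nonneg prod_nonneg ballI)
  fix \<sigma> e assume "\<sigma> \<in> {1..s} \<rightarrow>\<^sub>E W" "e \<in> complete_edges s"
  then show "0 \<le> f (\<sigma> (Min e)) (\<sigma> (Max e))"
    using assms(2) complete_edgesD(1,2) by (metis PiE_mem)
qed (use assms(1) in \<open>auto simp: PiE_iff\<close>)

lemma hom_sum_one: "finite W \<Longrightarrow> hom_sum s W p (\<lambda>_ _. 1) = (\<Sum>x\<in>W. p x) ^ s"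
  using prod_sum_PiE[of "{1..s}" "\<lambda>_. W" "\<lambda>_. p"] by (simp add: hom_sum_def)

lemma hom_sum_le_1:
  assumes "finite W" "\<And>x. x \<in> W \<Longrightarrow> 0 \<le> p x" "(\<Sum>x\<in>W. p x) = 1"
    and "\<And>x y. x \<in> W \<Longrightarrow> y \<in> W \<Longrightarrow> 0 \<le> f x y \<and> f x y \<le> 1"
  shows "hom_sum s W p f \<le> 1"
  using hom_sum_mono[of W p f "\<lambda>_ _. 1" s] assms by (simp add: hom_sum_one)

section \<open>Blow-ups and convergence of the Ramsey--Turan ratio\<close>

lemma finite_independent: "finite V \<Longrightarrow> finite {card S | S. is_independent V E S}"
  by (rule finite_subset[of _ "card ` Pow V"]) (auto simp: is_independent_def)

lemma independence_number_less:
  assumes "finite V" "\<And>S. is_independent V E S \<Longrightarrow> real (card S) < l"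
  shows "real (independence_number V E) < l"
proof -
  have "independence_number V E \<in> {card S | S. is_independent V E S}"
    unfolding independence_number_def
  proof (rule Max_in[OF finite_independent[OF assms(1)]])
    have "is_independent V E {}" by (simp add: is_independent_def)
    then show "{card S | S. is_independent V E S} \<noteq> {}" by blast
  qed
  then obtain S where "independence_number V E = card S" "is_independent V E S" by blast
  then show ?thesis using assms(2) by simp
qed

lemma card_le_independence_number:
  assumes "finite V" "is_independent V E S"
  shows "card S \<le> independence_number V E"
  unfolding independence_number_def
  by (rule Max_ge[OF finite_independent[OF assms(1)]]) (use assms(2) in blast)

lemma clique_count_le: "finite V \<Longrightarrow> clique_count s V E \<le> card V choose s"
proof -
  assume "finite V"
  then have "clique_count s V E \<le> card {S. S \<subseteq> V \<and> card S = s}"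
    unfolding clique_count_def by (intro card_mono) (auto simp: is_clique_def)
  then show ?thesis using n_subsets[OF \<open>finite V\<close>] by simp
qed

lemma RT_finite:
  fixes n s t :: nat
  shows "finite {clique_count s {..<n} E | E.
     simple_graph {..<n} E \<and> clique_free t {..<n} E \<and> real (independence_number {..<n} E) < l}"
proof (rule finite_subset)
  show "{clique_count s {..<n} E | E.
     simple_graph {..<n} E \<and> clique_free t {..<n} E \<and> real (independence_number {..<n} E) < l}
     \<subseteq> {..n choose s}"
    using clique_count_le[of "{..<n}" s] by auto
qed simp

lemma clique_count_le_RT:
  assumes "simple_graph {..<n} E" "clique_free t {..<n} E" "real (independence_number {..<n} E) < l"
  shows "clique_count s {..<n} E \<le> RT n s t l"
proof -
  have "clique_count s {..<n} E \<in> {clique_count s {..<n} E | E.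
     simple_graph {..<n} E \<and> clique_free t {..<n} E \<and> real (independence_number {..<n} E) < l}"
    using assms by blast
  then show ?thesis unfolding RT_def by (rule le_cSup_finite[OF RT_finite])
qed

text \<open>A nonzero value rules out the empty family, whose \<open>Sup\<close> is
  \<open>0\<close>, so the supremum is a maximum.\<close>

lemma RT_attained:
  assumes "RT n s t l \<noteq> 0"
  obtains E where "simple_graph {..<n} E" "clique_free t {..<n} E"
    "real (independence_number {..<n} E) < l" "clique_count s {..<n} E = RT n s t l"
proof -
  let ?X = "{clique_count s {..<n} E | E.
     simple_graph {..<n} E \<and> clique_free t {..<n} E \<and> real (independence_number {..<n} E) < l}"
  have ne: "?X \<noteq> {}" using assms unfolding RT_def by (intro notI) simp
  have "RT n s t l = Max ?X" unfolding RT_def by (rule cSup_eq_Max[OF RT_finite ne])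
  then have "RT n s t l \<in> ?X" using Max_in[OF RT_finite ne] by (rule ssubst)
  then obtain E where "RT n s t l = clique_count s {..<n} E" "simple_graph {..<n} E"
    "clique_free t {..<n} E" "real (independence_number {..<n} E) < l" by blast
  then show ?thesis by (intro that[of E]) auto
qed

lemma RT_le: "RT n s t l \<le> n choose s"
proof (cases "RT n s t l = 0")
  case False
  then show ?thesis using RT_attained clique_count_le[of "{..<n}" s] by (metis card_lessThan finite_lessThan)
qed simp

text \<open>\<open>RT_ratio\<close> divides by \<open>n choose s\<close>, while
  \<open>hom_sum\<close> with uniform weights amounts to dividing by \<open>n ^ s / fact s\<close>;
  this is the exchange factor between the two.\<close>

lemma tendsto_pow_over_binomial:
  "(\<lambda>n. real n ^ s / (fact s * real (n choose s))) \<longlonglongrightarrow> 1"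
proof -
  have "(\<lambda>n. inverse (\<Prod>i<s. 1 - real i / real n)) \<longlonglongrightarrow> inverse (\<Prod>i<s. 1 - 0)"
    by (intro tendsto_inverse tendsto_prod tendsto_diff tendsto_const lim_const_over_n) auto
  moreover have "\<forall>\<^sub>F n in sequentially.
      inverse (\<Prod>i<s. 1 - real i / real n) = real n ^ s / (fact s * real (n choose s))"
    using eventually_gt_at_top[of 0]
  proof eventually_elim
    case (elim n)
    have "fact s * real (n choose s) = (\<Prod>i<s. real n - real i)"
      using gbinomial_mult_fact[of s "real n"] by (simp add: binomial_gbinomial atLeast0LessThan)
    also have "\<dots> = (\<Prod>i<s. real n * (1 - real i / real n))"
      using elim by (intro prod.cong) (auto simp: field_simps)
    also have "\<dots> = real n ^ s * (\<Prod>i<s. 1 - real i / real n)"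
      by (simp add: prod.distrib)
    finally show ?case using elim by (simp add: field_simps)
  qed
  ultimately show ?thesis by (simp add: Lim_transform_eventually)
qed

section \<open>Blow-ups with prescribed class sizes\<close>

lemma exists_colouring:
  assumes "finite W" "(\<Sum>w\<in>W. m w) = n"
  obtains c where "c ` {..<n} \<subseteq> W" "\<And>w. w \<in> W \<Longrightarrow> card {x. x < n \<and> c x = w} = m w"
proof -
  have "card {..<n} = card (Sigma W (\<lambda>w. {..<m w}))" using assms by simp
  then obtain h where h: "bij_betw h {..<n} (Sigma W (\<lambda>w. {..<m w}))"
    using finite_same_card_bij[of "{..<n}" "Sigma W (\<lambda>w. {..<m w})"] assms(1) by auto
  have "(fst \<circ> h) ` {..<n} \<subseteq> W"
  proof (intro image_subsetI)
    fix x assume "x \<in> {..<n}"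
    then have "h x \<in> Sigma W (\<lambda>w. {..<m w})" using bij_betwE[OF h] by blast
    then show "(fst \<circ> h) x \<in> W" by auto
  qed
  moreover have "card {x. x < n \<and> (fst \<circ> h) x = w} = m w" if "w \<in> W" for w
  proof -
    have "h ` {x. x < n \<and> (fst \<circ> h) x = w} = {w} \<times> {..<m w}"
    proof (intro equalityI subsetI)
      fix z assume z: "z \<in> {w} \<times> {..<m w}"
      then have "z \<in> h ` {..<n}" using that h by (auto simp: bij_betw_def)
      then obtain x where "x < n" "z = h x" by blast
      with z show "z \<in> h ` {x. x < n \<and> (fst \<circ> h) x = w}"
        by (intro image_eqI[of _ _ x]) (auto simp: mem_Times_iff)
    qed (use bij_betwE[OF h] in force)
    moreover have "inj_on h {x. x < n \<and> (fst \<circ> h) x = w}"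
      using h by (auto simp: bij_betw_def intro: inj_on_subset)
    ultimately have "card {x. x < n \<and> (fst \<circ> h) x = w} = card ({w} \<times> {..<m w})"
      by (metis card_image)
    then show ?thesis by (simp add: card_cartesian_product)
  qed
  ultimately show ?thesis using that by blast
qed

text \<open>Vertices of equal colour are non-adjacent as soon as \<open>E\<close> is loop-free,
  because \<open>{c x, c x}\<close> is a singleton.\<close>

definition blowup :: "nat \<Rightarrow> (nat \<Rightarrow> 'a) \<Rightarrow> 'a set set \<Rightarrow> nat set set" where
  "blowup n c E = {{x, y} | x y. x < n \<and> y < n \<and> {c x, c y} \<in> E}"

lemma blowup_iff: "{x, y} \<in> blowup n c E \<longleftrightarrow> x < n \<and> y < n \<and> {c x, c y} \<in> E"
proof
  assume "{x, y} \<in> blowup n c E"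
  then obtain x' y' where *: "{x, y} = {x', y'}" "x' < n" "y' < n" "{c x', c y'} \<in> E"
    unfolding blowup_def by blast
  from *(1) consider "x = x'" "y = y'" | "x = y'" "y = x'" by (metis doubleton_eq_iff)
  then show "x < n \<and> y < n \<and> {c x, c y} \<in> E"
    using * by cases (auto simp: insert_commute)
qed (unfold blowup_def, blast)

context
  fixes W :: "'a set" and E and n :: nat and c
  assumes G: "simple_graph W E" and c: "c ` {..<n} \<subseteq> W"
begin

lemma simple_graph_blowup: "simple_graph {..<n} (blowup n c E)"
  using simple_graphD(2)[OF G] by (force simp: simple_graph_def blowup_def card_2_iff)

text \<open>Adjacent vertices have different colours, so a clique of the blow-up maps injectively
  onto a clique of \<open>E\<close>.\<close>

lemma clique_free_blowup:
  assumes "clique_free t W E"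
  shows "clique_free t {..<n} (blowup n c E)"
  unfolding clique_free_def
proof
  assume "\<exists>S. is_clique {..<n} (blowup n c E) S \<and> card S = t"
  then obtain S where S: "is_clique {..<n} (blowup n c E) S" "card S = t" by blast
  then have adj: "{c x, c y} \<in> E" if "x \<in> S" "y \<in> S" "x \<noteq> y" for x y
    using that by (auto simp: is_clique_def blowup_iff)
  have "inj_on c S"
    by (rule inj_onI, rule ccontr) (metis adj simple_graphD(2)[OF G])
  then have "card (c ` S) = t" using S card_image by blast
  moreover have "is_clique W E (c ` S)"
    using S(1) c adj unfolding is_clique_def by blast
  ultimately show False using assms by (auto simp: clique_free_def)
qed

lemma independent_blowup:
  assumes "is_independent {..<n} (blowup n c E) S"
  shows "is_independent W E (c ` S)"
  using assms c by (auto simp: is_independent_def blowup_iff subset_iff)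

end

lemma multiplicities_exist:
  assumes "finite W" "\<And>w. w \<in> W \<Longrightarrow> 0 \<le> p w" "(\<Sum>w\<in>W. p w) = (1::real)"
  obtains m :: "nat \<Rightarrow> 'a \<Rightarrow> nat"
  where "\<And>n. (\<Sum>w\<in>W. m n w) = n" "\<And>w. w \<in> W \<Longrightarrow> (\<lambda>n. real (m n w) / real n) \<longlonglongrightarrow> p w"
proof -
  have "W \<noteq> {}" using assms(3) by auto
  then obtain w0 where w0: "w0 \<in> W" by blast
  define fl where "fl n w = nat \<lfloor>p w * real n\<rfloor>" for n w
  \<comment> \<open>Rounding down everywhere leaves a surplus. The single vertex \<open>w0\<close>
    absorbs it, so the sum is exactly \<open>n\<close>.\<close>
  define m where "m n w = (if w = w0 then n - (\<Sum>w\<in>W-{w0}. fl n w) else fl n w)" for n w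
  have fl: "real (fl n w) \<le> p w * n" "p w * n - 1 \<le> real (fl n w)" if "w \<in> W" for n w
    using assms(2)[OF that] by (auto simp: fl_def of_nat_nat zero_le_mult_iff)
  have psum: "(\<Sum>w\<in>W-{w0}. p w) = 1 - p w0" using assms(1,3) w0 by (simp add: sum_diff1)
  have "(\<Sum>w\<in>W-{w0}. real (fl n w)) \<le> (\<Sum>w\<in>W-{w0}. p w * n)" for n
    using fl by (intro sum_mono) auto
  then have "(\<Sum>w\<in>W-{w0}. real (fl n w)) \<le> (1 - p w0) * n" for n
    by (simp add: sum_distrib_right[symmetric] psum)
  moreover have "(1 - p w0) * real n \<le> 1 * real n" for n
    using assms(2)[OF w0] by (intro mult_right_mono) auto
  ultimately have "(\<Sum>w\<in>W-{w0}. real (fl n w)) \<le> real n" for n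
    by (metis mult_1 order_trans)
  then have le: "(\<Sum>w\<in>W-{w0}. fl n w) \<le> n" for n
    by (metis of_nat_le_iff of_nat_sum)
  have sm: "(\<Sum>w\<in>W. m n w) = n" for n
  proof -
    have "(\<Sum>w\<in>W. m n w) = m n w0 + (\<Sum>w\<in>W-{w0}. m n w)"
      using assms(1) w0 by (simp add: sum.remove)
    also have "(\<Sum>w\<in>W-{w0}. m n w) = (\<Sum>w\<in>W-{w0}. fl n w)"
      by (intro sum.cong) (auto simp: m_def)
    finally show ?thesis using le[of n] by (simp add: m_def)
  qed
  have flim: "(\<lambda>n. real (fl n w) / real n) \<longlonglongrightarrow> p w" if "w \<in> W" for w
  proof (rule tendsto_sandwich)
    have "(\<lambda>n. p w - 1 / real n) \<longlonglongrightarrow> p w - 0"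
      by (intro tendsto_diff tendsto_const lim_const_over_n)
    then show "(\<lambda>n. p w - 1 / real n) \<longlonglongrightarrow> p w" by simp
    show "\<forall>\<^sub>F n in sequentially. p w - 1 / real n \<le> real (fl n w) / real n"
      using eventually_gt_at_top[of 0]
    proof eventually_elim
      case (elim n)
      have "p w - 1 / real n = (p w * n - 1) / real n" using elim by (simp add: field_simps)
      also have "\<dots> \<le> real (fl n w) / real n" by (intro divide_right_mono fl(2)[OF that]) simp
      finally show ?case .
    qed
    show "\<forall>\<^sub>F n in sequentially. real (fl n w) / real n \<le> p w"
      using eventually_gt_at_top[of 0] by eventually_elim (use fl(1)[OF that] in \<open>auto simp: field_simps\<close>)
  qed simp
  have "(\<lambda>n. real (m n w) / real n) \<longlonglongrightarrow> p w" if "w \<in> W" for w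
  proof (cases "w = w0")
    case True
    have "(\<lambda>n. 1 - (\<Sum>w\<in>W-{w0}. real (fl n w) / real n)) \<longlonglongrightarrow> 1 - (\<Sum>w\<in>W-{w0}. p w)"
      by (intro tendsto_diff tendsto_const tendsto_sum flim) auto
    moreover have "\<forall>\<^sub>F n in sequentially. 1 - (\<Sum>w\<in>W-{w0}. real (fl n w) / real n) = real (m n w) / real n"
      using eventually_gt_at_top[of 0]
    proof eventually_elim
      case (elim n)
      show ?case using elim le[of n] True
        by (simp add: m_def of_nat_diff diff_divide_distrib sum_divide_distrib)
    qed
    ultimately have "(\<lambda>n. real (m n w) / real n) \<longlonglongrightarrow> 1 - (\<Sum>w\<in>W-{w0}. p w)"
      by (rule Lim_transform_eventually)
    then show ?thesis using True psum by simp
  next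
    case False
    then show ?thesis using flim[OF that] by (simp add: m_def)
  qed
  with sm show ?thesis using that by blast
qed

lemma RT_ratio_liminf:
  assumes G: "simple_graph W E" "clique_free t W E"
    and p: "\<And>w. w \<in> W \<Longrightarrow> 0 \<le> p w" "(\<Sum>w\<in>W. p w) = 1"
    and ind: "\<And>I. is_independent W E I \<Longrightarrow> (\<Sum>w\<in>I. p w) < \<delta>"
    and "0 < \<epsilon>"
  shows "\<forall>\<^sub>F n in sequentially. RT_ratio s t \<delta> n > hom_sum s W p (adj E) - \<epsilon>"
proof -
  have fW: "finite W" using simple_graphD(1)[OF G(1)] .
  obtain m :: "nat \<Rightarrow> 'a \<Rightarrow> nat" where m: "\<And>n. (\<Sum>w\<in>W. m n w) = n"
    "\<And>w. w \<in> W \<Longrightarrow> (\<lambda>n. real (m n w) / real n) \<longlonglongrightarrow> p w"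
    using multiplicities_exist[OF fW p] by blast
  define r where "r n = real n ^ s / (fact s * real (n choose s))" for n
  define D where "D n = hom_sum s W (\<lambda>w. real (m n w) / real n) (adj E)" for n
  have "(\<lambda>n. D n * r n) \<longlonglongrightarrow> hom_sum s W p (adj E) * 1"
    unfolding D_def r_def by (intro tendsto_mult tendsto_hom_sum m tendsto_pow_over_binomial)
  then have ev1: "\<forall>\<^sub>F n in sequentially. D n * r n > hom_sum s W p (adj E) - \<epsilon>"
    using assms(6) by (intro order_tendstoD) auto
  \<comment> \<open>There are finitely many independent sets, and the bound on each is strict, so
    all bounds survive the rounding simultaneously for large \<open>n\<close>.\<close>
  have "\<forall>\<^sub>F n in sequentially. \<forall>I\<in>{I. is_independent W E I}. (\<Sum>w\<in>I. real (m n w) / real n) < \<delta>"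
  proof (intro eventually_ball_finite ballI)
    show "finite {I. is_independent W E I}"
      by (rule finite_subset[of _ "Pow W"]) (use fW in \<open>auto simp: is_independent_def\<close>)
    fix I assume "I \<in> {I. is_independent W E I}"
    then have I: "is_independent W E I" "I \<subseteq> W" by (auto simp: is_independent_def)
    have "(\<lambda>n. \<Sum>w\<in>I. real (m n w) / real n) \<longlonglongrightarrow> (\<Sum>w\<in>I. p w)"
      using I by (intro tendsto_sum m) auto
    then show "\<forall>\<^sub>F n in sequentially. (\<Sum>w\<in>I. real (m n w) / real n) < \<delta>"
      using ind[OF I(1)] order_tendstoD(2) by blast
  qed
  with ev1 show ?thesis using eventually_gt_at_top[of 0]
  proof eventually_elim
    case (elim n)
    obtain c where c: "c ` {..<n} \<subseteq> W" "\<And>w. w \<in> W \<Longrightarrow> card {x. x < n \<and> c x = w} = m n w"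
      using exists_colouring[OF fW m(1)[of n]] by metis
    let ?B = "blowup n c E"
    have B: "simple_graph {..<n} ?B" "clique_free t {..<n} ?B"
      using simple_graph_blowup[OF G(1) c(1)] clique_free_blowup[OF G(1) c(1) G(2)] by auto
    have "real (independence_number {..<n} ?B) < \<delta> * real n"
    proof (rule independence_number_less)
      fix S assume S: "is_independent {..<n} ?B S"
      have cS: "is_independent W E (c ` S)" using independent_blowup[OF G(1) c(1) S] .
      have sub: "S \<subseteq> {..<n}" using S by (auto simp: is_independent_def)
      have "S \<subseteq> (\<Union>w\<in>c ` S. {x. x < n \<and> c x = w})" using sub by auto
      then have "card S \<le> card (\<Union>w\<in>c ` S. {x. x < n \<and> c x = w})"
        using finite_subset[OF sub] by (intro card_mono) auto
      also have "\<dots> \<le> (\<Sum>w\<in>c ` S. card {x. x < n \<and> c x = w})"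
        using finite_subset[OF sub] by (intro card_UN_le) auto
      also have "\<dots> = (\<Sum>w\<in>c ` S. m n w)"
        using c sub by (intro sum.cong) auto
      finally have "real (card S) \<le> (\<Sum>w\<in>c ` S. real (m n w))"
        by (metis of_nat_mono of_nat_sum)
      moreover have "(\<Sum>w\<in>c ` S. real (m n w) / real n) < \<delta>" using elim(2) cS by auto
      ultimately show "real (card S) < \<delta> * real n"
        using elim(3) by (simp add: sum_divide_distrib[symmetric] field_simps)
    qed simp
    then have cnt: "clique_count s {..<n} ?B \<le> RT n s t (\<delta> * real n)"
      by (rule clique_count_le_RT[OF B])
    have "fact s * real (clique_count s {..<n} ?B) * (1 / real n) ^ s = hom_sum s {..<n} (\<lambda>_. 1 / real n) (adj ?B)"
      by (rule hom_sum_adj_uniform[OF B(1), symmetric])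
    also have "\<dots> = hom_sum s {..<n} (\<lambda>_. 1 / real n) (\<lambda>x y. adj E (c x) (c y))"
      unfolding hom_sum_def
    proof (intro sum.cong prod.cong refl arg_cong2[of _ _ _ _ "(*)"])
      fix \<sigma> e assume "\<sigma> \<in> {1..s} \<rightarrow>\<^sub>E {..<n}" "e \<in> complete_edges s"
      then have "\<sigma> (Min e) < n" "\<sigma> (Max e) < n"
        using complete_edgesD(1,2) by (blast dest: PiE_mem)+
      then show "adj ?B (\<sigma> (Min e)) (\<sigma> (Max e)) = adj E (c (\<sigma> (Min e))) (c (\<sigma> (Max e)))"
        by (simp add: adj_def blowup_iff)
    qed
    also have "\<dots> = hom_sum s W (\<lambda>w. \<Sum>x | x \<in> {..<n} \<and> c x = w. 1 / real n) (adj E)"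
      using fW c(1) by (intro hom_sum_pullback) auto
    also have "\<dots> = D n"
      unfolding D_def hom_sum_def
      by (intro sum.cong refl arg_cong2[of _ _ _ _ "(*)"] prod.cong) (use c(2) in \<open>auto simp: PiE_iff\<close>)
    finally have D: "D n = fact s * real (clique_count s {..<n} ?B) * (1 / real n) ^ s" by simp
    have "D n * r n = real (clique_count s {..<n} ?B) / real (n choose s)"
      using elim(3) by (simp add: D r_def field_simps)
    also have "\<dots> \<le> RT_ratio s t \<delta> n"
      unfolding RT_ratio_def using cnt by (intro divide_right_mono) auto
    finally show ?case using elim(1) by simp
  qed
qed

text \<open>A Fekete-type criterion: if every term is nearly a lower bound for all late terms, the
  sequence converges to its supremum. Blowing up provides the hypothesis.\<close>

lemma tendsto_Sup_if_eventually_ge: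
  fixes a :: "nat \<Rightarrow> real"
  assumes "\<And>n. a n \<le> B" "\<And>n \<epsilon>. 0 < \<epsilon> \<Longrightarrow> \<forall>\<^sub>F m in sequentially. a m > a n - \<epsilon>"
  shows "a \<longlonglongrightarrow> Sup (range a)"
proof (rule order_tendstoI)
  have bdd: "bdd_above (range a)" using assms(1) by (auto simp: bdd_above_def)
  fix y assume "y < Sup (range a)"
  then obtain n where "y < a n" using less_cSup_iff[OF _ bdd] by auto
  then show "\<forall>\<^sub>F m in sequentially. y < a m"
    using assms(2)[of "a n - y" n] by simp
next
  have bdd: "bdd_above (range a)" using assms(1) by (auto simp: bdd_above_def)
  fix y assume "Sup (range a) < y"
  then show "\<forall>\<^sub>F m in sequentially. a m < y"
    using cSup_upper[OF _ bdd] by (intro always_eventually) (auto intro: le_less_trans)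
qed

lemma convergent_RT_ratio: "convergent (RT_ratio s t \<delta>)"
proof -
  define r where "r n = real n ^ s / (fact s * real (n choose s))" for n
  \<comment> \<open>The homomorphism density of an extremal graph on \<open>n\<close> vertices.
    Blow-ups preserve this quantity, whereas \<open>RT_ratio\<close> is preserved only up to the
    factor \<open>r\<close>; so the criterion is applied to \<open>a\<close>.\<close>
  define a where "a n = fact s * real (RT n s t (\<delta> * real n)) * (1 / real n) ^ s" for n
  have rlim: "r \<longlonglongrightarrow> 1" unfolding r_def by (rule tendsto_pow_over_binomial)
  have a_le: "a n \<le> 1" for n
  proof (cases "n = 0")
    case True
    then show ?thesis using RT_le[of n s t "\<delta> * real n"]
      by (cases "s = 0") (auto simp: a_def power_0_left)
  next
    case False
    have "real (fact s * RT n s t (\<delta> * real n)) \<le> real (n ^ s)"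
      using RT_le[of n s t "\<delta> * real n"] binomial_fact_pow[of n s]
      by (intro of_nat_mono) (metis mult.commute mult_le_mono1 order_trans)
    then show ?thesis using False by (simp add: a_def field_simps)
  qed
  have a_nonneg: "0 \<le> a n" for n by (simp add: a_def)
  have ratio: "RT_ratio s t \<delta> n = a n * r n" if "n > 0" for n
    using that by (simp add: RT_ratio_def a_def r_def field_simps)
  have ev: "\<forall>\<^sub>F m in sequentially. RT_ratio s t \<delta> m > a n - \<epsilon>" if "0 < \<epsilon>" for n \<epsilon>
  proof (cases "RT n s t (\<delta> * real n) = 0 \<or> n = 0")
    case True
    then consider "a n = 0" | "n = 0" "s = 0" by (cases "s = 0") (auto simp: a_def)
    then show ?thesis
    proof cases
      case 1
      have "RT_ratio s t \<delta> m \<ge> 0" for m by (simp add: RT_ratio_def)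
      with that 1 show ?thesis by (intro always_eventually allI) (auto intro: less_le_trans[of _ 0])
    next
      \<comment> \<open>Here \<open>0 ^ 0 = 1\<close> could make \<open>a n\<close> positive, but no
        graph has independence number below \<open>\<delta> * 0\<close>.\<close>
      case 2
      show ?thesis
      proof (cases "RT n s t (\<delta> * real n) = 0")
        case True
        have "RT_ratio s t \<delta> m \<ge> 0" for m by (simp add: RT_ratio_def)
        with that True show ?thesis by (intro always_eventually allI) (auto simp: a_def intro: less_le_trans[of _ 0])
      next
        case False
        then obtain E where "real (independence_number {..<n} E) < \<delta> * real n"
          using RT_attained by blast
        then show ?thesis using 2 by simp
      qed
    qed
  next
    case False
    then have n: "n > 0" by simp
    from False obtain E where E: "simple_graph {..<n} E" "clique_free t {..<n} E"
      "real (independence_number {..<n} E) < \<delta> * real n"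
      "clique_count s {..<n} E = RT n s t (\<delta> * real n)"
      using RT_attained by blast
    have "\<forall>\<^sub>F m in sequentially. RT_ratio s t \<delta> m > hom_sum s {..<n} (\<lambda>_. 1 / real n) (adj E) - \<epsilon>"
    proof (rule RT_ratio_liminf[OF E(1,2) _ _ _ that])
      fix I assume "is_independent {..<n} E I"
      then have "real (card I) < \<delta> * real n"
        using card_le_independence_number[of "{..<n}" E I] E(3) by simp
      then show "(\<Sum>w\<in>I. 1 / real n) < \<delta>" using n by (simp add: field_simps)
    qed (use n in auto)
    then show ?thesis by (simp add: hom_sum_adj_uniform[OF E(1)] E(4) a_def)
  qed
  have "a \<longlonglongrightarrow> Sup (range a)"
  proof (rule tendsto_Sup_if_eventually_ge[OF a_le])
    fix \<epsilon> :: real and n' :: nat assume e: "0 < \<epsilon>"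
    have "\<forall>\<^sub>F m in sequentially. r m < 1 + \<epsilon> / 2"
      using order_tendstoD(2)[OF rlim, of "1 + \<epsilon>/2"] e by simp
    then show "\<forall>\<^sub>F m in sequentially. a m > a n' - \<epsilon>"
      using ev[OF half_gt_zero[OF e], of n'] eventually_gt_at_top[of 0]
    proof (eventually_elim)
      case (elim m)
      then have "a n' - \<epsilon>/2 < a m * r m" using e ratio by simp
      also have "\<dots> \<le> a m * (1 + \<epsilon>/2)" using elim a_nonneg by (intro mult_left_mono) auto
      also have "\<dots> = a m + a m * (\<epsilon> / 2)" by (simp add: algebra_simps)
      also have "\<dots> \<le> a m + 1 * (\<epsilon> / 2)" using a_le e by (intro add_left_mono mult_right_mono) auto
      finally show ?case by simp
    qed
  qed
  then have "(\<lambda>n. a n * r n) \<longlonglongrightarrow> Sup (range a) * 1" by (intro tendsto_mult rlim)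
  moreover have "\<forall>\<^sub>F n in sequentially. a n * r n = RT_ratio s t \<delta> n"
    using eventually_gt_at_top[of 0] by eventually_elim (simp add: ratio)
  ultimately have "RT_ratio s t \<delta> \<longlonglongrightarrow> Sup (range a) * 1"
    by (rule Lim_transform_eventually)
  then show ?thesis by (auto simp: convergent_def)
qed

section \<open>Counting lemma\<close>

lemma sum_PiE_insert:
  assumes "i \<notin> I"
  shows "(\<Sum>\<sigma>\<in>PiE (insert i I) T. \<phi> \<sigma>) = (\<Sum>x\<in>T i. \<Sum>\<sigma>\<in>PiE I T. \<phi> (\<sigma>(i := x)))"
proof -
  have "(\<Sum>\<sigma>\<in>PiE (insert i I) T. \<phi> \<sigma>) = (\<Sum>(x, \<sigma>)\<in>T i \<times> PiE I T. \<phi> (\<sigma>(i := x)))"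
    unfolding PiE_insert_eq
    by (subst sum.reindex[OF inj_combinator[OF assms]]) (simp add: case_prod_unfold)
  then show ?thesis by (simp add: sum.cartesian_product)
qed

lemma sum_weighted_le_sum_pos:
  fixes a u :: "'a \<Rightarrow> real"
  assumes "finite V" "\<And>x. x \<in> V \<Longrightarrow> 0 \<le> a x \<and> a x \<le> 1"
  shows "(\<Sum>x\<in>V. a x * u x) \<le> (\<Sum>x | x \<in> V \<and> u x > 0. u x)"
proof -
  have "(\<Sum>x\<in>V. a x * u x) \<le> (\<Sum>x\<in>V. if u x > 0 then u x else 0)"
  proof (intro sum_mono)
    fix x assume "x \<in> V"
    then show "a x * u x \<le> (if u x > 0 then u x else 0)"
      using assms(2)[of x] by (auto simp: mult_left_le_one_le mult_nonneg_nonpos)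
  qed
  also have "\<dots> = (\<Sum>x | x \<in> V \<and> u x > 0. u x)"
    using assms(1) by (simp add: sum.inter_filter)
  finally show ?thesis .
qed

text \<open>A bilinear form on a cube is largest at a corner: first \<open>a\<close>, then
  \<open>b\<close> is replaced by the indicator of the set where its coefficient is positive. Cut
  bounds for sets thus extend to fractional weights.\<close>

lemma bilinear_le_if_sets_le:
  fixes a b :: "'a \<Rightarrow> real"
  assumes "finite V" "\<And>x. x \<in> V \<Longrightarrow> 0 \<le> a x \<and> a x \<le> 1" "\<And>x. x \<in> V \<Longrightarrow> 0 \<le> b x \<and> b x \<le> 1"
    and sets: "\<And>A B. A \<subseteq> V \<Longrightarrow> B \<subseteq> V \<Longrightarrow> (\<Sum>x\<in>A. \<Sum>y\<in>B. h x y) \<le> \<kappa>"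
  shows "(\<Sum>x\<in>V. \<Sum>y\<in>V. a x * b y * h x y) \<le> \<kappa>"
proof -
  define A where "A = {x \<in> V. (\<Sum>y\<in>V. b y * h x y) > 0}"
  define B where "B = {y \<in> V. (\<Sum>x\<in>A. h x y) > 0}"
  have "(\<Sum>x\<in>V. \<Sum>y\<in>V. a x * b y * h x y) = (\<Sum>x\<in>V. a x * (\<Sum>y\<in>V. b y * h x y))"
    by (simp add: sum_distrib_left mult.assoc)
  also have "\<dots> \<le> (\<Sum>x\<in>A. \<Sum>y\<in>V. b y * h x y)"
    unfolding A_def by (rule sum_weighted_le_sum_pos[OF assms(1,2)])
  also have "\<dots> = (\<Sum>y\<in>V. b y * (\<Sum>x\<in>A. h x y))"
    by (subst sum.swap) (simp add: sum_distrib_left)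
  also have "\<dots> \<le> (\<Sum>y\<in>B. \<Sum>x\<in>A. h x y)"
    unfolding B_def by (rule sum_weighted_le_sum_pos[OF assms(1,3)])
  also have "\<dots> = (\<Sum>x\<in>A. \<Sum>y\<in>B. h x y)" by (rule sum.swap)
  also have "\<dots> \<le> \<kappa>" by (rule sets) (auto simp: A_def B_def)
  finally show ?thesis .
qed

text \<open>Once all coordinates other than the two ends of \<open>e\<^sub>0\<close> are fixed, every other edge contains at
  most one of these ends, so the remaining factors split as \<open>a x * b y\<close>.\<close>

lemma hom_sum_exchange_edge:
  fixes f g :: "'a \<Rightarrow> 'a \<Rightarrow> real"
  assumes fV: "finite V" and p: "\<And>x. x \<in> V \<Longrightarrow> 0 \<le> p x" "(\<Sum>x\<in>V. p x) = 1"
    and h: "\<And>e x y. e \<in> F \<Longrightarrow> x \<in> V \<Longrightarrow> y \<in> V \<Longrightarrow> 0 \<le> h e x y \<and> h e x y \<le> 1"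
    and cut: "\<And>a b. (\<And>x. x \<in> V \<Longrightarrow> 0 \<le> a x \<and> a x \<le> 1) \<Longrightarrow> (\<And>x. x \<in> V \<Longrightarrow> 0 \<le> b x \<and> b x \<le> 1)
      \<Longrightarrow> (\<Sum>x\<in>V. \<Sum>y\<in>V. a x * b y * (p x * p y * (f x y - g x y))) \<le> \<kappa>"
    and F: "F \<subseteq> complete_edges s" "e0 \<in> complete_edges s" "e0 \<notin> F"
  shows "(\<Sum>\<sigma> \<in> {1..s} \<rightarrow>\<^sub>E V. (\<Prod>i=1..s. p (\<sigma> i)) * ((\<Prod>e\<in>F. h e (\<sigma> (Min e)) (\<sigma> (Max e))) *
    (f (\<sigma> (Min e0)) (\<sigma> (Max e0)) - g (\<sigma> (Min e0)) (\<sigma> (Max e0))))) \<le> \<kappa>"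
proof -
  define i where "i = Min e0"
  define j where "j = Max e0"
  have ij: "i \<in> {1..s}" "j \<in> {1..s}" "i < j" "e0 = {i, j}"
    using complete_edgesD[OF F(2)] by (auto simp: i_def j_def)
  define I where "I = {1..s} - {i, j}"
  have I: "{1..s} = insert i (insert j I)" "i \<notin> insert j I" "j \<notin> I" "finite I"
    using ij by (auto simp: I_def)
  have fF: "finite F" using finite_subset[OF F(1)] by simp
  have eF: "Min e \<in> {1..s}" "Max e \<in> {1..s}" "e = {Min e, Max e}" "\<not> (i \<in> e \<and> j \<in> e)" if "e \<in> F" for e
  proof -
    have e: "e \<in> complete_edges s" using that F by auto
    show "Min e \<in> {1..s}" "Max e \<in> {1..s}" "e = {Min e, Max e}" using complete_edgesD[OF e] by auto
    show "\<not> (i \<in> e \<and> j \<in> e)"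
    proof
      assume "i \<in> e \<and> j \<in> e"
      then have "i \<in> {Min e, Max e}" "j \<in> {Min e, Max e}" using complete_edgesD(4)[OF e] by metis+
      then have "{i, j} = {Min e, Max e}" using ij(3) by auto
      then have "e0 = e" using complete_edgesD(4)[OF e] ij(4) by metis
      then show False using that F by auto
    qed
  qed
  define Fi where "Fi = {e \<in> F. i \<in> e}"
  define H where "H \<sigma> e = h e (\<sigma> (Min e)) (\<sigma> (Max e))" for \<sigma> e
  have inner: "(\<Sum>x\<in>V. \<Sum>y\<in>V. (\<Prod>k\<in>{1..s}. p ((\<sigma>(j := y, i := x)) k)) *
      ((\<Prod>e\<in>F. H (\<sigma>(j := y, i := x)) e) * (f x y - g x y))) \<le> (\<Prod>k\<in>I. p (\<sigma> k)) * \<kappa>"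
    if s: "\<sigma> \<in> I \<rightarrow>\<^sub>E V" for \<sigma>
  proof -
    have "V \<noteq> {}" using p(2) by auto
    then obtain v0 where v0: "v0 \<in> V" by blast
    \<comment> \<open>Edges in \<open>Fi\<close> avoid \<open>j\<close> and the remaining ones avoid
      \<open>i\<close>, so the filler \<open>v0\<close> is never read: \<open>a\<close> depends on
      \<open>x\<close> only and \<open>b\<close> on \<open>y\<close> only.\<close>
    define a where "a x = (\<Prod>e\<in>Fi. H (\<sigma>(j := v0, i := x)) e)" for x
    define b where "b y = (\<Prod>e\<in>F-Fi. H (\<sigma>(j := y, i := v0)) e)" for y
    have mem: "(\<sigma>(j := y, i := x)) k \<in> V" if "x \<in> V" "y \<in> V" "k \<in> {1..s}" for x y k
      using that s I(1) by (auto simp: PiE_iff)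
    have H01: "0 \<le> H (\<sigma>(j := y, i := x)) e \<and> H (\<sigma>(j := y, i := x)) e \<le> 1"
      if "x \<in> V" "y \<in> V" "e \<in> F" for x y e
      unfolding H_def using that by (intro h mem eF)
    have a01: "0 \<le> a x \<and> a x \<le> 1" if "x \<in> V" for x
      unfolding a_def using H01[OF that v0] by (auto simp: Fi_def intro!: prod_nonneg prod_le_1)
    have b01: "0 \<le> b y \<and> b y \<le> 1" if "y \<in> V" for y
      unfolding b_def using H01[OF v0 that] by (auto intro!: prod_nonneg prod_le_1)
    have split: "(\<Prod>e\<in>F. H (\<sigma>(j := y, i := x)) e) = a x * b y" for x y
    proof -
      have "(\<Prod>e\<in>F. H (\<sigma>(j := y, i := x)) e) =
          (\<Prod>e\<in>F-Fi. H (\<sigma>(j := y, i := x)) e) * (\<Prod>e\<in>Fi. H (\<sigma>(j := y, i := x)) e)"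
        using fF by (intro prod.subset_diff) (auto simp: Fi_def)
      also have "(\<Prod>e\<in>Fi. H (\<sigma>(j := y, i := x)) e) = a x"
        unfolding a_def
      proof (intro prod.cong refl)
        fix e assume e: "e \<in> Fi"
        then have "j \<notin> {Min e, Max e}" using eF(3,4)[of e] by (auto simp: Fi_def)
        then show "H (\<sigma>(j := y, i := x)) e = H (\<sigma>(j := v0, i := x)) e" by (simp add: H_def)
      qed
      also have "(\<Prod>e\<in>F-Fi. H (\<sigma>(j := y, i := x)) e) = b y"
        unfolding b_def
      proof (intro prod.cong refl)
        fix e assume e: "e \<in> F - Fi"
        then have "i \<notin> {Min e, Max e}" using eF(3)[of e] by (auto simp: Fi_def)
        then show "H (\<sigma>(j := y, i := x)) e = H (\<sigma>(j := y, i := v0)) e" by (simp add: H_def)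
      qed
      finally show ?thesis by (simp only: mult.commute)
    qed
    have pr: "(\<Prod>k\<in>{1..s}. p ((\<sigma>(j := y, i := x)) k)) = p x * p y * (\<Prod>k\<in>I. p (\<sigma> k))" for x y
    proof -
      have "(\<Prod>k\<in>{1..s}. p ((\<sigma>(j := y, i := x)) k)) =
          p x * (p y * (\<Prod>k\<in>I. p ((\<sigma>(j := y, i := x)) k)))"
      proof -
        have "(\<Prod>k\<in>insert i (insert j I). q k) = q i * (q j * (\<Prod>k\<in>I. q k))" for q :: "nat \<Rightarrow> real"
          using I(2-4) by simp
        then show ?thesis unfolding I(1) using ij(3) by simp
      qed
      also have "(\<Prod>k\<in>I. p ((\<sigma>(j := y, i := x)) k)) = (\<Prod>k\<in>I. p (\<sigma> k))"
        using I(2,3) by (intro prod.cong) auto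
      finally show ?thesis by (simp only: mult.assoc)
    qed
    have "(\<Sum>x\<in>V. \<Sum>y\<in>V. (\<Prod>k\<in>{1..s}. p ((\<sigma>(j := y, i := x)) k)) *
        ((\<Prod>e\<in>F. H (\<sigma>(j := y, i := x)) e) * (f x y - g x y)))
      = (\<Prod>k\<in>I. p (\<sigma> k)) * (\<Sum>x\<in>V. \<Sum>y\<in>V. a x * b y * (p x * p y * (f x y - g x y)))"
      unfolding split pr sum_distrib_left by (intro sum.cong refl) (simp add: algebra_simps)
    also have "\<dots> \<le> (\<Prod>k\<in>I. p (\<sigma> k)) * \<kappa>"
    proof (rule mult_left_mono)
      show "(\<Sum>x\<in>V. \<Sum>y\<in>V. a x * b y * (p x * p y * (f x y - g x y))) \<le> \<kappa>"
        by (rule cut[OF a01 b01])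
      show "0 \<le> (\<Prod>k\<in>I. p (\<sigma> k))"
        using s p(1) by (intro prod_nonneg) (auto simp: PiE_iff)
    qed
    finally show ?thesis .
  qed
  define \<Phi> where "\<Phi> \<sigma> = (\<Prod>k\<in>{1..s}. p (\<sigma> k)) * ((\<Prod>e\<in>F. H \<sigma> e) * (f (\<sigma> i) (\<sigma> j) - g (\<sigma> i) (\<sigma> j)))" for \<sigma>
  have upd: "(\<sigma>(j := y, i := x)) i = x" "(\<sigma>(j := y, i := x)) j = y" for \<sigma> :: "nat \<Rightarrow> 'a" and x y
    using ij(3) by auto
  have "(\<Sum>\<sigma> \<in> {1..s} \<rightarrow>\<^sub>E V. \<Phi> \<sigma>) = (\<Sum>x\<in>V. \<Sum>y\<in>V. \<Sum>\<sigma> \<in> I \<rightarrow>\<^sub>E V. \<Phi> (\<sigma>(j := y, i := x)))"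
    by (simp only: I(1) sum_PiE_insert[OF I(2)] sum_PiE_insert[OF I(3)])
  also have "\<dots> = (\<Sum>x\<in>V. \<Sum>y\<in>V. \<Sum>\<sigma> \<in> I \<rightarrow>\<^sub>E V. (\<Prod>k\<in>{1..s}. p ((\<sigma>(j := y, i := x)) k)) *
      ((\<Prod>e\<in>F. H (\<sigma>(j := y, i := x)) e) * (f x y - g x y)))"
    by (simp only: \<Phi>_def upd)
  also have "\<dots> = (\<Sum>\<sigma> \<in> I \<rightarrow>\<^sub>E V. \<Sum>x\<in>V. \<Sum>y\<in>V. (\<Prod>k\<in>{1..s}. p ((\<sigma>(j := y, i := x)) k)) *
      ((\<Prod>e\<in>F. H (\<sigma>(j := y, i := x)) e) * (f x y - g x y)))"
  proof -
    have "(\<Sum>x\<in>V. \<Sum>y\<in>V. \<Sum>\<sigma> \<in> I \<rightarrow>\<^sub>E V. q x y \<sigma>) = (\<Sum>\<sigma> \<in> I \<rightarrow>\<^sub>E V. \<Sum>x\<in>V. \<Sum>y\<in>V. q x y \<sigma>)"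
      for q :: "'a \<Rightarrow> 'a \<Rightarrow> _ \<Rightarrow> real"
    proof -
      have "(\<Sum>x\<in>V. \<Sum>y\<in>V. \<Sum>\<sigma> \<in> I \<rightarrow>\<^sub>E V. q x y \<sigma>) = (\<Sum>x\<in>V. \<Sum>\<sigma> \<in> I \<rightarrow>\<^sub>E V. \<Sum>y\<in>V. q x y \<sigma>)"
        by (rule sum.cong[OF refl]) (rule sum.swap)
      then show ?thesis by (simp only: sum.swap[of _ "I \<rightarrow>\<^sub>E V" V])
    qed
    then show ?thesis .
  qed
  also have "\<dots> \<le> (\<Sum>\<sigma> \<in> I \<rightarrow>\<^sub>E V. (\<Prod>k\<in>I. p (\<sigma> k)) * \<kappa>)"
    by (intro sum_mono inner)
  also have "\<dots> = \<kappa>"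
  proof -
    have "(\<Sum>\<sigma> \<in> I \<rightarrow>\<^sub>E V. \<Prod>k\<in>I. p (\<sigma> k)) = (\<Prod>k\<in>I. \<Sum>x\<in>V. p x)"
      using I fV by (intro prod_sum_PiE[symmetric]) auto
    then show ?thesis using p(2) by (simp add: sum_distrib_right[symmetric])
  qed
  finally show ?thesis by (simp only: \<Phi>_def H_def i_def j_def)
qed

text \<open>A hybrid argument: \<open>g\<close> is exchanged for \<open>f\<close> one edge at a
  time, at a cost of at most \<open>\<kappa>\<close> each. A one-sided cut bound gives a one-sided
  comparison, which is all an upper bound on clique counts asks for.\<close>

lemma hom_sum_counting:
  fixes f g :: "'a \<Rightarrow> 'a \<Rightarrow> real"
  assumes fV: "finite V" and p: "\<And>x. x \<in> V \<Longrightarrow> 0 \<le> p x" "(\<Sum>x\<in>V. p x) = 1"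
    and f: "\<And>x y. x \<in> V \<Longrightarrow> y \<in> V \<Longrightarrow> 0 \<le> f x y \<and> f x y \<le> 1"
    and g: "\<And>x y. x \<in> V \<Longrightarrow> y \<in> V \<Longrightarrow> 0 \<le> g x y \<and> g x y \<le> 1"
    and cut: "\<And>a b. (\<And>x. x \<in> V \<Longrightarrow> 0 \<le> a x \<and> a x \<le> 1) \<Longrightarrow> (\<And>x. x \<in> V \<Longrightarrow> 0 \<le> b x \<and> b x \<le> 1)
      \<Longrightarrow> (\<Sum>x\<in>V. \<Sum>y\<in>V. a x * b y * (p x * p y * (f x y - g x y))) \<le> \<kappa>"
  shows "hom_sum s V p f \<le> hom_sum s V p g + real (card (complete_edges s)) * \<kappa>"
proof -
  define T where "T F = (\<Sum>\<sigma> \<in> {1..s} \<rightarrow>\<^sub>E V. (\<Prod>i=1..s. p (\<sigma> i)) *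
      (\<Prod>e\<in>complete_edges s. (if e \<in> F then f else g) (\<sigma> (Min e)) (\<sigma> (Max e))))" for F
  have "T F \<le> T {} + real (card F) * \<kappa>" if "F \<subseteq> complete_edges s" for F
    using finite_subset[OF that finite_complete_edges] that
  proof (induction F rule: finite_induct)
    case (insert e0 F)
    have e0: "e0 \<in> complete_edges s" using insert by auto
    let ?h = "\<lambda>e. if e \<in> F then f else g"
    have "T (insert e0 F) - T F = (\<Sum>\<sigma> \<in> {1..s} \<rightarrow>\<^sub>E V. (\<Prod>i=1..s. p (\<sigma> i)) *
      ((\<Prod>e\<in>complete_edges s - {e0}. ?h e (\<sigma> (Min e)) (\<sigma> (Max e))) *
      (f (\<sigma> (Min e0)) (\<sigma> (Max e0)) - g (\<sigma> (Min e0)) (\<sigma> (Max e0)))))"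
      unfolding T_def sum_subtractf[symmetric]
    proof (intro sum.cong refl)
      fix \<sigma>
      let ?P = "\<lambda>F. (\<Prod>e\<in>complete_edges s. (if e \<in> F then f else g) (\<sigma> (Min e)) (\<sigma> (Max e)))"
      let ?Q = "\<Prod>e\<in>complete_edges s - {e0}. ?h e (\<sigma> (Min e)) (\<sigma> (Max e))"
      have "?P F = g (\<sigma> (Min e0)) (\<sigma> (Max e0)) * ?Q"
        using insert(2) by (subst prod.remove[OF finite_complete_edges e0]) simp
      moreover have "?P (insert e0 F) = f (\<sigma> (Min e0)) (\<sigma> (Max e0)) * ?Q"
        by (subst prod.remove[OF finite_complete_edges e0])
           (auto intro!: arg_cong2[of _ _ _ _ "(*)"] prod.cong)
      ultimately show "(\<Prod>i=1..s. p (\<sigma> i)) * ?P (insert e0 F) - (\<Prod>i=1..s. p (\<sigma> i)) * ?P F =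
        (\<Prod>i=1..s. p (\<sigma> i)) * (?Q * (f (\<sigma> (Min e0)) (\<sigma> (Max e0)) - g (\<sigma> (Min e0)) (\<sigma> (Max e0))))"
        by (simp add: algebra_simps)
    qed
    also have "\<dots> \<le> \<kappa>"
      by (rule hom_sum_exchange_edge[OF fV p _ cut]) (use f g e0 in auto)
    finally show ?case using insert by (simp add: algebra_simps)
  qed simp
  from this[OF subset_refl] show ?thesis by (simp add: T_def hom_sum_def)
qed

section \<open>Regularity lemma\<close>

text \<open>Partitions are encoded as colourings \<open>c\<close>, with the fibres as parts;
  refinement then reads \<open>c' x = c' y \<Longrightarrow> c x = c y\<close>.\<close>

definition fib :: "'a set \<Rightarrow> ('a \<Rightarrow> 'b) \<Rightarrow> 'b \<Rightarrow> 'a set" where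
  "fib V c i = {x \<in> V. c x = i}"

text \<open>Conditional expectation given the partition. \<open>bavg\<close> applies it in both
  arguments, and \<open>energy\<close> is the squared norm of the outcome.\<close>

definition pavg :: "'a set \<Rightarrow> ('a \<Rightarrow> 'b) \<Rightarrow> ('a \<Rightarrow> real) \<Rightarrow> 'a \<Rightarrow> real" where
  "pavg V c g x = (\<Sum>u\<in>fib V c (c x). g u) / real (card (fib V c (c x)))"

definition bavg :: "'a set \<Rightarrow> ('a \<Rightarrow> 'b) \<Rightarrow> ('a \<Rightarrow> 'a \<Rightarrow> real) \<Rightarrow> 'a \<Rightarrow> 'a \<Rightarrow> real" where
  "bavg V c f x y = pavg V c (\<lambda>u. pavg V c (f u) y) x"

definition energy :: "'a set \<Rightarrow> ('a \<Rightarrow> 'b) \<Rightarrow> ('a \<Rightarrow> 'a \<Rightarrow> real) \<Rightarrow> real" where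
  "energy V c f = (\<Sum>x\<in>V. \<Sum>y\<in>V. (bavg V c f x y)\<^sup>2)"

definition pair_density :: "('a \<Rightarrow> 'a \<Rightarrow> real) \<Rightarrow> 'a set \<Rightarrow> 'a set \<Rightarrow> real" where
  "pair_density f X Y = (\<Sum>x\<in>X. \<Sum>y\<in>Y. f x y) / (real (card X) * real (card Y))"

text \<open>Regularity in cut-norm form: the error is measured against the whole pair, and
  \<open>A\<close>, \<open>B\<close> may be arbitrarily small. In this form the errors can be summed
  over pairs of parts, and they pass to large subsets with a rescaled
  \<open>\<epsilon>\<close>.\<close>

definition regular_pair :: "real \<Rightarrow> ('a \<Rightarrow> 'a \<Rightarrow> real) \<Rightarrow> 'a set \<Rightarrow> 'a set \<Rightarrow> bool" where
  "regular_pair \<epsilon> f X Y \<longleftrightarrow> (\<forall>A\<subseteq>X. \<forall>B\<subseteq>Y.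
     \<bar>\<Sum>x\<in>A. \<Sum>y\<in>B. f x y - pair_density f X Y\<bar> \<le> \<epsilon> * real (card X) * real (card Y))"

text \<open>Irregular pairs of parts count with the product of their sizes, since the parts are not
  made equal in size.\<close>

definition irregular :: "real \<Rightarrow> 'a set \<Rightarrow> ('a \<Rightarrow> 'b) \<Rightarrow> ('a \<Rightarrow> 'a \<Rightarrow> real) \<Rightarrow> real" where
  "irregular \<epsilon> V c f = (\<Sum>x\<in>V. \<Sum>y\<in>V. of_bool (\<not> regular_pair \<epsilon> f (fib V c (c x)) (fib V c (c y))))"

lemma finite_fib: "finite V \<Longrightarrow> finite (fib V c i)"
  by (simp add: fib_def)

lemma fib_subset: "fib V c i \<subseteq> V"
  by (auto simp: fib_def)

lemma card_fib_pos: "finite V \<Longrightarrow> x \<in> V \<Longrightarrow> card (fib V c (c x)) > 0"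
  by (auto simp: card_gt_0_iff fib_def)

lemma sum_fib: "finite V \<Longrightarrow> (\<Sum>x\<in>V. g x) = (\<Sum>i\<in>c ` V. \<Sum>x\<in>fib V c i. g x)"
  unfolding fib_def by (rule sum.group[symmetric]) auto

lemma bavg_eq:
  "bavg V c f x y = pair_density f (fib V c (c x)) (fib V c (c y))"
  by (simp add: bavg_def pavg_def pair_density_def sum_divide_distrib[symmetric] mult.commute)

text \<open>The defining property of a conditional expectation, checked part by part.\<close>

lemma sum_pavg_mult:
  assumes "finite V" "\<And>x x'. x \<in> V \<Longrightarrow> x' \<in> V \<Longrightarrow> c x = c x' \<Longrightarrow> h x = h x'"
  shows "(\<Sum>x\<in>V. pavg V c g x * h x) = (\<Sum>x\<in>V. g x * h x)"
proof -
  have "(\<Sum>x\<in>fib V c i. pavg V c g x * h x) = (\<Sum>x\<in>fib V c i. g x * h x)" if i: "i \<in> c ` V" for i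
  proof -
    obtain x0 where x0: "x0 \<in> V" "c x0 = i" using i by auto
    have h: "h x = h x0" if "x \<in> fib V c i" for x
      using that x0 assms(2)[of x x0] by (auto simp: fib_def)
    have "(\<Sum>x\<in>fib V c i. pavg V c g x * h x) =
        (\<Sum>x\<in>fib V c i. (\<Sum>u\<in>fib V c i. g u) / real (card (fib V c i)) * h x0)"
    proof (intro sum.cong refl)
      fix x assume x: "x \<in> fib V c i"
      then have "c x = i" by (simp add: fib_def)
      then show "pavg V c g x * h x = (\<Sum>u\<in>fib V c i. g u) / real (card (fib V c i)) * h x0"
        using h[OF x] by (simp add: pavg_def)
    qed
    also have "\<dots> = (\<Sum>u\<in>fib V c i. g u) * h x0"
      using card_fib_pos[OF assms(1) x0(1), of c] x0 by simp
    also have "\<dots> = (\<Sum>x\<in>fib V c i. g x * h x)"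
      unfolding sum_distrib_right by (intro sum.cong refl) (simp add: h)
    finally show ?thesis .
  qed
  then have "(\<Sum>i\<in>c ` V. \<Sum>x\<in>fib V c i. pavg V c g x * h x) =
      (\<Sum>i\<in>c ` V. \<Sum>x\<in>fib V c i. g x * h x)"
    by (rule sum.cong[OF refl])
  then show ?thesis by (simp only: sum_fib[OF assms(1), of _ c])
qed

lemma sum_bavg_mult:
  assumes "finite V"
    and h: "\<And>x x' y y'. x \<in> V \<Longrightarrow> x' \<in> V \<Longrightarrow> y \<in> V \<Longrightarrow> y' \<in> V \<Longrightarrow> c x = c x' \<Longrightarrow> c y = c y' \<Longrightarrow> h x y = h x' y'"
  shows "(\<Sum>x\<in>V. \<Sum>y\<in>V. bavg V c f x y * h x y) = (\<Sum>x\<in>V. \<Sum>y\<in>V. f x y * h x y)"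
proof -
  have "(\<Sum>x\<in>V. \<Sum>y\<in>V. bavg V c f x y * h x y) =
      (\<Sum>y\<in>V. \<Sum>x\<in>V. pavg V c (\<lambda>u. pavg V c (f u) y) x * h x y)"
    unfolding bavg_def by (rule sum.swap)
  also have "\<dots> = (\<Sum>y\<in>V. \<Sum>x\<in>V. pavg V c (f x) y * h x y)"
    by (rule sum.cong[OF refl], rule sum_pavg_mult[OF assms(1)], rule h) auto
  also have "\<dots> = (\<Sum>x\<in>V. \<Sum>y\<in>V. pavg V c (f x) y * h x y)" by (rule sum.swap)
  also have "\<dots> = (\<Sum>x\<in>V. \<Sum>y\<in>V. f x y * h x y)"
    by (rule sum.cong[OF refl], rule sum_pavg_mult[OF assms(1)], rule h) auto
  finally show ?thesis .
qed

lemma bavg_cong: "c x = c x' \<Longrightarrow> c y = c y' \<Longrightarrow> bavg V c f x y = bavg V c f x' y'"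
  by (simp add: bavg_eq)

text \<open>Pythagoras: \<open>bavg V c f\<close> is the orthogonal projection of
  \<open>bavg V c' f\<close>, since both have the same pairing with functions that are constant on
  the parts of \<open>c\<close>.\<close>

lemma energy_refinement:
  assumes "finite V" "\<And>x y. x \<in> V \<Longrightarrow> y \<in> V \<Longrightarrow> c' x = c' y \<Longrightarrow> c x = c y"
  shows "(\<Sum>x\<in>V. \<Sum>y\<in>V. (bavg V c' f x y - bavg V c f x y)\<^sup>2) = energy V c' f - energy V c f"
proof -
  have "(\<Sum>x\<in>V. \<Sum>y\<in>V. bavg V c' f x y * bavg V c f x y) = (\<Sum>x\<in>V. \<Sum>y\<in>V. f x y * bavg V c f x y)"
    by (rule sum_bavg_mult[OF assms(1)]) (intro bavg_cong assms(2))
  also have "\<dots> = (\<Sum>x\<in>V. \<Sum>y\<in>V. bavg V c f x y * bavg V c f x y)"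
    by (rule sum_bavg_mult[OF assms(1), symmetric]) (intro bavg_cong)
  finally have *: "(\<Sum>x\<in>V. \<Sum>y\<in>V. bavg V c' f x y * bavg V c f x y) = energy V c f"
    by (simp add: energy_def power2_eq_square)
  have "(\<Sum>x\<in>V. \<Sum>y\<in>V. (bavg V c' f x y - bavg V c f x y)\<^sup>2) =
      energy V c' f + energy V c f - 2 * (\<Sum>x\<in>V. \<Sum>y\<in>V. bavg V c' f x y * bavg V c f x y)"
    by (simp add: power2_diff energy_def sum.distrib sum_subtractf sum_distrib_left mult.assoc)
  then show ?thesis by (simp add: *)
qed

lemma bavg_bounds:
  assumes "finite V" "\<forall>x\<in>V. \<forall>y\<in>V. 0 \<le> f x y \<and> f x y \<le> 1"
  shows "0 \<le> bavg V c f x y" "bavg V c f x y \<le> 1"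
proof -
  let ?X = "fib V c (c x)" and ?Y = "fib V c (c y)"
  have sub: "u \<in> ?X \<Longrightarrow> u \<in> V" "v \<in> ?Y \<Longrightarrow> v \<in> V" for u v by (auto simp: fib_def)
  show "0 \<le> bavg V c f x y"
    unfolding bavg_eq pair_density_def using assms(2) sub
    by (intro divide_nonneg_nonneg sum_nonneg) auto
  have "(\<Sum>x\<in>?X. \<Sum>y\<in>?Y. f x y) \<le> (\<Sum>x\<in>?X. \<Sum>y\<in>?Y. 1)"
    using assms(2) sub by (intro sum_mono) auto
  then show "bavg V c f x y \<le> 1"
    unfolding bavg_eq pair_density_def by (auto simp: divide_le_eq_1)
qed

lemma energy_le:
  assumes "finite V" "\<forall>x\<in>V. \<forall>y\<in>V. 0 \<le> f x y \<and> f x y \<le> 1"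
  shows "energy V c f \<le> real (card V) ^ 2"
proof -
  have "energy V c f \<le> (\<Sum>x\<in>V. \<Sum>y\<in>V. 1)"
    unfolding energy_def using bavg_bounds[OF assms, of c] by (intro sum_mono power_le_one)
  then show ?thesis by (simp add: power2_eq_square)
qed

lemma energy_nonneg: "0 \<le> energy V c f"
  by (auto simp: energy_def intro!: sum_nonneg)

text \<open>\<open>c'\<close> does not split across the borders of \<open>A\<close> and
  \<open>B\<close>, so the deviation of \<open>f\<close> on \<open>A \<times> B\<close> is equally
  the deviation of the refined averages. Cauchy--Schwarz turns it into a gain in squares.\<close>

lemma energy_gain_pair:
  fixes c :: "'a \<Rightarrow> 'b" and c' :: "'a \<Rightarrow> 'd" and f :: "'a \<Rightarrow> 'a \<Rightarrow> real"
  assumes fV: "finite V"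
    and X: "X = fib V c i" and Y: "Y = fib V c j"
    and AB: "A \<subseteq> X" "B \<subseteq> Y"
    and big: "\<bar>\<Sum>x\<in>A. \<Sum>y\<in>B. f x y - pair_density f X Y\<bar> > \<epsilon> * real (card X) * real (card Y)"
    and "0 < \<epsilon>"
    and ref: "\<And>x y. x \<in> V \<Longrightarrow> y \<in> V \<Longrightarrow> c' x = c' y \<Longrightarrow> (x \<in> A \<longleftrightarrow> y \<in> A) \<and> (x \<in> B \<longleftrightarrow> y \<in> B)"
  shows "(\<Sum>x\<in>X. \<Sum>y\<in>Y. (bavg V c' f x y - bavg V c f x y)\<^sup>2) \<ge> \<epsilon>\<^sup>2 * (real (card X) * real (card Y))"
proof -
  let ?d = "pair_density f X Y"
  define D where "D x y = bavg V c' f x y - bavg V c f x y" for x y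
  have XY: "X \<subseteq> V" "Y \<subseteq> V" unfolding X Y by (rule fib_subset)+
  have fXY: "finite X" "finite Y" by (rule finite_subset[OF _ fV], rule XY)+
  note fin = fXY finite_subset[OF AB(1) fXY(1)] finite_subset[OF AB(2) fXY(2)]
    order_trans[OF AB(1) XY(1)] order_trans[OF AB(2) XY(2)]
  have restr: "(\<Sum>x\<in>V. \<Sum>y\<in>V. g x y * (of_bool (x \<in> A) * of_bool (y \<in> B))) = (\<Sum>x\<in>A. \<Sum>y\<in>B. g x y)"
    for g :: "'a \<Rightarrow> 'a \<Rightarrow> real"
  proof -
    have "(\<Sum>x\<in>V. \<Sum>y\<in>V. g x y * (of_bool (x \<in> A) * of_bool (y \<in> B))) =
      (\<Sum>x\<in>V. if x \<in> A then (\<Sum>y\<in>V. if y \<in> B then g x y else 0) else 0)"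
      by (intro sum.cong refl) (auto simp: of_bool_def intro!: sum.cong sum.neutral)
    also have "\<dots> = (\<Sum>x\<in>A. \<Sum>y\<in>B. g x y)"
      using fin fV by (simp add: sum.inter_restrict[symmetric] Int_absorb1)
    finally show ?thesis .
  qed
  have avg: "(\<Sum>x\<in>A. \<Sum>y\<in>B. bavg V c' f x y) = (\<Sum>x\<in>A. \<Sum>y\<in>B. f x y)"
  proof -
    have "(\<Sum>x\<in>V. \<Sum>y\<in>V. bavg V c' f x y * (of_bool (x \<in> A) * of_bool (y \<in> B)))
        = (\<Sum>x\<in>V. \<Sum>y\<in>V. f x y * (of_bool (x \<in> A) * of_bool (y \<in> B)))"
    proof (rule sum_bavg_mult[OF fV])
      fix x x' y y' assume "x \<in> V" "x' \<in> V" "y \<in> V" "y' \<in> V" "c' x = c' x'" "c' y = c' y'"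
      then have "x \<in> A \<longleftrightarrow> x' \<in> A" "y \<in> B \<longleftrightarrow> y' \<in> B" using ref by blast+
      then show "of_bool (x \<in> A) * of_bool (y \<in> B) = (of_bool (x' \<in> A) * of_bool (y' \<in> B) :: real)"
        by simp
    qed
    then show ?thesis by (simp only: restr)
  qed
  have d: "bavg V c f x y = ?d" if "x \<in> X" "y \<in> Y" for x y
  proof -
    have "c x = i" "c y = j" using that X Y by (auto simp: fib_def)
    then show ?thesis by (simp add: bavg_eq X Y)
  qed
  have S: "(\<Sum>x\<in>A. \<Sum>y\<in>B. D x y) = (\<Sum>x\<in>A. \<Sum>y\<in>B. f x y - ?d)"
  proof -
    have "(\<Sum>x\<in>A. \<Sum>y\<in>B. D x y) = (\<Sum>x\<in>A. \<Sum>y\<in>B. bavg V c' f x y - ?d)"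
      unfolding D_def using AB d by (intro sum.cong refl) (auto simp: subset_iff)
    then show ?thesis by (simp add: sum_subtractf avg)
  qed
  have m: "real (card X) * real (card Y) > 0"
  proof (rule ccontr)
    assume "\<not> ?thesis"
    then have "X = {} \<or> Y = {}" using fin by (auto simp: zero_less_mult_iff)
    then have "A = {} \<or> B = {}" using AB by auto
    then have "(\<Sum>x\<in>A. \<Sum>y\<in>B. f x y - ?d) = 0" by (elim disjE) simp_all
    then have "\<epsilon> * real (card X) * real (card Y) < 0" using big by (simp only: abs_zero)
    moreover have "0 \<le> \<epsilon> * real (card X) * real (card Y)" using \<open>0 < \<epsilon>\<close> by simp
    ultimately show False by linarith
  qed
  have "(\<epsilon> * (real (card X) * real (card Y)))\<^sup>2 \<le> (\<Sum>x\<in>A. \<Sum>y\<in>B. D x y)\<^sup>2"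
  proof -
    have "\<epsilon> * (real (card X) * real (card Y)) \<le> \<bar>\<Sum>x\<in>A. \<Sum>y\<in>B. D x y\<bar>"
      unfolding S using big by (simp only: mult.assoc less_imp_le)
    moreover have "0 \<le> \<epsilon> * (real (card X) * real (card Y))"
      using m \<open>0 < \<epsilon>\<close> by (intro mult_nonneg_nonneg less_imp_le)
    ultimately have "(\<epsilon> * (real (card X) * real (card Y)))\<^sup>2 \<le> \<bar>\<Sum>x\<in>A. \<Sum>y\<in>B. D x y\<bar>\<^sup>2"
      by (rule power_mono)
    then show ?thesis by (simp only: power2_abs)
  qed
  also have "\<dots> = (\<Sum>z\<in>A\<times>B. D (fst z) (snd z))\<^sup>2"
    by (simp add: sum.cartesian_product case_prod_unfold)
  also have "\<dots> \<le> real (card (A\<times>B)) * (\<Sum>z\<in>A\<times>B. (D (fst z) (snd z))\<^sup>2)"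
    by (subst mult.commute) (rule sum_squared_le_sum_of_squares)
  also have "\<dots> \<le> (real (card X) * real (card Y)) * (\<Sum>z\<in>X\<times>Y. (D (fst z) (snd z))\<^sup>2)"
  proof (intro mult_mono sum_mono2)
    show "real (card (A\<times>B)) \<le> real (card X) * real (card Y)"
      unfolding card_cartesian_product of_nat_mult using AB fin
      by (intro mult_mono of_nat_mono card_mono) auto
    show "A \<times> B \<subseteq> X \<times> Y" using AB by auto
  qed (use fXY in \<open>simp_all add: sum_nonneg\<close>)
  also have "(\<Sum>z\<in>X\<times>Y. (D (fst z) (snd z))\<^sup>2) = (\<Sum>x\<in>X. \<Sum>y\<in>Y. (D x y)\<^sup>2)"
    by (simp add: sum.cartesian_product case_prod_unfold)
  finally have "(real (card X) * real (card Y)) * (\<epsilon>\<^sup>2 * (real (card X) * real (card Y)))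
      \<le> (real (card X) * real (card Y)) * (\<Sum>x\<in>X. \<Sum>y\<in>Y. (D x y)\<^sup>2)"
    by (simp only: power_mult_distrib power2_eq_square mult_ac)
  then have "\<epsilon>\<^sup>2 * (real (card X) * real (card Y)) \<le> (\<Sum>x\<in>X. \<Sum>y\<in>Y. (D x y)\<^sup>2)"
    using m by (simp only: mult_le_cancel_left_pos)
  then show ?thesis by (simp only: D_def)
qed

lemma energy_increment:
  fixes c :: "'a \<Rightarrow> nat" and f :: "'a \<Rightarrow> 'a \<Rightarrow> real"
  assumes fV: "finite V" and e: "0 < \<epsilon>"
  obtains c' :: "'a \<Rightarrow> nat" where "\<And>x y. x \<in> V \<Longrightarrow> y \<in> V \<Longrightarrow> c' x = c' y \<Longrightarrow> c x = c y"
    "card (c' ` V) \<le> card (c ` V) * (2 ^ (card (c ` V) * card (c ` V)) * 2 ^ (card (c ` V) * card (c ` V)))"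
    "energy V c' f \<ge> energy V c f + \<epsilon>\<^sup>2 * irregular \<epsilon> V c f"
proof -
  let ?C = "c ` V"
  define bad where "bad i j A B \<longleftrightarrow> A \<subseteq> fib V c i \<and> B \<subseteq> fib V c j \<and>
    \<bar>\<Sum>x\<in>A. \<Sum>y\<in>B. f x y - pair_density f (fib V c i) (fib V c j)\<bar>
       > \<epsilon> * real (card (fib V c i)) * real (card (fib V c j))" for i j A B
  have "\<forall>i j. \<exists>A B. \<not> regular_pair \<epsilon> f (fib V c i) (fib V c j) \<longrightarrow> bad i j A B"
    unfolding regular_pair_def bad_def by (meson not_le)
  then obtain A B where AB: "\<And>i j. \<not> regular_pair \<epsilon> f (fib V c i) (fib V c j) \<Longrightarrow> bad i j (A i j) (B i j)"
    by metis
  \<comment> \<open>The new colour records the old one together with the membership in every witness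
    of irregularity; the two families of subsets of \<open>?C \<times> ?C\<close> account for the
    exponential bound.\<close>
  define c1 where "c1 x = (c x, {(i, j) \<in> ?C \<times> ?C. x \<in> A i j}, {(i, j) \<in> ?C \<times> ?C. x \<in> B i j})" for x
  have fC: "finite ?C" using fV by simp
  \<comment> \<open>Renaming colours by natural numbers keeps the colour type fixed, so that the
    refinement can be iterated.\<close>
  obtain h :: "_ \<Rightarrow> nat" where h: "inj_on h (c1 ` V)"
    using finite_imp_inj_to_nat_seg[of "c1 ` V"] fV by auto
  define c' where "c' = h \<circ> c1"
  have ref: "c1 x = c1 y" if "x \<in> V" "y \<in> V" "c' x = c' y" for x y
    using h that by (auto simp: c'_def inj_on_def)
  have ref1: "c x = c y" if "x \<in> V" "y \<in> V" "c' x = c' y" for x y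
    using ref[OF that] by (simp add: c1_def)
  have ref2: "(x \<in> A i j \<longleftrightarrow> y \<in> A i j) \<and> (x \<in> B i j \<longleftrightarrow> y \<in> B i j)"
    if "x \<in> V" "y \<in> V" "c' x = c' y" "i \<in> ?C" "j \<in> ?C" for x y i j
  proof -
    have e: "{(i, j) \<in> ?C \<times> ?C. x \<in> A i j} = {(i, j) \<in> ?C \<times> ?C. y \<in> A i j}"
      "{(i, j) \<in> ?C \<times> ?C. x \<in> B i j} = {(i, j) \<in> ?C \<times> ?C. y \<in> B i j}"
      using ref[OF that(1-3)] unfolding c1_def by (simp_all only: prod.inject)
    show ?thesis
      using arg_cong[OF e(1), of "\<lambda>S. (i, j) \<in> S"] arg_cong[OF e(2), of "\<lambda>S. (i, j) \<in> S"] that(4,5)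
      by simp
  qed
  have "card (c' ` V) \<le> card (c1 ` V)"
    unfolding c'_def image_comp[symmetric] using fV by (intro card_image_le) auto
  also have "\<dots> \<le> card (?C \<times> (Pow (?C \<times> ?C) \<times> Pow (?C \<times> ?C)))"
    using fC by (intro card_mono) (auto simp: c1_def)
  also have "\<dots> = card ?C * (2 ^ (card ?C * card ?C) * 2 ^ (card ?C * card ?C))"
    using fC by (simp add: card_cartesian_product card_Pow)
  finally have card: "card (c' ` V) \<le> card ?C * (2 ^ (card ?C * card ?C) * 2 ^ (card ?C * card ?C))" .
  let ?D = "\<lambda>x y. (bavg V c' f x y - bavg V c f x y)\<^sup>2"
  let ?irr = "\<lambda>i j. of_bool (\<not> regular_pair \<epsilon> f (fib V c i) (fib V c j)) :: real"
  have two: "(\<Sum>x\<in>V. \<Sum>y\<in>V. g x y) = (\<Sum>i\<in>?C. \<Sum>j\<in>?C. \<Sum>x\<in>fib V c i. \<Sum>y\<in>fib V c j. g x y)"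
    for g :: "'a \<Rightarrow> 'a \<Rightarrow> real"
  proof -
    have "(\<Sum>x\<in>V. \<Sum>y\<in>V. g x y) = (\<Sum>i\<in>?C. \<Sum>x\<in>fib V c i. \<Sum>y\<in>V. g x y)" by (rule sum_fib[OF fV])
    also have "\<dots> = (\<Sum>i\<in>?C. \<Sum>x\<in>fib V c i. \<Sum>j\<in>?C. \<Sum>y\<in>fib V c j. g x y)"
      by (intro sum.cong refl sum_fib[OF fV])
    also have "\<dots> = (\<Sum>i\<in>?C. \<Sum>j\<in>?C. \<Sum>x\<in>fib V c i. \<Sum>y\<in>fib V c j. g x y)"
      by (intro sum.cong refl sum.swap)
    finally show ?thesis .
  qed
  have "\<epsilon>\<^sup>2 * irregular \<epsilon> V c f = (\<Sum>i\<in>?C. \<Sum>j\<in>?C. \<epsilon>\<^sup>2 * (\<Sum>x\<in>fib V c i. \<Sum>y\<in>fib V c j. ?irr (c x) (c y)))"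
    unfolding irregular_def two by (simp add: sum_distrib_left)
  also have "\<dots> \<le> (\<Sum>i\<in>?C. \<Sum>j\<in>?C. \<Sum>x\<in>fib V c i. \<Sum>y\<in>fib V c j. ?D x y)"
  proof (intro sum_mono)
    fix i j assume ij: "i \<in> ?C" "j \<in> ?C"
    have eq: "(\<Sum>x\<in>fib V c i. \<Sum>y\<in>fib V c j. ?irr (c x) (c y)) =
        (\<Sum>x\<in>fib V c i. \<Sum>y\<in>fib V c j. ?irr i j)"
      by (intro sum.cong refl) (auto simp: fib_def)
    show "\<epsilon>\<^sup>2 * (\<Sum>x\<in>fib V c i. \<Sum>y\<in>fib V c j. ?irr (c x) (c y))
        \<le> (\<Sum>x\<in>fib V c i. \<Sum>y\<in>fib V c j. ?D x y)"
    proof (cases "regular_pair \<epsilon> f (fib V c i) (fib V c j)")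
      case True
      then show ?thesis unfolding eq by (simp add: sum_nonneg)
    next
      case False
      have b: "bad i j (A i j) (B i j)" by (rule AB[OF False])
      have "\<epsilon>\<^sup>2 * (real (card (fib V c i)) * real (card (fib V c j)))
          \<le> (\<Sum>x\<in>fib V c i. \<Sum>y\<in>fib V c j. ?D x y)"
      proof (rule energy_gain_pair[OF fV refl refl])
        show "A i j \<subseteq> fib V c i" "B i j \<subseteq> fib V c j"
          "\<epsilon> * real (card (fib V c i)) * real (card (fib V c j))
            < \<bar>\<Sum>x\<in>A i j. \<Sum>y\<in>B i j. f x y - pair_density f (fib V c i) (fib V c j)\<bar>"
          using b by (simp_all only: bad_def)
      qed (use e ref2 ij in blast)+
      then show ?thesis unfolding eq using False by simp
    qed
  qed
  also have "\<dots> = energy V c' f - energy V c f"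
    by (simp only: two[symmetric] energy_refinement[OF fV ref1])
  finally have "energy V c f + \<epsilon>\<^sup>2 * irregular \<epsilon> V c f \<le> energy V c' f" by linarith
  then show ?thesis using that[OF ref1 card] by blast
qed

text \<open>\<open>m\<close> bounds the number of refinements still possible: each gains more than
  \<open>\<epsilon> ^ 3 * real (card V) ^ 2\<close>, while the energy never exceeds
  \<open>real (card V) ^ 2\<close>. The bound \<open>K\<close> must precede \<open>V\<close>,
  \<open>f\<close> and \<open>c\<close>, hence the explicit quantifiers.\<close>

lemma regularity_iterate:
  fixes k m :: nat
  assumes e: "0 < \<epsilon>"
  shows "\<exists>K. \<forall>V f (c::'a \<Rightarrow> nat). finite V \<longrightarrow> (\<forall>x\<in>V. \<forall>y\<in>V. 0 \<le> f x y \<and> f x y \<le> 1) \<longrightarrow>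
    card (c ` V) \<le> k \<longrightarrow> energy V c f \<ge> (1 - real m * \<epsilon> ^ 3) * real (card V) ^ 2 \<longrightarrow>
    (\<exists>c'::'a \<Rightarrow> nat. (\<forall>x\<in>V. \<forall>y\<in>V. c' x = c' y \<longrightarrow> c x = c y) \<and> card (c' ` V) \<le> K \<and>
       irregular \<epsilon> V c' f \<le> \<epsilon> * real (card V) ^ 2)"
proof (induction m arbitrary: k)
  case 0
  show ?case
  proof (intro exI[of _ k] allI impI)
    fix V :: "'a set" and f and c :: "'a \<Rightarrow> nat"
    assume V: "finite V" "\<forall>x\<in>V. \<forall>y\<in>V. 0 \<le> f x y \<and> f x y \<le> 1" "card (c ` V) \<le> k"
      "(1 - real 0 * \<epsilon> ^ 3) * real (card V) ^ 2 \<le> energy V c f"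
    \<comment> \<open>At maximal energy a refinement gains nothing, so nothing can be
      irregular.\<close>
    obtain c' :: "'a \<Rightarrow> nat" where "energy V c' f \<ge> energy V c f + \<epsilon>\<^sup>2 * irregular \<epsilon> V c f"
      using energy_increment[OF V(1) e] by metis
    moreover have "energy V c' f \<le> real (card V) ^ 2" using V by (intro energy_le)
    ultimately have "\<epsilon>\<^sup>2 * irregular \<epsilon> V c f \<le> 0" using V(4) by simp
    then have "irregular \<epsilon> V c f \<le> 0" using e by (simp add: mult_le_0_iff)
    moreover have "0 \<le> \<epsilon> * real (card V) ^ 2" using e by simp
    ultimately have "irregular \<epsilon> V c f \<le> \<epsilon> * real (card V) ^ 2" by (rule order_trans)
    then show "\<exists>c'::'a \<Rightarrow> nat. (\<forall>x\<in>V. \<forall>y\<in>V. c' x = c' y \<longrightarrow> c x = c y) \<and> card (c' ` V) \<le> k \<and>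
       irregular \<epsilon> V c' f \<le> \<epsilon> * real (card V) ^ 2"
      using V(3) by (intro exI[of _ c] conjI ballI impI)
  qed
next
  case (Suc m)
  define k' where "k' = k * (2 ^ (k * k) * 2 ^ (k * k))"
  obtain K where K: "\<forall>V f (c::'a \<Rightarrow> nat). finite V \<longrightarrow> (\<forall>x\<in>V. \<forall>y\<in>V. 0 \<le> f x y \<and> f x y \<le> 1) \<longrightarrow>
    card (c ` V) \<le> k' \<longrightarrow> energy V c f \<ge> (1 - real m * \<epsilon> ^ 3) * real (card V) ^ 2 \<longrightarrow>
    (\<exists>c'::'a \<Rightarrow> nat. (\<forall>x\<in>V. \<forall>y\<in>V. c' x = c' y \<longrightarrow> c x = c y) \<and> card (c' ` V) \<le> K \<and>
       irregular \<epsilon> V c' f \<le> \<epsilon> * real (card V) ^ 2)"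
    using Suc.IH[of k'] by blast
  show ?case
  proof (intro exI[of _ "max k K"] allI impI)
    fix V :: "'a set" and f and c :: "'a \<Rightarrow> nat"
    assume V: "finite V" "\<forall>x\<in>V. \<forall>y\<in>V. 0 \<le> f x y \<and> f x y \<le> 1" "card (c ` V) \<le> k"
      "(1 - real (Suc m) * \<epsilon> ^ 3) * real (card V) ^ 2 \<le> energy V c f"
    show "\<exists>c'::'a \<Rightarrow> nat. (\<forall>x\<in>V. \<forall>y\<in>V. c' x = c' y \<longrightarrow> c x = c y) \<and> card (c' ` V) \<le> max k K \<and>
       irregular \<epsilon> V c' f \<le> \<epsilon> * real (card V) ^ 2"
    proof (cases "irregular \<epsilon> V c f \<le> \<epsilon> * real (card V) ^ 2")
      case True
      then show ?thesis using V(3) by (intro exI[of _ c] conjI ballI impI) simp_all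
    next
      case False
      obtain c1 :: "'a \<Rightarrow> nat" where c1: "\<And>x y. x \<in> V \<Longrightarrow> y \<in> V \<Longrightarrow> c1 x = c1 y \<Longrightarrow> c x = c y"
        "card (c1 ` V) \<le> card (c ` V) * (2 ^ (card (c ` V) * card (c ` V)) * 2 ^ (card (c ` V) * card (c ` V)))"
        "energy V c1 f \<ge> energy V c f + \<epsilon>\<^sup>2 * irregular \<epsilon> V c f"
        using energy_increment[OF V(1) e] by metis
      have h1: "card (c1 ` V) \<le> k'"
        unfolding k'_def using c1(2) V(3)
        by (elim order_trans) (intro mult_mono power_increasing; simp)
      have h2: "energy V c1 f \<ge> (1 - real m * \<epsilon> ^ 3) * real (card V) ^ 2"
      proof -
        have "\<epsilon>\<^sup>2 * (\<epsilon> * real (card V) ^ 2) \<le> \<epsilon>\<^sup>2 * irregular \<epsilon> V c f"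
          using False by (intro mult_left_mono) auto
        moreover have "\<epsilon>\<^sup>2 * (\<epsilon> * real (card V) ^ 2) = \<epsilon> ^ 3 * real (card V) ^ 2"
          by (simp add: power2_eq_square power3_eq_cube)
        moreover have "(1 - real (Suc m) * \<epsilon> ^ 3) * real (card V) ^ 2 =
            (1 - real m * \<epsilon> ^ 3) * real (card V) ^ 2 - \<epsilon> ^ 3 * real (card V) ^ 2"
          by (simp add: algebra_simps)
        ultimately show ?thesis using c1(3) V(4) by linarith
      qed
      obtain c' :: "'a \<Rightarrow> nat" where c': "\<forall>x\<in>V. \<forall>y\<in>V. c' x = c' y \<longrightarrow> c1 x = c1 y"
        "card (c' ` V) \<le> K" "irregular \<epsilon> V c' f \<le> \<epsilon> * real (card V) ^ 2"
        using K[THEN spec, THEN spec, THEN spec, THEN mp, OF V(1), THEN mp, OF V(2), THEN mp, OF h1,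
            THEN mp, OF h2] by blast
      show ?thesis
      proof (intro exI[of _ c'] conjI)
        show "\<forall>x\<in>V. \<forall>y\<in>V. c' x = c' y \<longrightarrow> c x = c y" using c'(1) c1(1) by blast
        show "card (c' ` V) \<le> max k K" using c'(2) by linarith
      qed (rule c'(3))
    qed
  qed
qed

lemma regularity_lemma:
  fixes k :: nat
  assumes e: "0 < \<epsilon>"
  obtains K where "\<And>V f (c::'a \<Rightarrow> nat). finite V \<Longrightarrow> (\<forall>x\<in>V. \<forall>y\<in>V. 0 \<le> f x y \<and> f x y \<le> 1) \<Longrightarrow>
    card (c ` V) \<le> k \<Longrightarrow>
    \<exists>c'::'a \<Rightarrow> nat. (\<forall>x\<in>V. \<forall>y\<in>V. c' x = c' y \<longrightarrow> c x = c y) \<and> card (c' ` V) \<le> K \<and>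
       irregular \<epsilon> V c' f \<le> \<epsilon> * real (card V) ^ 2"
proof -
  \<comment> \<open>With so many steps available, the energy hypothesis of the iteration has a
    nonpositive left side and holds for every colouring.\<close>
  obtain m :: nat where m: "1 / \<epsilon> ^ 3 \<le> real m" using real_arch_simple by blast
  then have "(1 - real m * \<epsilon> ^ 3) \<le> 0" using e by (simp add: field_simps)
  then have "(1 - real m * \<epsilon> ^ 3) * real (card V) ^ 2 \<le> energy V c f" for V :: "'a set" and c :: "'a \<Rightarrow> nat" and f
    using energy_nonneg[of V c f] by (meson mult_nonpos_nonneg order_trans zero_le_power2)
  then show ?thesis using regularity_iterate[OF e, of k m] that by metis
qed

section \<open>Embedding cliques\<close>

text \<open>The parts outside \<open>S\<close> are used up first, one vertex each: two adjacent vertices have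
  large common neighbourhoods only in parts to which their densities exceed \<open>1/2\<close>.\<close>

lemma embed_clique:
  fixes A :: "'i \<Rightarrow> 'a set" and d :: "'i \<Rightarrow> 'i \<Rightarrow> real"
  assumes G: "simple_graph V E" and \<eta>: "0 < \<eta>" "\<eta> \<le> 1" and a: "0 < a"
    and edge: "\<And>X. X \<subseteq> V \<Longrightarrow> a \<le> real (card X) \<Longrightarrow> \<exists>x\<in>X. \<exists>y\<in>X. {x, y} \<in> E"
    and "finite J" "card J = m" "m \<le> T" "S \<subseteq> J"
    and "\<And>j. j \<in> J \<Longrightarrow> A j \<subseteq> V" "\<And>j. j \<in> J \<Longrightarrow> 2 * a \<le> real (card (A j)) * (\<eta> / 2) ^ m"
    and "\<And>i j X Y. i \<in> J \<Longrightarrow> j \<in> J \<Longrightarrow> i \<noteq> j \<Longrightarrow> X \<subseteq> A i \<Longrightarrow> Y \<subseteq> A j \<Longrightarrow>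
      (\<Sum>x\<in>X. \<Sum>y\<in>Y. adj E x y) \<ge> d i j * (real (card X) * real (card Y)) - \<kappa> * (real (card (A i)) * real (card (A j)))"
    and "\<And>i j. i \<in> J \<Longrightarrow> j \<in> J \<Longrightarrow> i \<noteq> j \<Longrightarrow> d i j \<ge> \<eta>"
    and "\<And>i j. i \<in> S \<Longrightarrow> j \<in> S \<Longrightarrow> i \<noteq> j \<Longrightarrow> d i j \<ge> 1/2 + \<eta>"
    and "0 \<le> \<kappa>" "4 * real T * \<kappa> \<le> \<eta> * (\<eta>\<^sup>2 / 4) ^ m"
  shows "\<exists>Q. Q \<subseteq> (\<Union>j\<in>J. A j) \<and> is_clique V E Q \<and> card Q = card J + card S"
  using assms(6-)
proof (induction m arbitrary: J S A \<kappa>)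
  case 0
  have "J = {}" using 0(1,2) by simp
  moreover have "S = {}" using 0(4) calculation by simp
  ultimately show ?case by (intro exI[of _ "{}"]) (simp add: is_clique_def)
next
  case (Suc m)
  note J = Suc.prems(1,2,4) and AV = Suc.prems(5) and size = Suc.prems(6) and reg = Suc.prems(7)
    and d1 = Suc.prems(8) and d2 = Suc.prems(9) and \<kappa> = Suc.prems(10,11)
  have fV: "finite V" using simple_graphD(1)[OF G] .
  have fS: "finite S" using J finite_subset by blast
  have J0: "J \<noteq> {}" using J by auto
  obtain j0 where j0: "j0 \<in> J" "j0 \<in> S \<Longrightarrow> S = J"
    using J0 J(3) by blast
  define J' where "J' = J - {j0}"
  have cJ': "card J' = m" "finite J'" "J' \<subseteq> J" "j0 \<notin> J'" using J j0 by (auto simp: J'_def)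
  have fA: "finite (A j)" if "j \<in> J" for j using AV[OF that] fV finite_subset by blast
  have big: "2 * a \<le> real (card (A j))" if "j \<in> J" for j
  proof -
    have "2 * a \<le> real (card (A j)) * (\<eta> / 2) ^ Suc m" using size[OF that] .
    also have "\<dots> \<le> real (card (A j)) * 1"
      using \<eta> by (intro mult_left_mono power_le_one) auto
    finally show ?thesis by simp
  qed
  have pos: "0 < real (card (A j))" if "j \<in> J" for j using big[OF that] a by linarith
  define deg where "deg x j = (\<Sum>y\<in>A j. adj E x y)" for x j
  define bad where "bad j = {x \<in> A j0. deg x j < (d j0 j - \<eta>/2) * real (card (A j))}" for j
  have T: "1 \<le> real T" using Suc.prems(3) by simp
  \<comment> \<open>The smallness of \<open>\<kappa>\<close> leaves at most a
    \<open>1 / (2 * card J)\<close> share of \<open>A j0\<close> bad for any one \<open>j\<close>,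
    so at least half of \<open>A j0\<close> is good for all remaining parts at once.\<close>
  have bad: "real (card (bad j)) * real T \<le> real (card (A j0)) * (1/2) * (1 / real (card J)) * real T"
    if j: "j \<in> J'" for j
  proof -
    have j': "j \<in> J" "j0 \<noteq> j" using j cJ' by auto
    let ?b = "real (card (bad j))" and ?A = "real (card (A j))" and ?Z = "real (card (A j0))"
    have "d j0 j * (?b * ?A) - \<kappa> * (?Z * ?A) \<le> (\<Sum>x\<in>bad j. deg x j)"
      unfolding deg_def by (rule reg[OF j0(1) j' _ subset_refl]) (simp add: bad_def)
    also have "\<dots> \<le> (\<Sum>x\<in>bad j. (d j0 j - \<eta>/2) * ?A)"
      by (intro sum_mono) (auto simp: bad_def)
    also have "\<dots> = (d j0 j - \<eta>/2) * (?b * ?A)" by simp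
    finally have "\<eta>/2 * ?b * ?A \<le> \<kappa> * ?Z * ?A" by (simp add: algebra_simps)
    then have "\<eta>/2 * ?b \<le> \<kappa> * ?Z" using pos[OF j'(1)] by (simp only: mult_le_cancel_right_pos)
    then have "\<eta>/2 * ?b * (4 * real T) \<le> \<kappa> * ?Z * (4 * real T)"
      by (intro mult_right_mono) auto
    also have "\<dots> = (4 * real T * \<kappa>) * ?Z" by simp
    also have "\<dots> \<le> (\<eta> * (\<eta>\<^sup>2 / 4) ^ Suc m) * ?Z" using \<kappa>(2) by (intro mult_right_mono) auto
    also have "\<dots> \<le> (\<eta> * 1) * ?Z"
      using \<eta> by (intro mult_right_mono mult_left_mono power_le_one)
        (auto simp: power2_eq_square intro: order_trans[OF mult_left_le_one_le])
    finally have "\<eta> * (?b * real T * 2) \<le> \<eta> * ?Z" by (simp add: algebra_simps)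
    then have "?b * real T * 2 \<le> ?Z" using \<eta>(1) by (simp only: mult_le_cancel_left_pos)
    moreover have "?Z * (1/2) \<le> ?Z * (1/2) * (1 / real (card J)) * real T"
    proof -
      have "1 \<le> 1 / real (card J) * real T" using J(2) Suc.prems(3) by (simp add: field_simps)
      then have "?Z * (1/2) * 1 \<le> ?Z * (1/2) * (1 / real (card J) * real T)"
        by (intro mult_left_mono) auto
      then show ?thesis by (simp only: mult.assoc mult_1_right)
    qed
    ultimately show ?thesis by linarith
  qed
  have bad': "real (card (bad j)) \<le> real (card (A j0)) * (1/2) * (1 / real (card J))" if "j \<in> J'" for j
    using bad[OF that] T by (simp only: mult_le_cancel_right_pos)
  define Ty where "Ty = A j0 - (\<Union>j\<in>J'. bad j)"
  have Tysub: "Ty \<subseteq> A j0" "Ty \<subseteq> V" using AV[OF j0(1)] by (auto simp: Ty_def)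
  have Ty: "a \<le> real (card Ty)"
  proof -
    have "real (card (\<Union>j\<in>J'. bad j)) \<le> real (\<Sum>j\<in>J'. card (bad j))"
      using cJ'(2) by (intro of_nat_mono card_UN_le)
    also have "\<dots> \<le> (\<Sum>j\<in>J'. real (card (A j0)) * (1/2) * (1 / real (card J)))"
      unfolding of_nat_sum by (intro sum_mono bad')
    also have "\<dots> = real (card (A j0)) * (1/2) * (real m / real (Suc m))"
      using cJ' J(2) by simp
    also have "\<dots> \<le> real (card (A j0)) * (1/2) * 1"
      by (intro mult_left_mono) auto
    finally have "real (card (\<Union>j\<in>J'. bad j)) \<le> real (card (A j0)) / 2" by simp
    moreover have "real (card (A j0)) \<le> real (card Ty) + real (card (\<Union>j\<in>J'. bad j))"
    proof -
      have "card (A j0) \<le> card (Ty \<union> (\<Union>j\<in>J'. bad j))"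
        using fA[OF j0(1)] cJ'(2) by (intro card_mono) (auto simp: Ty_def bad_def)
      also have "\<dots> \<le> card Ty + card (\<Union>j\<in>J'. bad j)" by (rule card_Un_le)
      finally show ?thesis by linarith
    qed
    ultimately show ?thesis using big[OF j0(1)] by linarith
  qed
  have deg: "(d j0 j - \<eta>/2) * real (card (A j)) \<le> deg x j" if "x \<in> Ty" "j \<in> J'" for x j
    using that by (auto simp: Ty_def bad_def)
  have deg_card: "deg x j = real (card {y \<in> A j. {x, y} \<in> E})" if "j \<in> J" for x j
    unfolding deg_def adj_def using fA[OF that] by (simp add: Int_def)
  have core: "\<exists>D. D \<subseteq> A j0 \<and> is_clique V E D \<and> card D = 1 + of_bool (j0 \<in> S) \<and>
    (\<forall>j\<in>J'. \<eta>/2 * real (card (A j)) \<le> real (card {y \<in> A j. \<forall>x\<in>D. {x, y} \<in> E}))"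
  proof (cases "j0 \<in> S")
    case False
    have "Ty \<noteq> {}" using Ty a by auto
    then obtain x where x: "x \<in> Ty" by blast
    have "\<eta>/2 * real (card (A j)) \<le> real (card {y \<in> A j. {x, y} \<in> E})" if j: "j \<in> J'" for j
    proof -
      have "\<eta> \<le> d j0 j" using d1[OF j0(1)] j cJ' by blast
      then have "\<eta>/2 * real (card (A j)) \<le> (d j0 j - \<eta>/2) * real (card (A j))"
        by (intro mult_right_mono) auto
      also have "\<dots> \<le> deg x j" by (rule deg[OF x j])
      finally show ?thesis using deg_card j cJ'(3) by auto
    qed
    then show ?thesis using False x Tysub
      by (intro exI[of _ "{x}"]) (auto simp: is_clique_def)
  next
    case True
    obtain x x' where x: "x \<in> Ty" "x' \<in> Ty" "{x, x'} \<in> E" using edge[OF Tysub(2) Ty] by blast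
    then have ne: "x \<noteq> x'" using simple_graphD(2)[OF G] by blast
    \<comment> \<open>Two neighbourhoods of relative size at least \<open>1/2 + \<eta>/2\<close>
      overlap in a share of at least \<open>\<eta>\<close>.\<close>
    have "\<eta>/2 * real (card (A j)) \<le> real (card {y \<in> A j. \<forall>z\<in>{x,x'}. {z, y} \<in> E})" if j: "j \<in> J'" for j
    proof -
      have jJ: "j \<in> J" using j cJ' by auto
      let ?N = "\<lambda>x. {y \<in> A j. {x, y} \<in> E}"
      have "1/2 + \<eta> \<le> d j0 j" using d2[of j0 j] True j0(2)[OF True] jJ j cJ' by blast
      then have "(1/2 + \<eta>/2) * real (card (A j)) \<le> (d j0 j - \<eta>/2) * real (card (A j))"
        by (intro mult_right_mono) auto
      then have dd: "(1/2 + \<eta>/2) * real (card (A j)) \<le> real (card (?N x))"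
        "(1/2 + \<eta>/2) * real (card (A j)) \<le> real (card (?N x'))"
        using deg[OF x(1) j] deg[OF x(2) j] deg_card[OF jJ, of x] deg_card[OF jJ, of x'] by linarith+
      have "card (?N x \<union> ?N x') + card (?N x \<inter> ?N x') = card (?N x) + card (?N x')"
        using fA[OF jJ] by (intro card_Un_Int[symmetric]) auto
      moreover have "card (?N x \<union> ?N x') \<le> card (A j)" using fA[OF jJ] by (intro card_mono) auto
      moreover have "?N x \<inter> ?N x' = {y \<in> A j. \<forall>z\<in>{x,x'}. {z, y} \<in> E}" by auto
      ultimately have "real (card (?N x)) + real (card (?N x')) \<le>
          real (card (A j)) + real (card {y \<in> A j. \<forall>z\<in>{x,x'}. {z, y} \<in> E})"
        by (simp only: of_nat_add[symmetric] of_nat_le_iff)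
      moreover have "\<eta>/2 * real (card (A j)) \<le> \<eta> * real (card (A j))" using \<eta> by (intro mult_right_mono) auto
      ultimately show ?thesis using dd by (simp add: algebra_simps)
    qed
    moreover have "is_clique V E {x, x'}"
      using x Tysub by (auto simp: is_clique_def insert_commute)
    ultimately show ?thesis using True x ne Tysub
      by (intro exI[of _ "{x, x'}"] conjI) (auto simp del: ball_simps)
  qed
  then obtain D where D: "D \<subseteq> A j0" "is_clique V E D" "card D = 1 + of_bool (j0 \<in> S)"
    "\<And>j. j \<in> J' \<Longrightarrow> \<eta>/2 * real (card (A j)) \<le> real (card {y \<in> A j. \<forall>x\<in>D. {x, y} \<in> E})" by blast
  define A' where "A' j = {y \<in> A j. \<forall>x\<in>D. {x, y} \<in> E}" for j
  have A'sub: "A' j \<subseteq> A j" for j by (auto simp: A'_def)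
  have A'big: "\<eta>/2 * real (card (A j)) \<le> real (card (A' j))" if "j \<in> J'" for j
    using D(4)[OF that] by (simp only: A'_def)
  \<comment> \<open>Both parts of a pair may shrink to a share \<open>\<eta>/2\<close>, so the
    relative error grows by at most \<open>4 / \<eta>\<^sup>2\<close>. Over \<open>m\<close> steps
    this gives the power of \<open>\<eta>\<^sup>2 / 4\<close> in the hypothesis on
    \<open>\<kappa>\<close>.\<close>
  define \<kappa>' where "\<kappa>' = \<kappa> * (4 / \<eta>\<^sup>2)"
  have "\<exists>Q. Q \<subseteq> (\<Union>j\<in>J'. A' j) \<and> is_clique V E Q \<and> card Q = card J' + card (S - {j0})"
  proof (rule Suc.IH[of J' "S - {j0}" A' \<kappa>'])
    show "finite J'" "card J' = m" using cJ' by auto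
    show "m \<le> T" using Suc.prems(3) by simp
    show "S - {j0} \<subseteq> J'" using J(3) by (auto simp: J'_def)
    show "A' j \<subseteq> V" if "j \<in> J'" for j using AV[of j] A'sub[of j] that cJ'(3) by blast
    show "2 * a \<le> real (card (A' j)) * (\<eta> / 2) ^ m" if "j \<in> J'" for j
    proof -
      have "2 * a \<le> (\<eta> / 2 * real (card (A j))) * (\<eta> / 2) ^ m"
        using size[of j] that cJ'(3) by (simp add: mult_ac subset_iff)
      also have "\<dots> \<le> real (card (A' j)) * (\<eta> / 2) ^ m"
        using A'big[OF that] \<eta> by (intro mult_right_mono) auto
      finally show ?thesis .
    qed
    show "d i j * (real (card X) * real (card Y)) - \<kappa>' * (real (card (A' i)) * real (card (A' j)))
        \<le> (\<Sum>x\<in>X. \<Sum>y\<in>Y. adj E x y)"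
      if ij: "i \<in> J'" "j \<in> J'" "i \<noteq> j" and XY: "X \<subseteq> A' i" "Y \<subseteq> A' j" for i j X Y
    proof -
      have "(\<eta>/2 * real (card (A i))) * (\<eta>/2 * real (card (A j))) \<le> real (card (A' i)) * real (card (A' j))"
        using \<eta> by (intro mult_mono A'big ij) auto
      then have "\<kappa>' * ((\<eta>/2 * real (card (A i))) * (\<eta>/2 * real (card (A j)))) \<le>
          \<kappa>' * (real (card (A' i)) * real (card (A' j)))"
        using \<kappa>(1) by (intro mult_left_mono) (auto simp: \<kappa>'_def)
      moreover have "\<kappa>' * ((\<eta>/2 * real (card (A i))) * (\<eta>/2 * real (card (A j)))) =
          \<kappa> * (real (card (A i)) * real (card (A j)))"
        using \<eta>(1) by (simp add: \<kappa>'_def power2_eq_square)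
      moreover have "d i j * (real (card X) * real (card Y)) - \<kappa> * (real (card (A i)) * real (card (A j)))
        \<le> (\<Sum>x\<in>X. \<Sum>y\<in>Y. adj E x y)"
        using ij cJ'(3) order_trans[OF XY(1) A'sub] order_trans[OF XY(2) A'sub] by (intro reg) auto
      ultimately show ?thesis by linarith
    qed
    show "\<eta> \<le> d i j" if "i \<in> J'" "j \<in> J'" "i \<noteq> j" for i j
      by (rule d1) (use that cJ'(3) in auto)
    show "1/2 + \<eta> \<le> d i j" if "i \<in> S - {j0}" "j \<in> S - {j0}" "i \<noteq> j" for i j
      by (rule d2) (use that in auto)
    show "0 \<le> \<kappa>'" using \<kappa>(1) by (simp add: \<kappa>'_def)
    have "4 * real T * \<kappa> * (4 / \<eta>\<^sup>2) \<le> \<eta> * (\<eta>\<^sup>2 / 4) ^ Suc m * (4 / \<eta>\<^sup>2)"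
      using \<kappa>(2) by (intro mult_right_mono) auto
    then show "4 * real T * \<kappa>' \<le> \<eta> * (\<eta>\<^sup>2 / 4) ^ m"
      using \<eta>(1) by (simp add: \<kappa>'_def)
  qed
  then obtain Q where Q: "Q \<subseteq> (\<Union>j\<in>J'. A' j)" "is_clique V E Q" "card Q = card J' + card (S - {j0})"
    by blast
  have DQ: "{x, y} \<in> E" if "x \<in> D" "y \<in> Q" for x y using Q(1) that by (auto simp: A'_def)
  have fin: "finite D" "finite Q"
    using D(2) Q(2) fV by (auto simp: is_clique_def intro: finite_subset)
  have "D \<inter> Q = {}" using DQ simple_graphD(2)[OF G] by blast
  then have "card (D \<union> Q) = card D + card Q" using fin by (rule card_Un_disjoint[rotated 2])
  also have "\<dots> = card J + card S"
  proof -
    have "card J = card J' + 1" using J cJ' by simp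
    moreover have "card S = card (S - {j0}) + of_bool (j0 \<in> S)"
      using fS by (cases "j0 \<in> S") (auto simp: card_Diff_singleton card_gt_0_iff Suc_diff_Suc dest: card_Suc_Diff1)
    ultimately show ?thesis using D(3) Q(3) by simp
  qed
  finally have "card (D \<union> Q) = card J + card S" .
  moreover have "is_clique V E (D \<union> Q)"
    using D(2) Q(2) DQ unfolding is_clique_def by (metis UnE Un_least insert_commute)
  moreover have "D \<union> Q \<subseteq> (\<Union>j\<in>J. A j)"
  proof (rule Un_least)
    show "D \<subseteq> (\<Union>j\<in>J. A j)" using D(1) j0(1) by (rule order_trans[OF _ UN_upper])
    have "(\<Union>j\<in>J'. A' j) \<subseteq> (\<Union>j\<in>J. A j)" using cJ'(3) A'sub by (intro UN_mono)
    then show "Q \<subseteq> (\<Union>j\<in>J. A j)" using Q(1) by (rule order_trans[rotated])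
  qed
  ultimately show ?case by (intro exI[of _ "D \<union> Q"] conjI)
qed

section \<open>Upper bound\<close>

lemma sum_sum_fib:
  fixes g :: "'a \<Rightarrow> 'a \<Rightarrow> real"
  assumes "finite V" "A \<subseteq> V" "B \<subseteq> V"
  shows "(\<Sum>x\<in>A. \<Sum>y\<in>B. g x y) =
    (\<Sum>i\<in>c ` V. \<Sum>j\<in>c ` V. \<Sum>x\<in>A \<inter> fib V c i. \<Sum>y\<in>B \<inter> fib V c j. g x y)"
proof -
  have one: "(\<Sum>x\<in>A. h x) = (\<Sum>i\<in>c ` V. \<Sum>x\<in>A \<inter> fib V c i. h x)" if "A \<subseteq> V" for A and h :: "'a \<Rightarrow> real"
  proof -
    have "(\<Sum>i\<in>c ` V. \<Sum>x\<in>A \<inter> fib V c i. h x) = (\<Sum>i\<in>c ` V. \<Sum>x\<in>{x \<in> A. c x = i}. h x)"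
      by (rule sum.cong[OF refl], rule sum.cong[OF _ refl]) (use that in \<open>auto simp: fib_def\<close>)
    also have "\<dots> = (\<Sum>x\<in>A. h x)"
      by (rule sum.group) (use assms(1) that finite_subset in auto)
    finally show ?thesis by (rule sym)
  qed
  have "(\<Sum>x\<in>A. \<Sum>y\<in>B. g x y) = (\<Sum>i\<in>c ` V. \<Sum>x\<in>A \<inter> fib V c i. \<Sum>y\<in>B. g x y)"
    by (rule one[OF assms(2)])
  also have "\<dots> = (\<Sum>i\<in>c ` V. \<Sum>x\<in>A \<inter> fib V c i. \<Sum>j\<in>c ` V. \<Sum>y\<in>B \<inter> fib V c j. g x y)"
    by (rule sum.cong[OF refl], rule sum.cong[OF refl], rule one[OF assms(3)])
  also have "\<dots> = (\<Sum>i\<in>c ` V. \<Sum>j\<in>c ` V. \<Sum>x\<in>A \<inter> fib V c i. \<Sum>y\<in>B \<inter> fib V c j. g x y)"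
    by (rule sum.cong[OF refl], rule sum.swap)
  finally show ?thesis .
qed

lemma pair_density_sym:
  assumes "\<And>x y. f x y = f y x"
  shows "pair_density f X Y = pair_density f Y X"
proof -
  have "(\<Sum>x\<in>X. \<Sum>y\<in>Y. f x y) = (\<Sum>y\<in>Y. \<Sum>x\<in>X. f y x)"
    by (subst sum.swap) (simp only: assms[of _ "_ :: 'a"])
  then show ?thesis by (simp add: pair_density_def mult.commute)
qed

lemma regular_pairD:
  assumes "regular_pair \<epsilon> f X Y" "A \<subseteq> X" "B \<subseteq> Y"
  shows "\<bar>(\<Sum>x\<in>A. \<Sum>y\<in>B. f x y) - pair_density f X Y * (real (card A) * real (card B))\<bar>
    \<le> \<epsilon> * (real (card X) * real (card Y))"
proof -
  have "(\<Sum>x\<in>A. \<Sum>y\<in>B. f x y - pair_density f X Y) =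
      (\<Sum>x\<in>A. \<Sum>y\<in>B. f x y) - pair_density f X Y * (real (card A) * real (card B))"
    by (simp add: sum_subtractf)
  moreover have "\<bar>\<Sum>x\<in>A. \<Sum>y\<in>B. f x y - pair_density f X Y\<bar> \<le> \<epsilon> * real (card X) * real (card Y)"
    using assms unfolding regular_pair_def by blast
  ultimately show ?thesis by (simp only: mult.assoc)
qed

lemma regular_pair_sym:
  assumes sym: "\<And>x y. f x y = f y x" and "regular_pair \<epsilon> f X Y"
  shows "regular_pair \<epsilon> f Y X"
  unfolding regular_pair_def
proof (intro allI impI)
  fix A B assume AB: "A \<subseteq> Y" "B \<subseteq> X"
  have "(\<Sum>x\<in>A. \<Sum>y\<in>B. f x y - pair_density f Y X) = (\<Sum>y\<in>B. \<Sum>x\<in>A. f x y - pair_density f Y X)"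
    by (rule sum.swap)
  also have "\<dots> = (\<Sum>y\<in>B. \<Sum>x\<in>A. f y x - pair_density f X Y)"
    using pair_density_sym[of f X Y, OF sym] by (intro sum.cong refl) (simp add: sym)
  finally have "\<bar>\<Sum>x\<in>A. \<Sum>y\<in>B. f x y - pair_density f Y X\<bar> = \<bar>\<Sum>y\<in>B. \<Sum>x\<in>A. f y x - pair_density f X Y\<bar>"
    by (rule arg_cong)
  also have "\<dots> \<le> \<epsilon> * real (card X) * real (card Y)"
    using assms(2) AB unfolding regular_pair_def by blast
  finally show "\<bar>\<Sum>x\<in>A. \<Sum>y\<in>B. f x y - pair_density f Y X\<bar> \<le> \<epsilon> * real (card Y) * real (card X)"
    by (simp only: mult_ac)
qed

lemma hom_density_le_1:
  assumes "weighted_graph R"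
  shows "hom_density s (complete_edges s) R \<le> 1"
  unfolding hom_density_eq_hom_sum
  by (rule hom_sum_le_1) (use assms in \<open>auto simp: weighted_graph_def\<close>)

lemma hom_density_le_weighted_turan_density:
  fixes R :: "nat wgraph"
  assumes "weighted_graph R" "weighted_clique_free t R"
  shows "hom_density s (complete_edges s) R \<le> weighted_turan_density s t"
  unfolding weighted_turan_density_def
proof (rule cSup_upper)
  show "bdd_above {hom_density s (complete_edges s) R | R :: nat wgraph. weighted_graph R \<and> weighted_clique_free t R}"
    using hom_density_le_1 by (intro bdd_aboveI[of _ 1]) blast
qed (use assms in blast)

lemma is_clique_threshold_edgesD:
  assumes "is_clique (verts R) (threshold_edges R \<alpha>) S" "u \<in> S" "v \<in> S" "u \<noteq> v" "weighted_graph R"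
  shows "eweight R u v > \<alpha>"
proof -
  have "{u, v} \<in> threshold_edges R \<alpha>" using assms by (simp add: is_clique_def)
  then obtain u' v' where uv: "{u, v} = {u', v'}" "u' \<in> verts R" "v' \<in> verts R" "eweight R u' v' > \<alpha>"
    unfolding threshold_edges_def by blast
  have "eweight R u' v' = eweight R v' u'" using assms(5) uv by (simp add: weighted_graph_def)
  then show ?thesis using uv by (auto simp: doubleton_eq_iff)
qed

section \<open>The cluster graph of a partition\<close>

context
  fixes V :: "'a set" and E :: "'a set set" and c :: "'a \<Rightarrow> nat" and \<eta> \<epsilon> \<beta> :: real and n :: nat
  assumes G: "simple_graph V E" and n: "card V = n" "0 < n"
    and \<eta>: "0 < \<eta>" "\<eta> \<le> 1"
begin

text \<open>The lower bound on the sizes is there for the embedding: what is left of a part after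
  \<open>t\<close> rounds of taking common neighbourhoods must still be large enough to span an
  edge.\<close>

definition good :: "nat \<Rightarrow> nat \<Rightarrow> bool" where
  "good i j \<longleftrightarrow> i \<noteq> j \<and> regular_pair \<epsilon> (adj E) (fib V c i) (fib V c j) \<and>
     \<beta> * real n \<le> real (card (fib V c i)) \<and> \<beta> * real n \<le> real (card (fib V c j))"

text \<open>Lowering by \<open>\<eta>\<close> turns the strict thresholds \<open>0\<close> and
  \<open>1/2\<close> into densities above them by a fixed margin, which \<open>embed_clique\<close>
  consumes.\<close>

definition cweight :: "nat \<Rightarrow> nat \<Rightarrow> real" where
  "cweight i j = (if good i j then max 0 (pair_density (adj E) (fib V c i) (fib V c j) - \<eta>) else 0)"

definition cluster :: "nat wgraph" where
  "cluster = \<lparr>verts = c ` V, vweight = (\<lambda>i. real (card (fib V c i)) / real n), eweight = cweight\<rparr>"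

lemma finite_graph: "finite V"
  using simple_graphD(1)[OF G] .

lemma good_sym: "good i j \<Longrightarrow> good j i"
  unfolding good_def using regular_pair_sym[of "adj E"] adj_sym by metis

lemma cweight_sym: "cweight i j = cweight j i"
  unfolding cweight_def using good_sym pair_density_sym[of "adj E", OF adj_sym] by metis

lemma pair_density_adj_bounds: "0 \<le> pair_density (adj E) X Y" "pair_density (adj E) X Y \<le> 1"
proof -
  show "0 \<le> pair_density (adj E) X Y"
    unfolding pair_density_def by (intro divide_nonneg_nonneg sum_nonneg) auto
  have "(\<Sum>x\<in>X. \<Sum>y\<in>Y. adj E x y) \<le> (\<Sum>x\<in>X. \<Sum>y\<in>Y. 1)" by (intro sum_mono) simp
  then show "pair_density (adj E) X Y \<le> 1"
    unfolding pair_density_def by (auto simp: divide_le_eq_1)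
qed

lemma cweight_bounds: "0 \<le> cweight i j" "cweight i j \<le> 1"
  using pair_density_adj_bounds(2)[of "fib V c i" "fib V c j"] \<eta> by (auto simp: cweight_def)

lemma sum_card_fib: "(\<Sum>i\<in>c ` V. real (card (fib V c i))) = real n"
proof -
  have "(\<Sum>x\<in>V. 1) = (\<Sum>i\<in>c ` V. \<Sum>x\<in>fib V c i. (1::real))" by (rule sum_fib[OF finite_graph])
  then show ?thesis using n by simp
qed

lemma weighted_graph_cluster: "weighted_graph cluster"
  unfolding weighted_graph_def
proof (intro conjI ballI)
  fix v
  have "card (fib V c v) \<le> n" using n(1) card_mono[OF finite_graph fib_subset, of c v] by simp
  then show "vweight cluster v \<in> {0..1}" using n(2) by (simp add: cluster_def divide_le_eq_1)
  show "(\<Sum>v\<in>verts cluster. vweight cluster v) = 1"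
    using n sum_card_fib by (simp add: cluster_def sum_divide_distrib[symmetric])
qed (use finite_graph cweight_bounds cweight_sym in \<open>auto simp: cluster_def cweight_def good_def\<close>)

text \<open>The five \<open>\<epsilon>\<close> are the regularity error, the irregular pairs, the
  diagonal, and the small parts in the first and in the second place; \<open>\<eta>\<close> is the
  amount by which the weights were lowered.\<close>

lemma cluster_cut:
  assumes \<epsilon>: "0 \<le> \<epsilon>" and irr: "irregular \<epsilon> V c (adj E) \<le> \<epsilon> * real n ^ 2"
    and small: "\<And>i. real (card (fib V c i)) \<le> \<epsilon> * real n"
    and \<beta>: "0 \<le> \<beta>" and K: "real (card (c ` V)) * \<beta> \<le> \<epsilon>"
    and AB: "A \<subseteq> V" "B \<subseteq> V"
  shows "(\<Sum>x\<in>A. \<Sum>y\<in>B. adj E x y - cweight (c x) (c y)) \<le> (\<eta> + 5 * \<epsilon>) * real n ^ 2"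
proof -
  define sm where "sm i = (of_bool (real (card (fib V c i)) < \<beta> * real n) :: real)" for i
  define ir where "ir i j = (of_bool (\<not> regular_pair \<epsilon> (adj E) (fib V c i) (fib V c j)) :: real)" for i j
  define \<phi> where "\<phi> i j = (\<epsilon> + \<eta>) + ir i j + of_bool (i = j) + sm i + sm j" for i j :: nat
  have bnd: "(\<Sum>x\<in>A \<inter> fib V c i. \<Sum>y\<in>B \<inter> fib V c j. adj E x y - cweight (c x) (c y))
      \<le> (\<Sum>x\<in>V \<inter> fib V c i. \<Sum>y\<in>V \<inter> fib V c j. \<phi> (c x) (c y))" for i j
  proof -
    let ?X = "fib V c i" and ?Y = "fib V c j"
    let ?A = "A \<inter> ?X" and ?B = "B \<inter> ?Y"
    have fin: "finite ?X" "finite ?Y" by (rule finite_fib[OF finite_graph])+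
    have VX: "V \<inter> ?X = ?X" "V \<inter> ?Y = ?Y" using fib_subset[of V c i] fib_subset[of V c j] by blast+
    have cards: "real (card ?A) * real (card ?B) \<le> real (card ?X) * real (card ?Y)"
      using fin by (intro mult_mono of_nat_mono card_mono) auto
    have L: "(\<Sum>x\<in>?A. \<Sum>y\<in>?B. adj E x y - cweight (c x) (c y)) =
        (\<Sum>x\<in>?A. \<Sum>y\<in>?B. adj E x y) - cweight i j * (real (card ?A) * real (card ?B))"
    proof -
      have "(\<Sum>x\<in>?A. \<Sum>y\<in>?B. adj E x y - cweight (c x) (c y)) = (\<Sum>x\<in>?A. \<Sum>y\<in>?B. adj E x y - cweight i j)"
        by (intro sum.cong refl) (auto simp: fib_def)
      then show ?thesis by (simp add: sum_subtractf)
    qed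
    have R: "(\<Sum>x\<in>V \<inter> ?X. \<Sum>y\<in>V \<inter> ?Y. \<phi> (c x) (c y)) = \<phi> i j * (real (card ?X) * real (card ?Y))"
    proof -
      have "(\<Sum>x\<in>?X. \<Sum>y\<in>?Y. \<phi> (c x) (c y)) = (\<Sum>x\<in>?X. \<Sum>y\<in>?Y. \<phi> i j)"
        by (intro sum.cong refl) (auto simp: fib_def)
      then show ?thesis unfolding VX by simp
    qed
    show ?thesis
    proof (cases "good i j")
      case True
      let ?d = "pair_density (adj E) ?X ?Y"
      have reg: "regular_pair \<epsilon> (adj E) ?X ?Y" using True by (simp add: good_def)
      have "(\<Sum>x\<in>?A. \<Sum>y\<in>?B. adj E x y) - ?d * (real (card ?A) * real (card ?B))
          \<le> \<epsilon> * (real (card ?X) * real (card ?Y))"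
        by (rule abs_le_D1) (rule regular_pairD[OF reg]; blast)
      moreover have "?d * (real (card ?A) * real (card ?B)) \<le> (cweight i j + \<eta>) * (real (card ?A) * real (card ?B))"
        using True by (intro mult_right_mono) (auto simp: cweight_def)
      moreover have "\<eta> * (real (card ?A) * real (card ?B)) \<le> \<eta> * (real (card ?X) * real (card ?Y))"
        using \<eta> cards by (intro mult_left_mono) auto
      moreover have "(\<epsilon> + \<eta>) * (real (card ?X) * real (card ?Y)) \<le> \<phi> i j * (real (card ?X) * real (card ?Y))"
        by (intro mult_right_mono) (auto simp: \<phi>_def ir_def sm_def)
      ultimately show ?thesis unfolding L R by (simp only: distrib_right)
    next
      case False
      have "(\<Sum>x\<in>?A. \<Sum>y\<in>?B. adj E x y) \<le> (\<Sum>x\<in>?A. \<Sum>y\<in>?B. 1)" by (intro sum_mono) simp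
      then have "(\<Sum>x\<in>?A. \<Sum>y\<in>?B. adj E x y) \<le> 1 * (real (card ?X) * real (card ?Y))" using cards by simp
      also have "\<dots> \<le> \<phi> i j * (real (card ?X) * real (card ?Y))"
        using False \<epsilon> \<eta> by (intro mult_right_mono) (auto simp: \<phi>_def ir_def sm_def good_def)
      finally show ?thesis unfolding L R
        using cweight_bounds(1)[of i j] by (smt (verit) mult_nonneg_nonneg of_nat_0_le_iff)
    qed
  qed
  have "(\<Sum>x\<in>A. \<Sum>y\<in>B. adj E x y - cweight (c x) (c y)) \<le> (\<Sum>x\<in>V. \<Sum>y\<in>V. \<phi> (c x) (c y))"
    unfolding sum_sum_fib[OF finite_graph AB, of _ c] sum_sum_fib[OF finite_graph subset_refl subset_refl, of _ c]
    by (rule sum_mono, rule sum_mono, rule bnd)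
  also have "\<dots> = (\<epsilon> + \<eta>) * real n ^ 2 + irregular \<epsilon> V c (adj E) + (\<Sum>x\<in>V. \<Sum>y\<in>V. of_bool (c x = c y))
      + real n * (\<Sum>x\<in>V. sm (c x)) + real n * (\<Sum>x\<in>V. sm (c x))"
    using n by (simp add: \<phi>_def sum.distrib irregular_def ir_def power2_eq_square sum_distrib_left[symmetric])
  also have "\<dots> \<le> (\<epsilon> + \<eta>) * real n ^ 2 + \<epsilon> * real n ^ 2 + \<epsilon> * real n ^ 2
      + \<epsilon> * real n ^ 2 + \<epsilon> * real n ^ 2"
  proof -
    have "(\<Sum>x\<in>V. \<Sum>y\<in>V. of_bool (c x = c y)) \<le> (\<Sum>x\<in>V. \<epsilon> * real n)"
    proof (rule sum_mono)
      fix x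
      have "(\<Sum>y\<in>V. of_bool (c x = c y)) = real (card (fib V c (c x)))"
        using finite_graph by (simp add: fib_def Int_def eq_commute)
      then show "(\<Sum>y\<in>V. of_bool (c x = c y)) \<le> \<epsilon> * real n" using small[of "c x"] by simp
    qed
    then have 1: "(\<Sum>x\<in>V. \<Sum>y\<in>V. of_bool (c x = c y)) \<le> \<epsilon> * real n ^ 2"
      using n by (simp add: power2_eq_square mult_ac)
    have "(\<Sum>x\<in>V. sm (c x)) = (\<Sum>i\<in>c ` V. \<Sum>x\<in>fib V c i. sm (c x))" by (rule sum_fib[OF finite_graph])
    also have "\<dots> \<le> (\<Sum>i\<in>c ` V. \<beta> * real n)"
    proof (rule sum_mono)
      fix i assume i: "i \<in> c ` V"
      have "(\<Sum>x\<in>fib V c i. sm (c x)) = (\<Sum>x\<in>fib V c i. sm i)" by (intro sum.cong refl) (simp add: fib_def)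
      also have "\<dots> = real (card (fib V c i)) * sm i" by simp
      also have "\<dots> \<le> \<beta> * real n"
        using \<beta> by (simp add: sm_def)
      finally show "(\<Sum>x\<in>fib V c i. sm (c x)) \<le> \<beta> * real n" .
    qed
    also have "\<dots> = real (card (c ` V)) * \<beta> * real n" by simp
    also have "\<dots> \<le> \<epsilon> * real n" using K by (intro mult_right_mono) auto
    finally have "real n * (\<Sum>x\<in>V. sm (c x)) \<le> real n * (\<epsilon> * real n)"
      by (intro mult_left_mono) auto
    then have 2: "real n * (\<Sum>x\<in>V. sm (c x)) \<le> \<epsilon> * real n ^ 2" by (simp add: power2_eq_square mult_ac)
    show ?thesis using 1 2 irr by linarith
  qed
  also have "\<dots> = (\<eta> + 5 * \<epsilon>) * real n ^ 2" by (simp add: algebra_simps)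
  finally show ?thesis .
qed

lemma hom_sum_le_cluster:
  assumes \<epsilon>: "0 \<le> \<epsilon>" and irr: "irregular \<epsilon> V c (adj E) \<le> \<epsilon> * real n ^ 2"
    and small: "\<And>i. real (card (fib V c i)) \<le> \<epsilon> * real n"
    and \<beta>: "0 \<le> \<beta>" and K: "real (card (c ` V)) * \<beta> \<le> \<epsilon>"
  shows "hom_sum s V (\<lambda>_. 1 / real n) (adj E) \<le>
    hom_density s (complete_edges s) cluster + real (card (complete_edges s)) * (\<eta> + 5 * \<epsilon>)"
proof -
  have "hom_sum s V (\<lambda>_. 1 / real n) (adj E) \<le>
      hom_sum s V (\<lambda>_. 1 / real n) (\<lambda>x y. cweight (c x) (c y)) + real (card (complete_edges s)) * (\<eta> + 5 * \<epsilon>)"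
  proof (rule hom_sum_counting[OF finite_graph])
    show "(\<Sum>x\<in>V. 1 / real n) = 1" using n by simp
  next
    fix a b :: "'a \<Rightarrow> real"
    assume ab: "\<And>x. x \<in> V \<Longrightarrow> 0 \<le> a x \<and> a x \<le> 1" "\<And>x. x \<in> V \<Longrightarrow> 0 \<le> b x \<and> b x \<le> 1"
    show "(\<Sum>x\<in>V. \<Sum>y\<in>V. a x * b y * (1 / real n * (1 / real n) * (adj E x y - cweight (c x) (c y)))) \<le> \<eta> + 5 * \<epsilon>"
    proof (rule bilinear_le_if_sets_le[OF finite_graph ab])
      fix A B assume AB: "A \<subseteq> V" "B \<subseteq> V"
      have "(\<Sum>x\<in>A. \<Sum>y\<in>B. 1 / real n * (1 / real n) * (adj E x y - cweight (c x) (c y))) =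
          1 / real n * (1 / real n) * (\<Sum>x\<in>A. \<Sum>y\<in>B. adj E x y - cweight (c x) (c y))"
        by (simp only: sum_distrib_left)
      also have "\<dots> \<le> 1 / real n * (1 / real n) * ((\<eta> + 5 * \<epsilon>) * real n ^ 2)"
        by (rule mult_left_mono[OF cluster_cut[OF \<epsilon> irr small \<beta> K AB]]) simp
      also have "\<dots> = \<eta> + 5 * \<epsilon>" using n by (simp add: power2_eq_square)
      finally show "(\<Sum>x\<in>A. \<Sum>y\<in>B. 1 / real n * (1 / real n) * (adj E x y - cweight (c x) (c y))) \<le> \<eta> + 5 * \<epsilon>" .
    qed
  qed (simp_all add: cweight_bounds)
  also have "hom_sum s V (\<lambda>_. 1 / real n) (\<lambda>x y. cweight (c x) (c y)) =
      hom_sum s (c ` V) (\<lambda>i. \<Sum>x | x \<in> V \<and> c x = i. 1 / real n) cweight"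
    by (rule hom_sum_pullback) (use finite_graph in auto)
  also have "\<dots> = hom_density s (complete_edges s) cluster"
    by (simp add: hom_density_eq_hom_sum cluster_def fib_def)
  finally show ?thesis .
qed

lemma clique_free_cluster:
  assumes free: "clique_free t V E" and a: "0 < a" "2 * a \<le> \<beta> * real n * (\<eta> / 2) ^ t"
    and edge: "\<And>X. X \<subseteq> V \<Longrightarrow> a \<le> real (card X) \<Longrightarrow> \<exists>x\<in>X. \<exists>y\<in>X. {x, y} \<in> E"
    and \<epsilon>: "0 \<le> \<epsilon>" "4 * real t * \<epsilon> \<le> \<eta> * (\<eta>\<^sup>2 / 4) ^ t"
    and t: "3 \<le> t"
  shows "weighted_clique_free t cluster"
  unfolding weighted_clique_free_def
proof (rule ccontr)
  assume "weighted_cliques t cluster \<noteq> {}"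
  then obtain S1 S2 where S: "S2 \<subseteq> S1" "S1 \<subseteq> verts cluster" "card S1 + card S2 = t" "1 \<le> card S2"
    and cl: "is_clique (verts cluster) (threshold_edges cluster 0) S1"
      "is_clique (verts cluster) (threshold_edges cluster (1/2)) S2"
    unfolding weighted_cliques_def by blast
  have w1: "good i j \<and> pair_density (adj E) (fib V c i) (fib V c j) > \<eta>"
    if "i \<in> S1" "j \<in> S1" "i \<noteq> j" for i j
  proof -
    have "eweight cluster i j > 0"
      by (rule is_clique_threshold_edgesD[OF cl(1) that weighted_graph_cluster])
    then show ?thesis by (simp add: cluster_def cweight_def split: if_splits)
  qed
  have w2: "pair_density (adj E) (fib V c i) (fib V c j) \<ge> 1/2 + \<eta>"
    if "i \<in> S2" "j \<in> S2" "i \<noteq> j" for i j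
  proof -
    have "eweight cluster i j > 1/2"
      by (rule is_clique_threshold_edgesD[OF cl(2) that weighted_graph_cluster])
    then show ?thesis by (auto simp: cluster_def cweight_def max_def split: if_splits)
  qed
  have fin: "finite S1" using S(2) finite_graph by (auto simp: cluster_def intro: finite_subset)
  \<comment> \<open>A second element of \<open>S1\<close> puts each part of \<open>S1\<close> into a
    good pair, and only this shows that the part is large.\<close>
  have two: "2 \<le> card S1"
  proof -
    have "card S2 \<le> card S1" using S(1) fin by (rule card_mono[rotated])
    then show ?thesis using S(3) t by linarith
  qed
  have "\<exists>Q. Q \<subseteq> (\<Union>j\<in>S1. fib V c j) \<and> is_clique V E Q \<and> card Q = card S1 + card S2"
  proof (rule embed_clique[OF G \<eta> a(1) edge fin refl _ S(1) fib_subset, where T = t and \<kappa> = \<epsilon> and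
      d = "\<lambda>i j. pair_density (adj E) (fib V c i) (fib V c j)"])
    show m: "card S1 \<le> t" using S(3) by linarith
    show "2 * a \<le> real (card (fib V c j)) * (\<eta> / 2) ^ card S1" if j: "j \<in> S1" for j
    proof -
      have "S1 - {j} \<noteq> {}"
      proof
        assume "S1 - {j} = {}"
        then have "S1 \<subseteq> {j}" by blast
        then have "card S1 \<le> card {j}" by (intro card_mono) auto
        then show False using two by simp
      qed
      then obtain i where "i \<in> S1" "i \<noteq> j" by blast
      then have "\<beta> * real n \<le> real (card (fib V c j))" using w1[of i j] j by (simp add: good_def)
      moreover have "(\<eta> / 2) ^ t \<le> (\<eta> / 2) ^ card S1" using \<eta> m by (intro power_decreasing) auto
      ultimately have "\<beta> * real n * (\<eta> / 2) ^ t \<le> real (card (fib V c j)) * (\<eta> / 2) ^ card S1"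
        using \<eta> by (intro mult_mono) auto
      then show ?thesis using a(2) by linarith
    qed
    show "pair_density (adj E) (fib V c i) (fib V c j) * (real (card X) * real (card Y))
        - \<epsilon> * (real (card (fib V c i)) * real (card (fib V c j))) \<le> (\<Sum>x\<in>X. \<Sum>y\<in>Y. adj E x y)"
      if "i \<in> S1" "j \<in> S1" "i \<noteq> j" and XY: "X \<subseteq> fib V c i" "Y \<subseteq> fib V c j" for i j X Y
    proof -
      have "regular_pair \<epsilon> (adj E) (fib V c i) (fib V c j)" using w1[OF that(1-3)] by (simp add: good_def)
      from regular_pairD[OF this XY] show ?thesis by linarith
    qed
    show "\<eta> \<le> pair_density (adj E) (fib V c i) (fib V c j)" if "i \<in> S1" "j \<in> S1" "i \<noteq> j" for i j
      using w1[OF that] by linarith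
    show "1/2 + \<eta> \<le> pair_density (adj E) (fib V c i) (fib V c j)" if "i \<in> S2" "j \<in> S2" "i \<noteq> j" for i j
      by (rule w2[OF that])
    have "(\<eta>\<^sup>2 / 4) ^ t \<le> (\<eta>\<^sup>2 / 4) ^ card S1"
    proof (rule power_decreasing[OF m])
      have "\<eta>\<^sup>2 \<le> 1" using \<eta> by (intro power_le_one) auto
      then show "\<eta>\<^sup>2 / 4 \<le> 1" by simp
    qed simp
    then have "\<eta> * (\<eta>\<^sup>2 / 4) ^ t \<le> \<eta> * (\<eta>\<^sup>2 / 4) ^ card S1" using \<eta> by (intro mult_left_mono) auto
    then show "4 * real t * \<epsilon> \<le> \<eta> * (\<eta>\<^sup>2 / 4) ^ card S1" using \<epsilon>(2) by linarith
  qed (simp_all add: \<epsilon>(1))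
  then obtain Q where "is_clique V E Q" "card Q = t" using S(3) by auto
  then show False using free by (auto simp: clique_free_def)
qed

end

lemma hom_sum_le_weighted_turan_density:
  fixes s t :: nat
  assumes t: "3 \<le> t" and e: "0 < e"
  obtains \<delta> N where "0 < \<delta>" "\<And>n E. N \<le> n \<Longrightarrow> simple_graph {..<n} E \<Longrightarrow> clique_free t {..<n} E \<Longrightarrow>
    real (independence_number {..<n} E) < \<delta> * real n \<Longrightarrow>
    hom_sum s {..<n} (\<lambda>_. 1 / real n) (adj E) \<le> weighted_turan_density s t + e"
proof -
  define P where "P = real (card (complete_edges s))"
  \<comment> \<open>Since \<open>\<epsilon> \<le> \<eta>\<close> below, each of the \<open>P\<close>
    edges costs at most \<open>\<eta> + 5 * \<epsilon> \<le> 6 * \<eta>\<close>.\<close>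
  define \<eta> where "\<eta> = min 1 (e / (6 * (P + 1)))"
  have P: "0 \<le> P" by (simp add: P_def)
  have \<eta>: "0 < \<eta>" "\<eta> \<le> 1" "6 * P * \<eta> \<le> e"
  proof -
    show "0 < \<eta>" "\<eta> \<le> 1" using e P by (auto simp: \<eta>_def)
    have "6 * P * \<eta> \<le> 6 * (P + 1) * (e / (6 * (P + 1)))"
      using P \<open>0 < \<eta>\<close> by (intro mult_mono) (auto simp: \<eta>_def)
    also have "\<dots> = e" using P by simp
    finally show "6 * P * \<eta> \<le> e" .
  qed
  define \<epsilon> where "\<epsilon> = min \<eta> (\<eta> * (\<eta>\<^sup>2 / 4) ^ t / (4 * real t))"
  have \<epsilon>: "0 < \<epsilon>" "\<epsilon> \<le> \<eta>" "4 * real t * \<epsilon> \<le> \<eta> * (\<eta>\<^sup>2 / 4) ^ t"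
  proof -
    show "0 < \<epsilon>" "\<epsilon> \<le> \<eta>" using \<eta> t by (auto simp: \<epsilon>_def)
    have "4 * real t * \<epsilon> \<le> 4 * real t * (\<eta> * (\<eta>\<^sup>2 / 4) ^ t / (4 * real t))"
      by (intro mult_left_mono) (auto simp: \<epsilon>_def)
    also have "\<dots> = \<eta> * (\<eta>\<^sup>2 / 4) ^ t" using t by simp
    finally show "4 * real t * \<epsilon> \<le> \<eta> * (\<eta>\<^sup>2 / 4) ^ t" .
  qed
  obtain k :: nat where k: "2 / \<epsilon> + 1 \<le> real k" using real_arch_simple by blast
  obtain K where K: "\<And>V f (c::nat \<Rightarrow> nat). finite V \<Longrightarrow> (\<forall>x\<in>V. \<forall>y\<in>V. 0 \<le> f x y \<and> f x y \<le> 1) \<Longrightarrow>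
    card (c ` V) \<le> k \<Longrightarrow>
    \<exists>c'::nat \<Rightarrow> nat. (\<forall>x\<in>V. \<forall>y\<in>V. c' x = c' y \<longrightarrow> c x = c y) \<and> card (c' ` V) \<le> K \<and>
       irregular \<epsilon> V c' f \<le> \<epsilon> * real (card V) ^ 2"
    using regularity_lemma[OF \<epsilon>(1), of k] by blast
  \<comment> \<open>With at most \<open>K\<close> parts, all parts smaller than
    \<open>\<beta> * n\<close> together contain at most \<open>\<epsilon> * n\<close>
    vertices.\<close>
  define \<beta> where "\<beta> = \<epsilon> / (real K + 1)"
  \<comment> \<open>A part of size \<open>\<beta> * n\<close> that shrinks \<open>t\<close> times by
    the factor \<open>\<eta> / 2\<close> still has \<open>2 * \<delta> * n\<close> vertices.\<close>
  define \<delta> where "\<delta> = \<beta> * (\<eta> / 2) ^ t / 2"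
  have \<beta>: "0 < \<beta>" using \<epsilon> by (simp add: \<beta>_def)
  have \<delta>: "0 < \<delta>" using \<beta> \<eta> by (simp add: \<delta>_def)
  obtain N :: nat where N: "1 / \<epsilon> + 1 \<le> real N" using real_arch_simple by blast
  have "hom_sum s {..<n} (\<lambda>_. 1 / real n) (adj E) \<le> weighted_turan_density s t + e"
    if n: "N \<le> n" and E: "simple_graph {..<n} E" "clique_free t {..<n} E"
      and ind: "real (independence_number {..<n} E) < \<delta> * real n" for n E
  proof -
    have nN: "1 / \<epsilon> + 1 \<le> real n" using n N by linarith
    then have n1: "1 \<le> \<epsilon> * real n" using \<epsilon>(1) by (simp add: field_simps)
    have n0: "0 < n" using n1 by (cases n) auto
    define m where "m = nat \<lfloor>\<epsilon> * real n\<rfloor>"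
    have m: "real m \<le> \<epsilon> * real n" "\<epsilon> * real n < real m + 1" "1 \<le> m"
    proof -
      show "real m \<le> \<epsilon> * real n" "\<epsilon> * real n < real m + 1" using n1 unfolding m_def by linarith+
      show "1 \<le> m" using n1 unfolding m_def by linarith
    qed
    \<comment> \<open>Starting from intervals of length at most \<open>\<epsilon> * n\<close> keeps
      all parts of every refinement that small, which bounds the diagonal.\<close>
    define c0 where "c0 x = x div m" for x
    have c0: "card (c0 ` {..<n}) \<le> k"
    proof -
      have "c0 ` {..<n} \<subseteq> {..n div m}" by (auto simp: c0_def intro: div_le_mono)
      then have "card (c0 ` {..<n}) \<le> n div m + 1" using card_mono[of "{..n div m}"] by simp
      moreover have "real (n div m) \<le> 2 / \<epsilon>"
      proof -
        have "real (n div m * m) \<le> real n" by (simp only: of_nat_le_iff div_times_less_eq_dividend)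
        then have "real (n div m) \<le> real n / real m" using m(3) by (simp add: field_simps)
        also have "\<dots> \<le> 2 / \<epsilon>"
        proof -
          have "\<epsilon> * real n \<le> 2 * real m" using m by linarith
          then show ?thesis using m(3) \<epsilon>(1) by (simp add: field_simps)
        qed
        finally show ?thesis .
      qed
      ultimately show ?thesis using k by linarith
    qed
    obtain c :: "nat \<Rightarrow> nat" where c: "\<forall>x\<in>{..<n}. \<forall>y\<in>{..<n}. c x = c y \<longrightarrow> c0 x = c0 y"
      "card (c ` {..<n}) \<le> K" "irregular \<epsilon> {..<n} c (adj E) \<le> \<epsilon> * real (card {..<n}) ^ 2"
      using K[of "{..<n}" "adj E" c0, OF _ _ c0] by auto
    have small: "real (card (fib {..<n} c i)) \<le> \<epsilon> * real n" for i
    proof (cases "fib {..<n} c i = {}")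
      case True
      then show ?thesis using n1 by simp
    next
      case False
      then obtain x where x: "x \<in> fib {..<n} c i" by blast
      have "fib {..<n} c i \<subseteq> {x div m * m..<x div m * m + m}"
      proof
        fix y assume y: "y \<in> fib {..<n} c i"
        then have "c0 y = c0 x" using c(1) x by (auto simp: fib_def)
        then have "y div m = x div m" by (simp add: c0_def)
        moreover have "y div m * m \<le> y" "y < y div m * m + m"
          using div_mult_mod_eq[of y m] mod_less_divisor[of m y] m(3) by linarith+
        ultimately show "y \<in> {x div m * m..<x div m * m + m}" by simp
      qed
      then have "card (fib {..<n} c i) \<le> m" using card_mono[of "{x div m * m..<x div m * m + m}"] by simp
      then show ?thesis using m(1) by linarith
    qed
    have Kb: "real (card (c ` {..<n})) * \<beta> \<le> \<epsilon>"
    proof -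
      have "real (card (c ` {..<n})) * \<beta> \<le> (real K + 1) * \<beta>" using c(2) \<beta> by (intro mult_right_mono) auto
      also have "\<dots> = \<epsilon>" by (simp add: \<beta>_def)
      finally show ?thesis .
    qed
    let ?R = "cluster {..<n} E c \<eta> \<epsilon> \<beta> n"
    have irr: "irregular \<epsilon> {..<n} c (adj E) \<le> \<epsilon> * real n ^ 2" using c(3) by simp
    have R: "weighted_graph ?R"
      by (rule weighted_graph_cluster[OF E(1) _ n0 \<eta>(1,2)]) simp
    have free: "weighted_clique_free t ?R"
    proof (rule clique_free_cluster[OF E(1) _ n0 \<eta>(1,2) E(2)])
      show "0 < \<delta> * real n" using \<delta> n0 by simp
      show "2 * (\<delta> * real n) \<le> \<beta> * real n * (\<eta> / 2) ^ t" by (simp add: \<delta>_def)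
      show "\<exists>x\<in>X. \<exists>y\<in>X. {x, y} \<in> E" if X: "X \<subseteq> {..<n}" "\<delta> * real n \<le> real (card X)" for X
      proof (rule ccontr)
        assume "\<not> ?thesis"
        then have "is_independent {..<n} E X" using X(1) by (simp add: is_independent_def)
        then have "card X \<le> independence_number {..<n} E" by (intro card_le_independence_number) auto
        then show False using ind X(2) by linarith
      qed
    qed (use \<epsilon> t in auto)
    have "hom_sum s {..<n} (\<lambda>_. 1 / real n) (adj E) \<le>
        hom_density s (complete_edges s) ?R + P * (\<eta> + 5 * \<epsilon>)"
      unfolding P_def
      by (rule hom_sum_le_cluster[OF E(1) _ n0 \<eta>(1,2) _ irr small _ Kb]) (use \<epsilon> \<beta> in auto)
    also have "\<dots> \<le> weighted_turan_density s t + e"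
    proof (rule add_mono)
      show "hom_density s (complete_edges s) ?R \<le> weighted_turan_density s t"
        by (rule hom_density_le_weighted_turan_density[OF R free])
      have "P * (\<eta> + 5 * \<epsilon>) \<le> P * (6 * \<eta>)" using P \<epsilon>(2) by (intro mult_left_mono) auto
      then show "P * (\<eta> + 5 * \<epsilon>) \<le> e" using \<eta>(3) by (simp add: mult_ac)
    qed
    finally show ?thesis .
  qed
  then show ?thesis using that[OF \<delta>] by blast
qed

section \<open>Concentration of measure on grids\<close>

lemma sum_sum_swap4:
  fixes g :: "'a \<Rightarrow> 'b \<Rightarrow> 'a \<Rightarrow> 'b \<Rightarrow> real"
  shows "(\<Sum>a\<in>A. \<Sum>b\<in>B. \<Sum>a'\<in>A. \<Sum>b'\<in>B. g a b a' b') = (\<Sum>a\<in>A. \<Sum>a'\<in>A. \<Sum>b\<in>B. \<Sum>b'\<in>B. g a b a' b')"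
  by (rule sum.cong[OF refl]) (rule sum.swap)

text \<open>Pointwise, the squared sides of a quadrilateral dominate its squared diagonals.\<close>

lemma variance_product_le:
  fixes F :: "'a \<Rightarrow> 'b \<Rightarrow> real"
  shows "(\<Sum>a\<in>A. \<Sum>b\<in>B. \<Sum>a'\<in>A. \<Sum>b'\<in>B. (F a b - F a' b')\<^sup>2) \<le>
    real (card A) * (\<Sum>a\<in>A. \<Sum>b\<in>B. \<Sum>b'\<in>B. (F a b - F a b')\<^sup>2) +
    real (card B) * (\<Sum>b\<in>B. \<Sum>a\<in>A. \<Sum>a'\<in>A. (F a b - F a' b)\<^sup>2)"
proof -
  let ?S = "\<lambda>g. (\<Sum>a\<in>A. \<Sum>a'\<in>A. \<Sum>b\<in>B. \<Sum>b'\<in>B. g a a' b b' :: real)"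
  have flipa: "?S g = ?S (\<lambda>a a' b b'. g a' a b b')" for g by (rule sum.swap)
  have flipb: "?S g = ?S (\<lambda>a a' b b'. g a a' b' b)" for g
    by (rule sum.cong[OF refl], rule sum.cong[OF refl], rule sum.swap)
  have add: "?S (\<lambda>a a' b b'. g a a' b b' + g' a a' b b') = ?S g + ?S g'" for g g'
    by (simp only: sum.distrib)
  have "?S (\<lambda>a a' b b'. (F a b - F a' b')\<^sup>2 + (F a b' - F a' b)\<^sup>2) \<le>
      ?S (\<lambda>a a' b b'. ((F a b - F a b')\<^sup>2 + (F a' b - F a' b')\<^sup>2) + ((F a b - F a' b)\<^sup>2 + (F a b' - F a' b')\<^sup>2))"
  proof (intro sum_mono)
    fix a a' b b'
    have "((F a b - F a b')\<^sup>2 + (F a' b - F a' b')\<^sup>2) + ((F a b - F a' b)\<^sup>2 + (F a b' - F a' b')\<^sup>2)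
        - ((F a b - F a' b')\<^sup>2 + (F a b' - F a' b)\<^sup>2) = (F a b - F a b' - F a' b + F a' b')\<^sup>2"
      by (simp add: power2_eq_square algebra_simps)
    moreover have "0 \<le> (F a b - F a b' - F a' b + F a' b')\<^sup>2" by (rule zero_le_power2)
    ultimately show "(F a b - F a' b')\<^sup>2 + (F a b' - F a' b)\<^sup>2 \<le>
        ((F a b - F a b')\<^sup>2 + (F a' b - F a' b')\<^sup>2) + ((F a b - F a' b)\<^sup>2 + (F a b' - F a' b')\<^sup>2)"
      by linarith
  qed
  then have "?S (\<lambda>a a' b b'. (F a b - F a' b')\<^sup>2) + ?S (\<lambda>a a' b b'. (F a b' - F a' b)\<^sup>2) \<le>
      (?S (\<lambda>a a' b b'. (F a b - F a b')\<^sup>2) + ?S (\<lambda>a a' b b'. (F a' b - F a' b')\<^sup>2)) +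
      (?S (\<lambda>a a' b b'. (F a b - F a' b)\<^sup>2) + ?S (\<lambda>a a' b b'. (F a b' - F a' b')\<^sup>2))"
    by (simp only: add)
  moreover have "?S (\<lambda>a a' b b'. (F a b' - F a' b)\<^sup>2) = ?S (\<lambda>a a' b b'. (F a b - F a' b')\<^sup>2)"
    by (rule flipb)
  moreover have "?S (\<lambda>a a' b b'. (F a' b - F a' b')\<^sup>2) = ?S (\<lambda>a a' b b'. (F a b - F a b')\<^sup>2)"
    by (rule flipa)
  moreover have "?S (\<lambda>a a' b b'. (F a b' - F a' b')\<^sup>2) = ?S (\<lambda>a a' b b'. (F a b - F a' b)\<^sup>2)"
    by (rule flipb)
  ultimately have "?S (\<lambda>a a' b b'. (F a b - F a' b')\<^sup>2) \<le>
      ?S (\<lambda>a a' b b'. (F a b - F a b')\<^sup>2) + ?S (\<lambda>a a' b b'. (F a b - F a' b)\<^sup>2)"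
    by linarith
  also have "?S (\<lambda>a a' b b'. (F a b - F a b')\<^sup>2) = real (card A) * (\<Sum>a\<in>A. \<Sum>b\<in>B. \<Sum>b'\<in>B. (F a b - F a b')\<^sup>2)"
    by (simp add: sum_distrib_left)
  also have "?S (\<lambda>a a' b b'. (F a b - F a' b)\<^sup>2) = real (card B) * (\<Sum>b\<in>B. \<Sum>a\<in>A. \<Sum>a'\<in>A. (F a b - F a' b)\<^sup>2)"
  proof -
    have "?S (\<lambda>a a' b b'. (F a b - F a' b)\<^sup>2) = (\<Sum>a\<in>A. \<Sum>a'\<in>A. \<Sum>b\<in>B. real (card B) * (F a b - F a' b)\<^sup>2)"
      by simp
    also have "\<dots> = (\<Sum>a\<in>A. \<Sum>b\<in>B. \<Sum>a'\<in>A. real (card B) * (F a b - F a' b)\<^sup>2)"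
      by (rule sum.cong[OF refl], rule sum.swap)
    also have "\<dots> = (\<Sum>b\<in>B. \<Sum>a\<in>A. \<Sum>a'\<in>A. real (card B) * (F a b - F a' b)\<^sup>2)" by (rule sum.swap)
    finally show ?thesis by (simp only: sum_distrib_left)
  qed
  finally show ?thesis by (simp only: sum_sum_swap4)
qed

text \<open>The Efron--Stein inequality: a variance on a product is at most the sum of the mean
  variances in single coordinates. Writing variances as double sums over two copies avoids means;
  the powers of \<open>card S\<close> are the normalisation.\<close>

lemma efron_stein:
  fixes F :: "('i \<Rightarrow> 'b) \<Rightarrow> real"
  assumes "finite I"
  shows "real (card S) * (\<Sum>x\<in>I \<rightarrow>\<^sub>E S. \<Sum>y\<in>I \<rightarrow>\<^sub>E S. (F x - F y)\<^sup>2) \<le>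
    real (card S) ^ card I * (\<Sum>i\<in>I. \<Sum>x\<in>I \<rightarrow>\<^sub>E S. \<Sum>b\<in>S. (F x - F (x(i := b)))\<^sup>2)"
  using assms
proof (induction I arbitrary: F rule: finite_induct)
  case empty
  then show ?case by simp
next
  case (insert i I)
  let ?X = "I \<rightarrow>\<^sub>E S" and ?M = "real (card S)"
  define G where "G a u = F (u(i := a))" for a u
  have cX: "real (card ?X) = ?M ^ card I" using insert(1) by (simp add: card_funcsetE)
  have "(\<Sum>x\<in>insert i I \<rightarrow>\<^sub>E S. \<Sum>y\<in>insert i I \<rightarrow>\<^sub>E S. (F x - F y)\<^sup>2)
      = (\<Sum>a\<in>S. \<Sum>u\<in>?X. \<Sum>a'\<in>S. \<Sum>u'\<in>?X. (G a u - G a' u')\<^sup>2)"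
    by (simp only: sum_PiE_insert[OF insert(2)] G_def)
  also have "\<dots> \<le> ?M * (\<Sum>a\<in>S. \<Sum>u\<in>?X. \<Sum>u'\<in>?X. (G a u - G a u')\<^sup>2) +
      real (card ?X) * (\<Sum>u\<in>?X. \<Sum>a\<in>S. \<Sum>a'\<in>S. (G a u - G a' u)\<^sup>2)"
    by (rule variance_product_le)
  finally have "?M * (\<Sum>x\<in>insert i I \<rightarrow>\<^sub>E S. \<Sum>y\<in>insert i I \<rightarrow>\<^sub>E S. (F x - F y)\<^sup>2) \<le>
      ?M * (?M * (\<Sum>a\<in>S. \<Sum>u\<in>?X. \<Sum>u'\<in>?X. (G a u - G a u')\<^sup>2) +
      real (card ?X) * (\<Sum>u\<in>?X. \<Sum>a\<in>S. \<Sum>a'\<in>S. (G a u - G a' u)\<^sup>2))"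
    by (rule mult_left_mono) simp
  also have "\<dots> = ?M * (\<Sum>a\<in>S. ?M * (\<Sum>u\<in>?X. \<Sum>u'\<in>?X. (G a u - G a u')\<^sup>2)) +
      ?M ^ card (insert i I) * (\<Sum>u\<in>?X. \<Sum>a\<in>S. \<Sum>a'\<in>S. (G a u - G a' u)\<^sup>2)"
    using insert(1,2) by (simp add: cX sum_distrib_left algebra_simps)
  also have "(\<Sum>u\<in>?X. \<Sum>a\<in>S. \<Sum>a'\<in>S. (G a u - G a' u)\<^sup>2) =
      (\<Sum>x\<in>insert i I \<rightarrow>\<^sub>E S. \<Sum>b\<in>S. (F x - F (x(i := b)))\<^sup>2)"
  proof -
    have "(\<Sum>x\<in>insert i I \<rightarrow>\<^sub>E S. \<Sum>b\<in>S. (F x - F (x(i := b)))\<^sup>2) =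
        (\<Sum>a\<in>S. \<Sum>u\<in>?X. \<Sum>a'\<in>S. (G a u - G a' u)\<^sup>2)"
      by (simp only: sum_PiE_insert[OF insert(2)] G_def fun_upd_upd)
    then show ?thesis by (simp only: sum.swap[of _ S ?X])
  qed
  also have "?M * (\<Sum>a\<in>S. ?M * (\<Sum>u\<in>?X. \<Sum>u'\<in>?X. (G a u - G a u')\<^sup>2)) \<le>
      ?M * (\<Sum>a\<in>S. ?M ^ card I * (\<Sum>j\<in>I. \<Sum>u\<in>?X. \<Sum>b\<in>S. (G a u - G a (u(j := b)))\<^sup>2))"
    by (intro mult_left_mono sum_mono insert.IH) simp
  also have "\<dots> = ?M ^ card (insert i I) * (\<Sum>a\<in>S. \<Sum>j\<in>I. \<Sum>u\<in>?X. \<Sum>b\<in>S. (G a u - G a (u(j := b)))\<^sup>2)"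
    using insert(1,2) by (simp add: sum_distrib_left mult_ac)
  also have "(\<Sum>a\<in>S. \<Sum>j\<in>I. \<Sum>u\<in>?X. \<Sum>b\<in>S. (G a u - G a (u(j := b)))\<^sup>2) =
      (\<Sum>j\<in>I. \<Sum>x\<in>insert i I \<rightarrow>\<^sub>E S. \<Sum>b\<in>S. (F x - F (x(j := b)))\<^sup>2)"
  proof -
    have "(\<Sum>a\<in>S. \<Sum>j\<in>I. \<Sum>u\<in>?X. \<Sum>b\<in>S. (G a u - G a (u(j := b)))\<^sup>2) =
        (\<Sum>j\<in>I. \<Sum>a\<in>S. \<Sum>u\<in>?X. \<Sum>b\<in>S. (G a u - G a (u(j := b)))\<^sup>2)"
      by (rule sum.swap)
    also have "\<dots> = (\<Sum>j\<in>I. \<Sum>x\<in>insert i I \<rightarrow>\<^sub>E S. \<Sum>b\<in>S. (F x - F (x(j := b)))\<^sup>2)"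
    proof (rule sum.cong[OF refl])
      fix j assume "j \<in> I"
      then have "j \<noteq> i" using insert(2) by auto
      then have "G a (u(j := b)) = F (u(i := a, j := b))" for a u b
        unfolding G_def by (subst fun_upd_twist) simp_all
      then show "(\<Sum>a\<in>S. \<Sum>u\<in>?X. \<Sum>b\<in>S. (G a u - G a (u(j := b)))\<^sup>2) =
          (\<Sum>x\<in>insert i I \<rightarrow>\<^sub>E S. \<Sum>b\<in>S. (F x - F (x(j := b)))\<^sup>2)"
        by (simp only: sum_PiE_insert[OF insert(2)] G_def)
    qed
    finally show ?thesis .
  qed
  finally show ?case by (simp only: sum.insert[OF insert(1,2)] distrib_left add.commute)
qed

section \<open>Poincare inequality and concentration on the grid\<close>

definition grid :: "nat \<Rightarrow> int set" where
  "grid N = {- int N..int N}"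

lemma finite_grid [simp]: "finite (grid N)"
  by (simp add: grid_def)

lemma card_grid: "card (grid N) = 2 * N + 1"
  by (simp add: grid_def)

lemma telescope_int:
  fixes g :: "int \<Rightarrow> real"
  shows "a \<le> b \<Longrightarrow> g b - g a = (\<Sum>k\<in>{a..<b}. g (k + 1) - g k)"
proof (induction b rule: int_ge_induct)
  case (step b)
  have "{a..<b + 1} = insert b {a..<b}" using step(1) by auto
  then show ?case using step by simp
qed simp

text \<open>\<open>v k\<close> controls only increases of \<open>g\<close> away from
  \<open>k\<close>. A decrease from \<open>k\<close> to \<open>k + 1\<close> is an increase in the
  opposite direction, so every step is charged to one of its ends and every point at most twice.
  Cauchy--Schwarz along the path supplies the factor \<open>2 * N\<close>.\<close>

lemma path_poincare:
  fixes g v :: "int \<Rightarrow> real"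
  assumes v: "\<And>k k'. k \<in> grid N \<Longrightarrow> k' \<in> grid N \<Longrightarrow> \<bar>k - k'\<bar> = 1 \<Longrightarrow> g k' - g k \<le> v k"
  shows "(\<Sum>a\<in>grid N. \<Sum>b\<in>grid N. (g a - g b)\<^sup>2) \<le>
    real (card (grid N)) ^ 2 * (4 * real N * (\<Sum>k\<in>grid N. (v k)\<^sup>2))"
proof -
  let ?E = "{- int N..<int N}"
  define T where "T = (\<Sum>k\<in>?E. (g (k + 1) - g k)\<^sup>2)"
  have le: "(g b - g a)\<^sup>2 \<le> 2 * real N * T" if ab: "a \<in> grid N" "b \<in> grid N" "a \<le> b" for a b
  proof -
    have sub: "{a..<b} \<subseteq> ?E" using ab by (auto simp: grid_def)
    have "(g b - g a)\<^sup>2 = (\<Sum>k\<in>{a..<b}. g (k + 1) - g k)\<^sup>2" using telescope_int[OF ab(3), of g] by simp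
    also have "\<dots> \<le> (\<Sum>k\<in>{a..<b}. (g (k + 1) - g k)\<^sup>2) * real (card {a..<b})"
      by (rule sum_squared_le_sum_of_squares)
    also have "\<dots> \<le> T * real (card ?E)"
      unfolding T_def by (intro mult_mono sum_mono2 of_nat_mono card_mono sub sum_nonneg) auto
    also have "\<dots> = 2 * real N * T" by simp
    finally show ?thesis .
  qed
  have le': "(g a - g b)\<^sup>2 \<le> 2 * real N * T" if "a \<in> grid N" "b \<in> grid N" for a b
  proof (cases "a \<le> b")
    case True
    then show ?thesis using le[OF that] by (simp add: power2_commute)
  next
    case False
    then show ?thesis using le[OF that(2,1)] by simp
  qed
  have T: "T \<le> 2 * (\<Sum>k\<in>grid N. (v k)\<^sup>2)"
  proof -
    have "T \<le> (\<Sum>k\<in>?E. (v k)\<^sup>2 + (v (k + 1))\<^sup>2)"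
      unfolding T_def
    proof (rule sum_mono)
      fix k assume k: "k \<in> ?E"
      have kk: "k \<in> grid N" "k + 1 \<in> grid N" using k by (auto simp: grid_def)
      have up: "g (k + 1) - g k \<le> v k" by (rule v[OF kk]) simp
      have down: "g k - g (k + 1) \<le> v (k + 1)" by (rule v[OF kk(2,1)]) simp
      show "(g (k + 1) - g k)\<^sup>2 \<le> (v k)\<^sup>2 + (v (k + 1))\<^sup>2"
      proof (cases "g k \<le> g (k + 1)")
        case True
        then have "(g (k + 1) - g k)\<^sup>2 \<le> (v k)\<^sup>2" using up by (intro power_mono) auto
        then show ?thesis using zero_le_power2[of "v (k + 1)"] by linarith
      next
        case False
        then have "(g k - g (k + 1))\<^sup>2 \<le> (v (k + 1))\<^sup>2" using down by (intro power_mono) auto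
        then show ?thesis using zero_le_power2[of "v k"] power2_commute[of "g k" "g (k + 1)"] by linarith
      qed
    qed
    also have "\<dots> = (\<Sum>k\<in>?E. (v k)\<^sup>2) + (\<Sum>k\<in>?E. (v (k + 1))\<^sup>2)" by (rule sum.distrib)
    also have "(\<Sum>k\<in>?E. (v (k + 1))\<^sup>2) = (\<Sum>k\<in>(\<lambda>k. k + 1) ` ?E. (v k)\<^sup>2)"
      by (subst sum.reindex) (auto simp: inj_on_def)
    also have "\<dots> \<le> (\<Sum>k\<in>grid N. (v k)\<^sup>2)" by (rule sum_mono2) (auto simp: grid_def)
    also have "(\<Sum>k\<in>?E. (v k)\<^sup>2) \<le> (\<Sum>k\<in>grid N. (v k)\<^sup>2)" by (rule sum_mono2) (auto simp: grid_def)
    finally show ?thesis by simp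
  qed
  have "(\<Sum>a\<in>grid N. \<Sum>b\<in>grid N. (g a - g b)\<^sup>2) \<le> (\<Sum>a\<in>grid N. \<Sum>b\<in>grid N. 2 * real N * T)"
    by (intro sum_mono le')
  also have "\<dots> = real (card (grid N)) ^ 2 * (2 * real N * T)" by (simp add: power2_eq_square)
  also have "\<dots> \<le> real (card (grid N)) ^ 2 * (2 * real N * (2 * (\<Sum>k\<in>grid N. (v k)\<^sup>2)))"
    by (intro mult_left_mono T) auto
  finally show ?thesis by (simp add: mult_ac)
qed

text \<open>Efron--Stein reduces to lines and \<open>path_poincare\<close> treats each line;
  measured in units of \<open>N\<close>, the constant is \<open>12\<close> in every dimension. The
  one-sided hypothesis suits distance functions: a nearest point to \<open>x\<close> only limits how
  fast the distance grows away from \<open>x\<close>.\<close>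

lemma grid_poincare:
  fixes F :: "('i \<Rightarrow> int) \<Rightarrow> real"
  assumes I: "finite I" and N: "1 \<le> N"
    and u: "\<And>x i k. x \<in> I \<rightarrow>\<^sub>E grid N \<Longrightarrow> i \<in> I \<Longrightarrow> k \<in> grid N \<Longrightarrow> \<bar>x i - k\<bar> = 1 \<Longrightarrow> F (x(i := k)) - F x \<le> u i x"
  shows "(\<Sum>x\<in>I \<rightarrow>\<^sub>E grid N. \<Sum>y\<in>I \<rightarrow>\<^sub>E grid N. (F x - F y)\<^sup>2) \<le>
    real (card (I \<rightarrow>\<^sub>E grid N)) * (12 * real N ^ 2 * (\<Sum>x\<in>I \<rightarrow>\<^sub>E grid N. \<Sum>i\<in>I. (u i x)\<^sup>2))"
proof -
  let ?X = "I \<rightarrow>\<^sub>E grid N" and ?M = "real (card (grid N))"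
  have M: "0 < ?M" "?M \<le> 3 * real N" using N by (auto simp: card_grid)
  have dir: "(\<Sum>x\<in>?X. \<Sum>b\<in>grid N. (F x - F (x(i := b)))\<^sup>2) \<le> ?M ^ 2 * (4 * real N * (\<Sum>x\<in>?X. (u i x)\<^sup>2))"
    if i: "i \<in> I" for i
  proof -
    define J where "J = I - {i}"
    have J: "I = insert i J" "i \<notin> J" using i by (auto simp: J_def)
    have "(\<Sum>x\<in>?X. \<Sum>b\<in>grid N. (F x - F (x(i := b)))\<^sup>2) =
        (\<Sum>a\<in>grid N. \<Sum>w\<in>J \<rightarrow>\<^sub>E grid N. \<Sum>b\<in>grid N. (F (w(i := a)) - F (w(i := b)))\<^sup>2)"
      by (simp only: J(1) sum_PiE_insert[OF J(2)] fun_upd_upd)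
    also have "\<dots> = (\<Sum>w\<in>J \<rightarrow>\<^sub>E grid N. \<Sum>a\<in>grid N. \<Sum>b\<in>grid N. (F (w(i := a)) - F (w(i := b)))\<^sup>2)"
      by (rule sum.swap)
    also have "\<dots> \<le> (\<Sum>w\<in>J \<rightarrow>\<^sub>E grid N. ?M ^ 2 * (4 * real N * (\<Sum>k\<in>grid N. (u i (w(i := k)))\<^sup>2)))"
    proof (rule sum_mono, rule path_poincare)
      fix w k k' assume w: "w \<in> J \<rightarrow>\<^sub>E grid N" and k: "k \<in> grid N" "k' \<in> grid N" "\<bar>k - k'\<bar> = 1"
      have "w(i := k) \<in> ?X" unfolding J(1) by (rule PiE_fun_upd[OF k(1) w])
      from u[OF this i k(2)] k(3) show "F (w(i := k')) - F (w(i := k)) \<le> u i (w(i := k))" by simp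
    qed
    also have "\<dots> = ?M ^ 2 * (4 * real N * (\<Sum>w\<in>J \<rightarrow>\<^sub>E grid N. \<Sum>k\<in>grid N. (u i (w(i := k)))\<^sup>2))"
      by (simp only: sum_distrib_left)
    also have "(\<Sum>w\<in>J \<rightarrow>\<^sub>E grid N. \<Sum>k\<in>grid N. (u i (w(i := k)))\<^sup>2) = (\<Sum>x\<in>?X. (u i x)\<^sup>2)"
      by (simp only: J(1) sum_PiE_insert[OF J(2)] sum.swap[of _ "grid N" "J \<rightarrow>\<^sub>E grid N"])
    finally show ?thesis .
  qed
  have "?M * (\<Sum>x\<in>?X. \<Sum>y\<in>?X. (F x - F y)\<^sup>2) \<le>
      ?M ^ card I * (\<Sum>i\<in>I. \<Sum>x\<in>?X. \<Sum>b\<in>grid N. (F x - F (x(i := b)))\<^sup>2)"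
    by (rule efron_stein[OF I])
  also have "\<dots> \<le> ?M ^ card I * (\<Sum>i\<in>I. ?M ^ 2 * (4 * real N * (\<Sum>x\<in>?X. (u i x)\<^sup>2)))"
    by (intro mult_left_mono sum_mono dir) auto
  also have "\<dots> = ?M * (real (card ?X) * (?M * (4 * real N) * (\<Sum>i\<in>I. \<Sum>x\<in>?X. (u i x)\<^sup>2)))"
    using I by (simp add: card_funcsetE sum_distrib_left[symmetric] power2_eq_square mult_ac)
  finally have "(\<Sum>x\<in>?X. \<Sum>y\<in>?X. (F x - F y)\<^sup>2) \<le>
      real (card ?X) * (?M * (4 * real N) * (\<Sum>i\<in>I. \<Sum>x\<in>?X. (u i x)\<^sup>2))"
    using M(1) by (simp only: mult_le_cancel_left_pos)
  also have "\<dots> \<le> real (card ?X) * (3 * real N * (4 * real N) * (\<Sum>i\<in>I. \<Sum>x\<in>?X. (u i x)\<^sup>2))"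
    using M(2) by (intro mult_left_mono mult_right_mono sum_nonneg) auto
  also have "(\<Sum>i\<in>I. \<Sum>x\<in>?X. (u i x)\<^sup>2) = (\<Sum>x\<in>?X. \<Sum>i\<in>I. (u i x)\<^sup>2)" by (rule sum.swap)
  finally show ?thesis by (simp add: power2_eq_square mult_ac)
qed

text \<open>Concavity: the square root stays below its tangent at \<open>1 + D\<close>.\<close>

lemma sqrt_tangent:
  assumes "0 \<le> (D::real)" "0 \<le> D'"
  shows "sqrt (1 + D') - sqrt (1 + D) \<le> (D' - D) / (2 * sqrt (1 + D))"
proof -
  define a where "a = sqrt (1 + D')"
  define b where "b = sqrt (1 + D)"
  have a: "a\<^sup>2 = 1 + D'" and b: "b\<^sup>2 = 1 + D" "0 < b"
    using assms by (simp_all add: a_def b_def)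
  have "D' - D - 2 * b * (a - b) = (a - b)\<^sup>2" using a b(1) by (simp add: power2_eq_square algebra_simps)
  then have "(a - b) * (2 * b) \<le> D' - D" using zero_le_power2[of "a - b"] by (simp add: algebra_simps)
  then show ?thesis unfolding a_def[symmetric] b_def[symmetric] using b(2) by (simp only: pos_le_divide_eq mult_pos_pos zero_less_numeral)
qed

definition sqdist :: "'i set \<Rightarrow> ('i \<Rightarrow> int) \<Rightarrow> ('i \<Rightarrow> int) \<Rightarrow> real" where
  "sqdist I x y = (\<Sum>i\<in>I. (real_of_int (x i - y i))\<^sup>2)"

lemma sqdist_nonneg: "0 \<le> sqdist I x y"
  by (simp add: sqdist_def sum_nonneg)

lemma sqdist_upd:
  assumes "finite I" "i \<in> I" "\<bar>x i - k\<bar> = 1"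
  shows "sqdist I (x(i := k)) y \<le> sqdist I x y + (2 * \<bar>real_of_int (x i - y i)\<bar> + 1)"
proof -
  have "sqdist I (x(i := k)) y = (real_of_int (k - y i))\<^sup>2 + (\<Sum>j\<in>I-{i}. (real_of_int (x j - y j))\<^sup>2)"
    unfolding sqdist_def by (subst sum.remove[OF assms(1,2)]) simp
  moreover have "sqdist I x y = (real_of_int (x i - y i))\<^sup>2 + (\<Sum>j\<in>I-{i}. (real_of_int (x j - y j))\<^sup>2)"
    unfolding sqdist_def by (rule sum.remove[OF assms(1,2)])
  moreover have "(real_of_int (k - y i))\<^sup>2 \<le> (real_of_int (x i - y i))\<^sup>2 + (2 * \<bar>real_of_int (x i - y i)\<bar> + 1)"
  proof -
    define p where "p = real_of_int (x i - y i)"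
    define q where "q = real_of_int (k - x i)"
    have "\<bar>q\<bar> = 1" using assms(3) unfolding q_def by linarith
    then have q: "q\<^sup>2 = 1" "p * q \<le> \<bar>p\<bar>"
      by (metis power2_abs power_one) (metis \<open>\<bar>q\<bar> = 1\<close> abs_ge_self abs_mult mult.right_neutral)
    have "real_of_int (k - y i) = p + q" by (simp add: p_def q_def)
    then have "(real_of_int (k - y i))\<^sup>2 = p\<^sup>2 + 2 * (p * q) + q\<^sup>2" by (simp add: power2_sum)
    then show ?thesis unfolding p_def[symmetric] using q by linarith
  qed
  ultimately show ?thesis by linarith
qed

text \<open>The function \<open>sqrt (1 + dist(x, A)\<^sup>2)\<close> has bounded gradient, and unlike \<open>dist(x, A)\<close> its one-step
  increments are controlled coordinatewise by a nearest point of \<open>A\<close>. Hence its variance is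
  bounded independently of the dimension.\<close>

lemma grid_concentration:
  fixes A B :: "('i \<Rightarrow> int) set"
  assumes I: "finite I" and N: "1 \<le> N" "card I \<le> N ^ 2" and \<theta>: "0 < \<theta>"
    and A: "A \<subseteq> I \<rightarrow>\<^sub>E grid N" "\<theta> * real (card (I \<rightarrow>\<^sub>E grid N)) \<le> real (card A)"
    and B: "B \<subseteq> I \<rightarrow>\<^sub>E grid N" "\<theta> * real (card (I \<rightarrow>\<^sub>E grid N)) \<le> real (card B)"
  shows "\<exists>x\<in>A. \<exists>y\<in>B. sqdist I x y \<le> ((1 + 5 / \<theta>)\<^sup>2 - 1) * real N ^ 2"
proof (rule ccontr)
  assume "\<not> ?thesis"
  then have far: "((1 + 5 / \<theta>)\<^sup>2 - 1) * real N ^ 2 < sqdist I x y" if "x \<in> A" "y \<in> B" for x y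
    using that not_le by blast
  let ?X = "I \<rightarrow>\<^sub>E grid N"
  have fX: "finite ?X" using I by (intro finite_PiE) simp_all
  have cX: "0 < real (card ?X)" using I by (simp add: card_funcsetE card_grid)
  have fA: "finite A" "finite B" using A(1) B(1) fX finite_subset by blast+
  have "0 < real (card A)" using A(2) \<theta> cX by (meson less_le_trans mult_pos_pos)
  then have neA: "A \<noteq> {}" by auto
  have Npos: "0 < real N ^ 2" using N(1) by simp
  have "\<exists>a\<in>A. \<forall>b\<in>A. sqdist I x a \<le> sqdist I x b" for x
    using arg_min_if_finite(1)[OF fA(1) neA, of "sqdist I x"] arg_min_least[OF fA(1) neA, of _ "sqdist I x"] by blast
  then obtain nr where nr: "\<And>x. nr x \<in> A" "\<And>x b. b \<in> A \<Longrightarrow> sqdist I x (nr x) \<le> sqdist I x b" by metis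
  define D where "D x = sqdist I x (nr x) / real N ^ 2" for x
  have D0: "0 \<le> D x" for x unfolding D_def by (intro divide_nonneg_nonneg sqdist_nonneg) simp
  define G where "G x = sqrt (1 + D x)" for x
  have G: "(G x)\<^sup>2 = 1 + D x" "0 < G x" for x using D0[of x] by (simp_all add: G_def)
  define u where "u i x = (2 * \<bar>real_of_int (x i - nr x i)\<bar> + 1) / (real N ^ 2 * (2 * G x))" for i x
  have incr: "G (x(i := k)) - G x \<le> u i x" if "i \<in> I" "\<bar>x i - k\<bar> = 1" for x i k
  proof -
    let ?x = "x(i := k)"
    have "sqdist I ?x (nr ?x) \<le> sqdist I ?x (nr x)" by (rule nr(2)[OF nr(1)])
    also have "\<dots> \<le> sqdist I x (nr x) + (2 * \<bar>real_of_int (x i - nr x i)\<bar> + 1)" by (rule sqdist_upd[where x = x and i = i and k = k, OF I that])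
    finally have "D ?x \<le> (sqdist I x (nr x) + (2 * \<bar>real_of_int (x i - nr x i)\<bar> + 1)) / real N ^ 2"
      unfolding D_def by (rule divide_right_mono) simp
    then have "D ?x - D x \<le> (2 * \<bar>real_of_int (x i - nr x i)\<bar> + 1) / real N ^ 2"
      by (simp add: D_def add_divide_distrib)
    then have "(D ?x - D x) / (2 * G x) \<le> (2 * \<bar>real_of_int (x i - nr x i)\<bar> + 1) / real N ^ 2 / (2 * G x)"
      using G(2)[of x] by (intro divide_right_mono) auto
    moreover have "G ?x - G x \<le> (D ?x - D x) / (2 * G x)"
      unfolding G_def by (rule sqrt_tangent[OF D0 D0])
    ultimately show ?thesis by (simp add: u_def)
  qed
  \<comment> \<open>The \<open>1\<close> under the root pays for the rounding terms, whose total is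
    of order \<open>card I \<le> N\<^sup>2\<close>: the numerator is at most
    \<open>8 * (1 + D x) * N\<^sup>2\<close>, and \<open>1 + D x\<close> cancels.\<close>
  have grad: "(\<Sum>i\<in>I. (u i x)\<^sup>2) \<le> 2 / real N ^ 2" for x
  proof -
    define Z where "Z = (real N ^ 2 * (2 * G x))\<^sup>2"
    have Z: "Z = 4 * (1 + D x) * (real N ^ 2 * real N ^ 2)"
      using G(1)[of x] by (simp add: Z_def power_mult_distrib power2_eq_square mult_ac)
    have Zpos: "0 < Z" using Z Npos D0[of x] by simp
    have "(\<Sum>i\<in>I. (u i x)\<^sup>2) = (\<Sum>i\<in>I. (2 * \<bar>real_of_int (x i - nr x i)\<bar> + 1)\<^sup>2) / Z"
      by (simp add: u_def power_divide Z_def sum_divide_distrib)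
    also have "\<dots> \<le> (\<Sum>i\<in>I. 8 * (real_of_int (x i - nr x i))\<^sup>2 + 2) / Z"
    proof (intro divide_right_mono sum_mono)
      fix i
      define p where "p = \<bar>real_of_int (x i - nr x i)\<bar>"
      have "8 * p\<^sup>2 + 2 - (2 * p + 1)\<^sup>2 = (2 * p - 1)\<^sup>2" by (simp add: power2_eq_square algebra_simps)
      then have "(2 * p + 1)\<^sup>2 \<le> 8 * p\<^sup>2 + 2" using zero_le_power2[of "2 * p - 1"] by linarith
      then show "(2 * \<bar>real_of_int (x i - nr x i)\<bar> + 1)\<^sup>2 \<le> 8 * (real_of_int (x i - nr x i))\<^sup>2 + 2"
        by (simp only: p_def power2_abs)
    qed (use Zpos in simp)
    also have "\<dots> = (8 * (D x * real N ^ 2) + 2 * real (card I)) / Z"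
      using Npos by (simp add: sum.distrib D_def sqdist_def sum_distrib_left)
    also have "\<dots> \<le> (8 * (D x * real N ^ 2) + 2 * real N ^ 2) / Z"
    proof (rule divide_right_mono)
      have "real (card I) \<le> real N ^ 2" using N(2) by (metis of_nat_mono of_nat_power)
      then show "8 * (D x * real N ^ 2) + 2 * real (card I) \<le> 8 * (D x * real N ^ 2) + 2 * real N ^ 2" by simp
    qed (use Zpos in simp)
    also have "\<dots> \<le> (8 * (1 + D x) * real N ^ 2) / Z"
      using Npos Zpos by (intro divide_right_mono) (auto simp: algebra_simps)
    also have "\<dots> = 2 / real N ^ 2"
    proof -
      have "8 * e * q / (4 * e * (q * q)) = 2 / q" if "0 < e" "0 < q" for e q :: real
        using that by (simp add: field_simps)
      from this[of "1 + D x", OF _ Npos] show ?thesis using D0[of x] by (simp only: Z)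
    qed
    finally show ?thesis .
  qed
  have "(\<Sum>x\<in>?X. \<Sum>y\<in>?X. (G x - G y)\<^sup>2) \<le>
      real (card ?X) * (12 * real N ^ 2 * (\<Sum>x\<in>?X. \<Sum>i\<in>I. (u i x)\<^sup>2))"
    by (rule grid_poincare[OF I N(1)]) (rule incr)
  also have "\<dots> \<le> real (card ?X) * (12 * real N ^ 2 * (\<Sum>x\<in>?X. 2 / real N ^ 2))"
    by (intro mult_left_mono sum_mono grad) auto
  also have "\<dots> = 24 * real (card ?X) ^ 2"
  proof -
    have "c * (12 * q * (c * (2 / q))) = 24 * c ^ 2" if "0 < q" for c q :: real
      using that by (simp add: power2_eq_square)
    from this[OF Npos] show ?thesis by simp
  qed
  finally have upper: "(\<Sum>x\<in>?X. \<Sum>y\<in>?X. (G x - G y)\<^sup>2) \<le> 24 * real (card ?X) ^ 2" .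
  \<comment> \<open>\<open>G\<close> is \<open>1\<close> on \<open>A\<close> and at least
    \<open>1 + 5 / \<theta>\<close> on \<open>B\<close>; this is where the radius in the statement
    comes from.\<close>
  have sep: "(5 / \<theta>)\<^sup>2 \<le> (G x - G y)\<^sup>2" if "x \<in> A" "y \<in> B" for x y
  proof -
    have "sqdist I x (nr x) \<le> sqdist I x x" by (rule nr(2)[OF that(1)])
    then have "D x \<le> 0" using Npos by (simp add: D_def sqdist_def divide_le_0_iff)
    then have "G x = 1" using D0[of x] by (simp add: G_def)
    have sym: "sqdist I y (nr y) = sqdist I (nr y) y"
      unfolding sqdist_def by (intro sum.cong refl) (simp add: power2_commute)
    have "((1 + 5 / \<theta>)\<^sup>2 - 1) * real N ^ 2 < sqdist I y (nr y)" unfolding sym by (rule far[OF nr(1) that(2)])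
    then have "(1 + 5 / \<theta>)\<^sup>2 - 1 < D y" unfolding D_def by (simp only: pos_less_divide_eq[OF Npos])
    then have "(1 + 5 / \<theta>)\<^sup>2 \<le> (G y)\<^sup>2" using G(1)[of y] by linarith
    then have "1 + 5 / \<theta> \<le> G y" by (rule power2_le_imp_le) (rule less_imp_le[OF G(2)])
    then have "5 / \<theta> \<le> G y - G x" using \<open>G x = 1\<close> by linarith
    then have "(5 / \<theta>)\<^sup>2 \<le> (G y - G x)\<^sup>2" using \<theta> by (intro power_mono) auto
    then show ?thesis by (simp only: power2_commute)
  qed
  \<comment> \<open>The constant \<open>5\<close> is chosen so that the pairs in
    \<open>A \<times> B\<close> alone contribute \<open>25\<close>, against the upper bound
    \<open>24 = 12 * 2\<close>.\<close>
  have "25 * real (card ?X) ^ 2 = (5 / \<theta>)\<^sup>2 * ((\<theta> * real (card ?X)) * (\<theta> * real (card ?X)))"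
    using \<theta> by (simp add: power2_eq_square)
  also have "\<dots> \<le> (5 / \<theta>)\<^sup>2 * (real (card A) * real (card B))"
    using A(2) B(2) \<theta> by (intro mult_left_mono mult_mono) auto
  also have "\<dots> = (\<Sum>x\<in>A. \<Sum>y\<in>B. (5 / \<theta>)\<^sup>2)" by simp
  also have "\<dots> \<le> (\<Sum>x\<in>A. \<Sum>y\<in>B. (G x - G y)\<^sup>2)" by (intro sum_mono sep)
  also have "\<dots> \<le> (\<Sum>x\<in>A. \<Sum>y\<in>?X. (G x - G y)\<^sup>2)" using fX B(1) by (intro sum_mono sum_mono2) auto
  also have "\<dots> \<le> (\<Sum>x\<in>?X. \<Sum>y\<in>?X. (G x - G y)\<^sup>2)" using fX A(1) by (intro sum_mono2 sum_nonneg) auto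
  also have "\<dots> \<le> 24 * real (card ?X) ^ 2" by (rule upper)
  finally have "real (card ?X) ^ 2 \<le> 0" by simp
  then show False using cX by simp
qed

section \<open>Nearly antipodal pairs in dense sets\<close>

definition sqnorm_sum :: "'i set \<Rightarrow> ('i \<Rightarrow> int) \<Rightarrow> ('i \<Rightarrow> int) \<Rightarrow> real" where
  "sqnorm_sum I x y = (\<Sum>i\<in>I. (real_of_int (x i + y i))\<^sup>2)"

lemma grid_antipodal:
  fixes A :: "('i \<Rightarrow> int) set"
  assumes I: "finite I" and N: "1 \<le> N" "card I \<le> N ^ 2" and \<theta>: "0 < \<theta>"
    and A: "A \<subseteq> I \<rightarrow>\<^sub>E grid N" "\<theta> * real (card (I \<rightarrow>\<^sub>E grid N)) \<le> real (card A)"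
  shows "\<exists>x\<in>A. \<exists>y\<in>A. sqnorm_sum I x y \<le> ((1 + 5 / \<theta>)\<^sup>2 - 1) * real N ^ 2"
proof -
  \<comment> \<open>\<open>restrict\<close> keeps the value \<open>undefined\<close> outside
    \<open>I\<close>, so that \<open>neg x\<close> is again a point of the grid.\<close>
  define neg where "neg x = restrict (\<lambda>i. - x i) I" for x :: "'i \<Rightarrow> int"
  have "inj_on neg A"
  proof (rule inj_onI)
    fix x y assume xy: "x \<in> A" "y \<in> A" "neg x = neg y"
    show "x = y"
    proof (rule PiE_ext)
      show "x \<in> I \<rightarrow>\<^sub>E grid N" "y \<in> I \<rightarrow>\<^sub>E grid N" using A(1) xy by auto
      fix i assume "i \<in> I"
      then show "x i = y i" using fun_cong[OF xy(3), of i] by (simp add: neg_def)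
    qed
  qed
  then have card: "card (neg ` A) = card A" by (rule card_image)
  have sub: "neg ` A \<subseteq> I \<rightarrow>\<^sub>E grid N"
  proof (rule image_subsetI)
    fix x assume "x \<in> A"
    then have "x i \<in> grid N" if "i \<in> I" for i using A(1) that by auto
    then have "- x i \<in> grid N" if "i \<in> I" for i using that by (force simp: grid_def)
    then show "neg x \<in> I \<rightarrow>\<^sub>E grid N" by (auto simp: neg_def)
  qed
  have big: "\<theta> * real (card (I \<rightarrow>\<^sub>E grid N)) \<le> real (card (neg ` A))" unfolding card by (rule A(2))
  obtain x z where xz: "x \<in> A" "z \<in> neg ` A" "sqdist I x z \<le> ((1 + 5 / \<theta>)\<^sup>2 - 1) * real N ^ 2"
    using grid_concentration[OF I N \<theta> A sub big] by blast
  then obtain y where y: "y \<in> A" "z = neg y" by blast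
  have "sqdist I x z = sqnorm_sum I x y"
    unfolding sqdist_def sqnorm_sum_def y(2) by (intro sum.cong refl) (simp add: neg_def)
  then show ?thesis using xz y(1) by auto
qed

section \<open>Anti-concentration of inner products\<close>

text \<open>With \<open>y = \<bar>x\<bar> / 2\<close> one has
  \<open>cos x = 1 - 2 * (sin y)\<^sup>2\<close>, and the mean value theorem gives
  \<open>sin y \<ge> y * cos (pi / 4)\<close> because \<open>1/2 < pi / 4\<close>.\<close>

lemma cos_le:
  assumes "\<bar>x::real\<bar> \<le> 1"
  shows "cos x \<le> 1 - x\<^sup>2 / 4"
proof (cases "x = 0")
  case False
  define y where "y = \<bar>x\<bar> / 2"
  have y: "0 < y" "y \<le> 1/2" using False assms by (simp_all add: y_def)
  obtain z where z: "0 < z" "z < y" "sin y - sin 0 = (y - 0) * cos z"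
    using MVT2[OF y(1), of sin cos] DERIV_sin by blast
  have "cos (pi / 4) \<le> cos z"
    by (rule cos_monotone_0_pi_le) (use z y pi_ge_two in auto)
  then have "y * (sqrt 2 / 2) \<le> sin y" using z(3) y(1) by (simp add: cos_45)
  then have "(y * (sqrt 2 / 2))\<^sup>2 \<le> (sin y)\<^sup>2" using y(1) by (intro power_mono) auto
  then have "x\<^sup>2 / 8 \<le> (sin y)\<^sup>2" by (simp add: y_def power_mult_distrib power_divide)
  moreover have "cos x = cos (2 * y)" by (simp add: y_def)
  ultimately show ?thesis by (simp add: cos_double_sin)
qed simp

text \<open>A characteristic function factorises over the coordinates. With real cosines the
  induction needs the free phase \<open>c\<close>; the sine terms cancel by the symmetry of the
  grid.\<close>

lemma cos_sum_grid: 
  fixes \<theta> :: "'i \<Rightarrow> real"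
  assumes "finite I"
  shows "(\<Sum>x\<in>I \<rightarrow>\<^sub>E grid N. \<Sum>y\<in>I \<rightarrow>\<^sub>E grid N. cos (c + (\<Sum>i\<in>I. \<theta> i * real_of_int (x i * y i)))) =
    cos c * (\<Prod>i\<in>I. \<Sum>a\<in>grid N. \<Sum>b\<in>grid N. cos (\<theta> i * real_of_int (a * b)))"
  using assms
proof (induction I arbitrary: c rule: finite_induct)
  case empty
  then show ?case by simp
next
  case (insert i I)
  let ?X = "I \<rightarrow>\<^sub>E grid N" and ?P = "\<Prod>i\<in>I. \<Sum>a\<in>grid N. \<Sum>b\<in>grid N. cos (\<theta> i * real_of_int (a * b))"
  have sin0: "(\<Sum>a\<in>grid N. \<Sum>b\<in>grid N. sin (\<theta> i * real_of_int (a * b))) = 0"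
  proof -
    have "(\<Sum>a\<in>grid N. \<Sum>b\<in>grid N. sin (\<theta> i * real_of_int (a * b))) =
        (\<Sum>a\<in>grid N. \<Sum>b\<in>grid N. sin (\<theta> i * real_of_int (- a * b)))"
      by (rule sum.reindex_bij_witness[where i = uminus and j = uminus]) (auto simp: grid_def)
    also have "\<dots> = - (\<Sum>a\<in>grid N. \<Sum>b\<in>grid N. sin (\<theta> i * real_of_int (a * b)))"
      by (simp add: sum_negf)
    finally show ?thesis by simp
  qed
  have step: "(\<Sum>j\<in>insert i I. \<theta> j * real_of_int ((u(i := a)) j * (w(i := b)) j)) =
      \<theta> i * real_of_int (a * b) + (\<Sum>j\<in>I. \<theta> j * real_of_int (u j * w j))" for u w a b
  proof -
    have "(\<Sum>j\<in>I. \<theta> j * real_of_int ((u(i := a)) j * (w(i := b)) j)) = (\<Sum>j\<in>I. \<theta> j * real_of_int (u j * w j))"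
      by (rule sum.cong[OF refl]) (use insert(2) in auto)
    then show ?thesis by (simp only: sum.insert[OF insert(1,2)] fun_upd_same)
  qed
  have "(\<Sum>x\<in>insert i I \<rightarrow>\<^sub>E grid N. \<Sum>y\<in>insert i I \<rightarrow>\<^sub>E grid N.
      cos (c + (\<Sum>j\<in>insert i I. \<theta> j * real_of_int (x j * y j)))) =
      (\<Sum>a\<in>grid N. \<Sum>u\<in>?X. \<Sum>b\<in>grid N. \<Sum>w\<in>?X.
        cos ((c + \<theta> i * real_of_int (a * b)) + (\<Sum>j\<in>I. \<theta> j * real_of_int (u j * w j))))"
    by (simp only: sum_PiE_insert[OF insert(2)] step add.assoc)
  also have "\<dots> = (\<Sum>a\<in>grid N. \<Sum>b\<in>grid N. \<Sum>u\<in>?X. \<Sum>w\<in>?X.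
        cos ((c + \<theta> i * real_of_int (a * b)) + (\<Sum>j\<in>I. \<theta> j * real_of_int (u j * w j))))"
    by (rule sum.cong[OF refl]) (rule sum.swap)
  also have "\<dots> = (\<Sum>a\<in>grid N. \<Sum>b\<in>grid N. cos (c + \<theta> i * real_of_int (a * b)) * ?P)"
    by (simp only: insert.IH)
  also have "\<dots> = (\<Sum>a\<in>grid N. \<Sum>b\<in>grid N. cos (c + \<theta> i * real_of_int (a * b))) * ?P"
    by (simp only: sum_distrib_right)
  also have "(\<Sum>a\<in>grid N. \<Sum>b\<in>grid N. cos (c + \<theta> i * real_of_int (a * b))) =
      cos c * (\<Sum>a\<in>grid N. \<Sum>b\<in>grid N. cos (\<theta> i * real_of_int (a * b))) -
      sin c * (\<Sum>a\<in>grid N. \<Sum>b\<in>grid N. sin (\<theta> i * real_of_int (a * b)))"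
    by (simp only: cos_add sum_subtractf sum_distrib_left)
  finally show ?case by (simp only: sin0 prod.insert[OF insert(1,2)] mult_zero_right diff_0_right mult.assoc)
qed

lemma sum_squares_grid: "(\<Sum>a\<in>grid N. (real_of_int a)\<^sup>2) \<ge> real N ^ 2 * real (card (grid N)) / 3"
proof -
  have "(\<Sum>a\<in>grid N. (real_of_int a)\<^sup>2) = real N * (real N + 1) * (2 * real N + 1) / 3"
  proof (induction N)
    case (Suc N)
    have "grid (Suc N) = insert (- int (Suc N)) (insert (int (Suc N)) (grid N))"
      by (auto simp: grid_def)
    then have "(\<Sum>a\<in>grid (Suc N). (real_of_int a)\<^sup>2) = 2 * (real N + 1)\<^sup>2 + (\<Sum>a\<in>grid N. (real_of_int a)\<^sup>2)"
      by (simp add: grid_def power2_eq_square algebra_simps)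
    then show ?case using Suc by (simp add: power2_eq_square field_simps)
  qed (simp add: grid_def)
  moreover have "real N ^ 2 * (2 * real N + 1) \<le> real N * (real N + 1) * (2 * real N + 1)"
    by (intro mult_right_mono) (auto simp: power2_eq_square intro: mult_left_mono)
  ultimately show ?thesis by (simp add: card_grid algebra_simps)
qed

lemma abs_grid_le: "a \<in> grid N \<Longrightarrow> \<bar>real_of_int a\<bar> \<le> real N"
  by (auto simp: grid_def abs_le_iff)

text \<open>The denominator is \<open>36 = 4 * 3 * 3\<close>: the \<open>4\<close> of
  \<open>cos_le\<close> and a mean square of at least \<open>N\<^sup>2 / 3\<close> for each of the
  two coordinates. Nonnegativity is what allows these bounds to be multiplied over
  coordinates.\<close>

lemma cos_grid_bounds:
  assumes "\<bar>\<theta>\<bar> * real N ^ 2 \<le> 1"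
  defines "K \<equiv> (\<Sum>a\<in>grid N. \<Sum>b\<in>grid N. cos (\<theta> * real_of_int (a * b)))"
  shows "0 \<le> K" "K \<le> real (card (grid N)) ^ 2 * (1 - (\<bar>\<theta>\<bar> * real N ^ 2)\<^sup>2 / 36)"
proof -
  have small: "\<bar>\<theta> * real_of_int (a * b)\<bar> \<le> 1" if "a \<in> grid N" "b \<in> grid N" for a b
  proof -
    have "\<bar>\<theta> * real_of_int (a * b)\<bar> = \<bar>\<theta>\<bar> * (\<bar>real_of_int a\<bar> * \<bar>real_of_int b\<bar>)" by (simp add: abs_mult)
    also have "\<dots> \<le> \<bar>\<theta>\<bar> * (real N * real N)" by (intro mult_left_mono mult_mono abs_grid_le that) auto
    finally show ?thesis using assms(1) by (simp add: power2_eq_square)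
  qed
  show "0 \<le> K" unfolding K_def
  proof (intro sum_nonneg cos_ge_zero)
    fix a b assume ab: "a \<in> grid N" "b \<in> grid N"
    show "- (pi / 2) \<le> \<theta> * real_of_int (a * b)" "\<theta> * real_of_int (a * b) \<le> pi / 2"
      using small[OF ab] pi_ge_two by linarith+
  qed
  let ?M = "real (card (grid N))" and ?q = "\<Sum>a\<in>grid N. (real_of_int a)\<^sup>2"
  have "K \<le> (\<Sum>a\<in>grid N. \<Sum>b\<in>grid N. 1 - (\<theta> * real_of_int (a * b))\<^sup>2 / 4)"
    unfolding K_def by (intro sum_mono cos_le small)
  also have "\<dots> = ?M ^ 2 - \<theta>\<^sup>2 / 4 * (?q * ?q)"
  proof -
    have "(\<Sum>a\<in>grid N. \<Sum>b\<in>grid N. (\<theta> * real_of_int (a * b))\<^sup>2 / 4) =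
        (\<Sum>a\<in>grid N. \<Sum>b\<in>grid N. \<theta>\<^sup>2 / 4 * ((real_of_int a)\<^sup>2 * (real_of_int b)\<^sup>2))"
      by (simp add: power_mult_distrib)
    also have "\<dots> = \<theta>\<^sup>2 / 4 * (?q * ?q)"
      by (simp only: sum_distrib_left[symmetric] sum_distrib_right[symmetric])
    finally show ?thesis by (simp add: sum_subtractf power2_eq_square)
  qed
  also have "\<dots> \<le> ?M ^ 2 - \<theta>\<^sup>2 / 4 * ((real N ^ 2 * ?M / 3) * (real N ^ 2 * ?M / 3))"
    by (intro diff_left_mono mult_left_mono mult_mono sum_squares_grid) (auto intro: sum_nonneg)
  also have "\<dots> = ?M ^ 2 * (1 - (\<bar>\<theta>\<bar> * real N ^ 2)\<^sup>2 / 36)"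
    by (simp add: power_mult_distrib power2_eq_square algebra_simps)
  finally show "K \<le> ?M ^ 2 * (1 - (\<bar>\<theta>\<bar> * real N ^ 2)\<^sup>2 / 36)" .
qed

section \<open>Inner products over a block of coordinates\<close>

definition ip :: "'i set \<Rightarrow> ('i \<Rightarrow> int) \<Rightarrow> ('i \<Rightarrow> int) \<Rightarrow> real" where
  "ip J x y = (\<Sum>i\<in>J. real_of_int (x i * y i))"

text \<open>Coordinates outside \<open>J\<close> get frequency \<open>0\<close> and contribute the
  trivial factor, so the decay is exponential in the block length and independent of
  \<open>N\<close> and of the other coordinates.\<close>

lemma cos_ip_le:
  fixes I :: "'i set"
  assumes I: "finite I" "J \<subseteq> I" and \<tau>: "\<bar>\<tau>\<bar> \<le> 1" and N: "1 \<le> N"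
  shows "(\<Sum>x\<in>I \<rightarrow>\<^sub>E grid N. \<Sum>y\<in>I \<rightarrow>\<^sub>E grid N. cos (\<tau> * (ip J x y / real N ^ 2))) \<le>
    real (card (I \<rightarrow>\<^sub>E grid N)) ^ 2 * (1 - \<tau>\<^sup>2 / 36) ^ card J"
proof -
  define \<theta> where "\<theta> = \<tau> / real N ^ 2"
  have th: "\<bar>\<theta>\<bar> * real N ^ 2 = \<bar>\<tau>\<bar>" using N by (simp add: \<theta>_def abs_divide)
  let ?M = "real (card (grid N))" and ?\<theta> = "\<lambda>i. if i \<in> J then \<theta> else 0"
  let ?K = "\<Sum>a\<in>grid N. \<Sum>b\<in>grid N. cos (\<theta> * real_of_int (a * b))"
  have K: "0 \<le> ?K" "?K \<le> ?M ^ 2 * (1 - \<tau>\<^sup>2 / 36)"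
    using cos_grid_bounds[of \<theta> N] \<tau> unfolding th by simp_all
  have eq: "\<tau> * (ip J x y / real N ^ 2) = 0 + (\<Sum>i\<in>I. ?\<theta> i * real_of_int (x i * y i))" for x y
  proof -
    have "(\<Sum>i\<in>I. ?\<theta> i * real_of_int (x i * y i)) = (\<Sum>i\<in>I. if i \<in> J then \<theta> * real_of_int (x i * y i) else 0)"
      by (rule sum.cong[OF refl]) simp
    also have "\<dots> = (\<Sum>i\<in>I \<inter> J. \<theta> * real_of_int (x i * y i))" by (rule sum.inter_restrict[OF I(1), symmetric])
    also have "I \<inter> J = J" using I(2) by blast
    finally show ?thesis by (simp only: ip_def sum_distrib_left[symmetric] \<theta>_def) simp
  qed
  have "(\<Sum>x\<in>I \<rightarrow>\<^sub>E grid N. \<Sum>y\<in>I \<rightarrow>\<^sub>E grid N. cos (\<tau> * (ip J x y / real N ^ 2))) =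
      cos 0 * (\<Prod>i\<in>I. \<Sum>a\<in>grid N. \<Sum>b\<in>grid N. cos (?\<theta> i * real_of_int (a * b)))"
    unfolding eq by (rule cos_sum_grid[OF I(1)])
  also have "\<dots> = (\<Prod>i\<in>I. if i \<in> J then ?K else ?M ^ 2)"
    by (simp add: power2_eq_square if_distrib[of "\<lambda>z. cos (z * _)"] cong: if_cong) (rule prod.cong[OF refl], simp)
  also have "\<dots> \<le> (\<Prod>i\<in>I. ?M ^ 2 * (if i \<in> J then 1 - \<tau>\<^sup>2 / 36 else 1))"
    by (rule prod_mono) (use K in auto)
  also have "\<dots> = (?M ^ 2) ^ card I * (\<Prod>i\<in>I. if i \<in> J then 1 - \<tau>\<^sup>2 / 36 else 1)"
    by (simp add: prod.distrib)
  also have "(\<Prod>i\<in>I. if i \<in> J then 1 - \<tau>\<^sup>2 / 36 else 1) = (\<Prod>i\<in>I \<inter> J. 1 - \<tau>\<^sup>2 / 36)"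
    by (rule prod.inter_restrict[OF I(1), symmetric])
  also have "I \<inter> J = J" using I(2) by blast
  also have "(?M ^ 2) ^ card I = real (card (I \<rightarrow>\<^sub>E grid N)) ^ 2"
    using I(1) by (simp add: card_funcsetE power_mult[symmetric] mult.commute)
  finally show ?thesis by simp
qed

text \<open>Second moment method for \<open>Z = \<Sum>k\<le>K. cos (k \<tau> s)\<close>, where \<open>s\<close> is the normalised inner product:
  if \<open>s\<close> is small then \<open>Z \<ge> K/2\<close>, whereas the distinct frequencies are nearly orthogonal, so that
  \<open>Z\<^sup>2\<close> has mean about \<open>K/2\<close>.\<close>

lemma ip_anticoncentration_aux:
  fixes I :: "'i set" and m :: real
  assumes I: "finite I" "J \<subseteq> I" and N: "1 \<le> N" and K: "1 \<le> K" and m: "1 \<le> m"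
  shows "real (card {(x, y) \<in> (I \<rightarrow>\<^sub>E grid N) \<times> (I \<rightarrow>\<^sub>E grid N). \<bar>ip J x y\<bar> \<le> m * real N ^ 2}) \<le>
    4 * (1 / real K + (1 - (1 / (2 * real K * m))\<^sup>2 / 36) ^ card J) * real (card (I \<rightarrow>\<^sub>E grid N)) ^ 2"
proof -
  let ?X = "I \<rightarrow>\<^sub>E grid N"
  \<comment> \<open>For \<open>k \<le> K\<close> and a normalised inner product of size at most
    \<open>m\<close>, the angle is then at most \<open>1/2\<close>, where the cosine exceeds
    \<open>1/2\<close>; and all frequencies up to \<open>2 * K * \<tau>\<close> stay in the range of
    \<open>cos_ip_le\<close>.\<close>
  define \<tau> where "\<tau> = 1 / (2 * real K * m)"
  define Q where "Q = (1 - \<tau>\<^sup>2 / 36) ^ card J"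
  define c where "c = real (card ?X) ^ 2"
  have Km: "1 \<le> real K * m" using mult_mono[of 1 "real K" 1 m] K m by simp
  have \<tau>: "0 < \<tau>" "2 * real K * \<tau> \<le> 1" "real K * m * \<tau> = 1/2" "\<tau> \<le> 1"
  proof -
    have pos: "0 < real K" "0 < m" using K m by auto
    show "0 < \<tau>" using pos unfolding \<tau>_def by simp
    show "real K * m * \<tau> = 1/2" using pos unfolding \<tau>_def by (simp add: field_simps)
    moreover have "real K * 1 * \<tau> \<le> real K * m * \<tau>"
      using m \<open>0 < \<tau>\<close> by (intro mult_right_mono mult_left_mono) auto
    ultimately show "2 * real K * \<tau> \<le> 1" by simp
    then have "1 * \<tau> \<le> 2 * real K * \<tau>" using K \<open>0 < \<tau>\<close> by (intro mult_right_mono) auto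
    then show "\<tau> \<le> 1" using \<open>2 * real K * \<tau> \<le> 1\<close> by linarith
  qed
  have tau36: "\<tau>\<^sup>2 / 36 \<le> 1" using \<tau> power_le_one[of \<tau> 2] by simp
  have Q0: "0 \<le> Q" using tau36 by (simp add: Q_def)
  have fX: "finite ?X" using I by (intro finite_PiE) simp_all
  define sc where "sc z = ip J (fst z) (snd z) / real N ^ 2" for z :: "('i \<Rightarrow> int) \<times> ('i \<Rightarrow> int)"
  let ?XX = "?X \<times> ?X"
  have cosE: "(\<Sum>z\<in>?XX. cos (real_of_int k * \<tau> * sc z)) \<le> c * Q" if k: "k \<noteq> 0" "\<bar>real_of_int k\<bar> \<le> 2 * real K" for k :: int
  proof -
    let ?t = "real_of_int k * \<tau>"
    have abs: "\<bar>?t\<bar> = \<bar>real_of_int k\<bar> * \<tau>" using \<tau>(1) by (simp add: abs_mult)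
    have "\<bar>real_of_int k\<bar> * \<tau> \<le> 2 * real K * \<tau>" using k(2) \<tau>(1) by (intro mult_right_mono) auto
    then have t1: "\<bar>?t\<bar> \<le> 1" using abs \<tau>(2) by linarith
    have "1 \<le> \<bar>real_of_int k\<bar>" using k(1) by linarith
    then have "1 * \<tau> \<le> \<bar>real_of_int k\<bar> * \<tau>" using \<tau>(1) by (intro mult_right_mono) auto
    then have "\<tau> \<le> \<bar>?t\<bar>" using abs by simp
    then have "\<tau>\<^sup>2 \<le> \<bar>?t\<bar>\<^sup>2" using \<tau>(1) by (intro power_mono) auto
    then have sq: "\<tau>\<^sup>2 \<le> ?t\<^sup>2" by (simp only: power2_abs)
    have "?t\<^sup>2 \<le> 1" using t1 by (simp only: abs_square_le_1)
    have "(\<Sum>z\<in>?XX. cos (?t * sc z)) = (\<Sum>x\<in>?X. \<Sum>y\<in>?X. cos (?t * (ip J x y / real N ^ 2)))"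
      by (simp add: sum.cartesian_product sc_def case_prod_unfold)
    also have "\<dots> \<le> c * (1 - ?t\<^sup>2 / 36) ^ card J" unfolding c_def by (rule cos_ip_le[OF I t1 N])
    also have "\<dots> \<le> c * Q"
      unfolding Q_def using sq \<open>?t\<^sup>2 \<le> 1\<close> by (intro mult_left_mono power_mono) (auto simp: c_def)
    finally show ?thesis .
  qed
  define Z where "Z z = (\<Sum>k=1..K. cos (real k * \<tau> * sc z))" for z
  have "(\<Sum>z\<in>?XX. (Z z)\<^sup>2) = (\<Sum>k=1..K. \<Sum>l=1..K. \<Sum>z\<in>?XX. cos (real k * \<tau> * sc z) * cos (real l * \<tau> * sc z))"
  proof -
    have "(\<Sum>z\<in>?XX. (Z z)\<^sup>2) = (\<Sum>z\<in>?XX. \<Sum>k=1..K. \<Sum>l=1..K. cos (real k * \<tau> * sc z) * cos (real l * \<tau> * sc z))"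
      unfolding Z_def power2_eq_square sum_product ..
    also have "\<dots> = (\<Sum>k=1..K. \<Sum>z\<in>?XX. \<Sum>l=1..K. cos (real k * \<tau> * sc z) * cos (real l * \<tau> * sc z))"
      by (rule sum.swap)
    also have "\<dots> = (\<Sum>k=1..K. \<Sum>l=1..K. \<Sum>z\<in>?XX. cos (real k * \<tau> * sc z) * cos (real l * \<tau> * sc z))"
      by (rule sum.cong[OF refl]) (rule sum.swap)
    finally show ?thesis .
  qed
  also have "\<dots> \<le> (\<Sum>k=1..K. \<Sum>l=1..K. c * (Q + of_bool (k = l)))"
  proof (intro sum_mono)
    fix k l assume kl: "k \<in> {1..K}" "l \<in> {1..K}"
    \<comment> \<open>Product to sum: the frequencies \<open>k - l\<close> and \<open>k + l\<close>
      are at most \<open>2 * K\<close> in absolute value, and zero occurs only for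
      \<open>k = l\<close>.\<close>
    have "(\<Sum>z\<in>?XX. cos (real k * \<tau> * sc z) * cos (real l * \<tau> * sc z)) =
        (\<Sum>z\<in>?XX. (cos (real_of_int (int k - int l) * \<tau> * sc z) + cos (real_of_int (int k + int l) * \<tau> * sc z)) / 2)"
      by (intro sum.cong refl) (simp add: cos_times_cos algebra_simps)
    also have "\<dots> = ((\<Sum>z\<in>?XX. cos (real_of_int (int k - int l) * \<tau> * sc z)) +
        (\<Sum>z\<in>?XX. cos (real_of_int (int k + int l) * \<tau> * sc z))) / 2"
      by (simp only: sum.distrib sum_divide_distrib[symmetric])
    also have "\<dots> \<le> (c * (Q + 2 * of_bool (k = l)) + c * Q) / 2"
    proof (intro divide_right_mono add_mono)
      show "(\<Sum>z\<in>?XX. cos (real_of_int (int k + int l) * \<tau> * sc z)) \<le> c * Q"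
        by (rule cosE) (use kl in auto)
      show "(\<Sum>z\<in>?XX. cos (real_of_int (int k - int l) * \<tau> * sc z)) \<le> c * (Q + 2 * of_bool (k = l))"
      proof (cases "k = l")
        case True
        have "(\<Sum>z\<in>?XX. cos (real_of_int (int k - int l) * \<tau> * sc z)) = c"
          using True by (simp add: c_def card_cartesian_product power2_eq_square)
        also have "\<dots> \<le> c * (Q + 2)" using Q0 mult_left_mono[of 1 "Q + 2" c] by (simp add: c_def)
        finally show ?thesis using True by simp
      next
        case False
        have "(\<Sum>z\<in>?XX. cos (real_of_int (int k - int l) * \<tau> * sc z)) \<le> c * Q"
          by (rule cosE) (use kl False in auto)
        then show ?thesis using False by simp
      qed
    qed simp
    also have "\<dots> = c * (Q + of_bool (k = l))" by (simp add: algebra_simps)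
    finally show "(\<Sum>z\<in>?XX. cos (real k * \<tau> * sc z) * cos (real l * \<tau> * sc z)) \<le> c * (Q + of_bool (k = l))" .
  qed
  also have "\<dots> = c * (real K ^ 2 * Q + real K)"
    by (simp add: sum_distrib_left[symmetric] sum.distrib power2_eq_square algebra_simps)
  finally have second: "(\<Sum>z\<in>?XX. (Z z)\<^sup>2) \<le> c * (real K ^ 2 * Q + real K)" .
  let ?B = "{(x, y) \<in> ?XX. \<bar>ip J x y\<bar> \<le> m * real N ^ 2}"
  have low: "(real K / 2)\<^sup>2 \<le> (Z z)\<^sup>2" if z: "z \<in> ?B" for z
  proof -
    have "\<bar>sc z\<bar> \<le> m"
    proof -
      have "\<bar>ip J (fst z) (snd z)\<bar> \<le> m * real N ^ 2" using z by auto
      then show ?thesis using N by (simp add: sc_def abs_divide pos_divide_le_eq)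
    qed
    have "1 / 2 \<le> cos (real k * \<tau> * sc z)" if k: "k \<in> {1..K}" for k
    proof -
      let ?t = "real k * \<tau> * sc z"
      have "\<bar>?t\<bar> = real k * \<tau> * \<bar>sc z\<bar>" using \<tau>(1) by (simp add: abs_mult)
      also have "\<dots> \<le> real K * \<tau> * m" using k \<tau>(1) \<open>\<bar>sc z\<bar> \<le> m\<close> by (intro mult_mono) auto
      also have "\<dots> = 1/2" using \<tau>(3) by (simp add: mult_ac)
      finally have t: "\<bar>?t\<bar> \<le> 1/2" .
      have "cos (pi / 3) \<le> cos \<bar>?t\<bar>"
        by (rule cos_monotone_0_pi_le) (use t pi_ge_two in auto)
      then show ?thesis by (simp add: cos_60)
    qed
    then have "(\<Sum>k=1..K. 1 / 2) \<le> Z z" unfolding Z_def by (intro sum_mono)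
    then have "real K / 2 \<le> Z z" by simp
    then show ?thesis by (intro power_mono) auto
  qed
  have "real (card ?B) * (real K / 2)\<^sup>2 = (\<Sum>z\<in>?B. (real K / 2)\<^sup>2)" by simp
  also have "\<dots> \<le> (\<Sum>z\<in>?B. (Z z)\<^sup>2)" by (rule sum_mono[OF low])
  also have "\<dots> \<le> (\<Sum>z\<in>?XX. (Z z)\<^sup>2)" using fX by (intro sum_mono2) auto
  also have "\<dots> \<le> c * (real K ^ 2 * Q + real K)" by (rule second)
  finally have "real (card ?B) * (real K / 2)\<^sup>2 \<le> c * (real K ^ 2 * Q + real K)" .
  moreover have "real (card ?B) * (real K / 2)\<^sup>2 = real (card ?B) * real K ^ 2 / 4" by (simp add: power_divide)
  moreover have "4 * (1 / real K + Q) * c * real K ^ 2 = 4 * (c * (real K ^ 2 * Q + real K))"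
    using K by (simp add: power2_eq_square field_simps)
  ultimately have "real (card ?B) * real K ^ 2 \<le> 4 * (1 / real K + Q) * c * real K ^ 2" by linarith
  moreover have "0 < real K ^ 2" using K by simp
  ultimately have "real (card ?B) \<le> 4 * (1 / real K + Q) * c" by (simp only: mult_le_cancel_right_pos)
  then show ?thesis by (simp only: c_def Q_def \<tau>_def)
qed

text \<open>\<open>K\<close> is fixed first to make \<open>1 / K\<close> small. The base
  \<open>q < 1\<close> of the second term then depends on \<open>K\<close> and \<open>m\<close>
  only, so a long block makes it small uniformly in \<open>N\<close> and \<open>I\<close>; this
  uniformity allows \<open>N\<close> to be chosen after \<open>h0\<close>.\<close>

lemma ip_anticoncentration:
  fixes m \<epsilon> :: real
  assumes "0 < \<epsilon>"
  obtains h0 :: nat where "\<And>(I :: 'i set) J N. finite I \<Longrightarrow> J \<subseteq> I \<Longrightarrow> h0 \<le> card J \<Longrightarrow> 1 \<le> N \<Longrightarrow>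
    real (card {(x, y) \<in> (I \<rightarrow>\<^sub>E grid N) \<times> (I \<rightarrow>\<^sub>E grid N). \<bar>ip J x y\<bar> \<le> m * real N ^ 2}) \<le>
    \<epsilon> * real (card (I \<rightarrow>\<^sub>E grid N)) ^ 2"
proof -
  define m1 where "m1 = max 1 m"
  have m1: "1 \<le> m1" "m \<le> m1" by (auto simp: m1_def)
  obtain K :: nat where K0: "8 / \<epsilon> + 1 \<le> real K" using real_arch_simple by blast
  have "0 < 8 / \<epsilon>" using assms by simp
  then have K: "1 \<le> K" using K0 by linarith
  have K8: "4 * (1 / real K) \<le> \<epsilon> / 2"
  proof -
    have "8 / \<epsilon> \<le> real K" using K0 by linarith
    then show ?thesis using assms K by (simp add: field_simps)
  qed
  define q where "q = 1 - (1 / (2 * real K * m1))\<^sup>2 / 36"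
  have q: "0 \<le> q" "q < 1"
  proof -
    define d where "d = 2 * real K * m1"
    define p where "p = 1 / d"
    have "1 \<le> real K * m1" using mult_mono[of 1 "real K" 1 m1] K m1 by simp
    then have "1 \<le> d" unfolding d_def by linarith
    then have "0 < p" "p \<le> 1" by (simp_all add: p_def)
    then have "0 < p\<^sup>2" "p\<^sup>2 \<le> 1" by (simp_all add: power_le_one)
    moreover have "q = 1 - p\<^sup>2 / 36" by (simp only: q_def p_def d_def)
    ultimately show "0 \<le> q" "q < 1" by linarith+
  qed
  obtain h0 where h0: "q ^ h0 < \<epsilon> / 8" using real_arch_pow_inv[of "\<epsilon> / 8" q] assms q by auto
  show ?thesis
  proof (rule that[of h0])
    fix I :: "'i set" and J and N :: nat
    assume I: "finite I" "J \<subseteq> I" "h0 \<le> card J" "1 \<le> N"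
    let ?X = "I \<rightarrow>\<^sub>E grid N"
    have fX: "finite ?X" using I by (intro finite_PiE) simp_all
    have qh: "q ^ card J \<le> \<epsilon> / 8" using h0 power_decreasing[OF I(3), of q] q by linarith
    have "card {(x, y) \<in> ?X \<times> ?X. \<bar>ip J x y\<bar> \<le> m * real N ^ 2} \<le>
        card {(x, y) \<in> ?X \<times> ?X. \<bar>ip J x y\<bar> \<le> m1 * real N ^ 2}"
    proof (rule card_mono)
      have "m * real N ^ 2 \<le> m1 * real N ^ 2" using m1(2) by (intro mult_right_mono) auto
      then show "{(x, y) \<in> ?X \<times> ?X. \<bar>ip J x y\<bar> \<le> m * real N ^ 2} \<subseteq> {(x, y) \<in> ?X \<times> ?X. \<bar>ip J x y\<bar> \<le> m1 * real N ^ 2}"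
        by auto
      show "finite {(x, y) \<in> ?X \<times> ?X. \<bar>ip J x y\<bar> \<le> m1 * real N ^ 2}"
        by (rule finite_subset[of _ "?X \<times> ?X"]) (use fX in auto)
    qed
    then have "real (card {(x, y) \<in> ?X \<times> ?X. \<bar>ip J x y\<bar> \<le> m * real N ^ 2}) \<le>
        real (card {(x, y) \<in> ?X \<times> ?X. \<bar>ip J x y\<bar> \<le> m1 * real N ^ 2})" by simp
    also have "\<dots> \<le> 4 * (1 / real K + q ^ card J) * real (card ?X) ^ 2"
      unfolding q_def by (rule ip_anticoncentration_aux[OF I(1,2,4) K m1(1)])
    also have "\<dots> \<le> \<epsilon> * real (card ?X) ^ 2"
      using K8 qh by (intro mult_right_mono) auto
    finally show "real (card {(x, y) \<in> ?X \<times> ?X. \<bar>ip J x y\<bar> \<le> m * real N ^ 2}) \<le> \<epsilon> * real (card ?X) ^ 2" .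
  qed
qed

section \<open>Rarity of short vectors\<close>

lemma exp_minus_le:
  assumes "0 \<le> (u::real)" "u \<le> 1"
  shows "exp (- u) \<le> 1 - u / 2"
proof -
  have "1 \<le> (1 - u / 2) * (1 + u)"
    using mult_left_mono[OF assms(2,1)] by (simp add: algebra_simps)
  also have "\<dots> \<le> (1 - u / 2) * exp u" using assms by (intro mult_left_mono) auto
  finally show ?thesis by (simp add: exp_minus field_simps)
qed

text \<open>The exponential Markov inequality for the negated squared length. The factor per
  coordinate is \<open>5/6 = 1 - (1/2) * (1/3)\<close>, where \<open>1/3\<close> bounds the mean of
  \<open>(a / N)\<^sup>2\<close> from below.\<close>

lemma small_norm_rare:
  fixes C \<epsilon> :: real
  assumes "0 < \<epsilon>"
  obtains h0 :: nat where "\<And>(I :: 'i set) N. finite I \<Longrightarrow> h0 \<le> card I \<Longrightarrow> 1 \<le> N \<Longrightarrow>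
    real (card {x \<in> I \<rightarrow>\<^sub>E grid N. ip I x x \<le> C * real N ^ 2}) \<le> \<epsilon> * real (card (I \<rightarrow>\<^sub>E grid N))"
proof -
  obtain h0 where h0: "(5/6::real) ^ h0 < \<epsilon> / exp C"
    using real_arch_pow_inv[of "\<epsilon> / exp C" "5/6"] assms by auto
  show ?thesis
  proof (rule that[of h0])
    fix I :: "'i set" and N :: nat
    assume I: "finite I" "h0 \<le> card I" "1 \<le> N"
    let ?X = "I \<rightarrow>\<^sub>E grid N" and ?M = "real (card (grid N))"
    let ?B = "{x \<in> ?X. ip I x x \<le> C * real N ^ 2}"
    have fX: "finite ?X" using I by (intro finite_PiE) simp_all
    have Npos: "0 < real N ^ 2" using I(3) by simp
    have one: "(\<Sum>a\<in>grid N. exp (- ((real_of_int a)\<^sup>2 / real N ^ 2))) \<le> ?M * (5/6)"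
    proof -
      have "(\<Sum>a\<in>grid N. exp (- ((real_of_int a)\<^sup>2 / real N ^ 2))) \<le> (\<Sum>a\<in>grid N. 1 - (real_of_int a)\<^sup>2 / real N ^ 2 / 2)"
      proof (rule sum_mono, rule exp_minus_le)
        fix a assume a: "a \<in> grid N"
        have "\<bar>real_of_int a\<bar>\<^sup>2 \<le> real N ^ 2" by (rule power_mono[OF abs_grid_le[OF a]]) simp
        then show "(real_of_int a)\<^sup>2 / real N ^ 2 \<le> 1" using Npos by simp
      qed simp
      also have "\<dots> = ?M - (\<Sum>a\<in>grid N. (real_of_int a)\<^sup>2) / real N ^ 2 / 2"
        by (simp only: sum_subtractf sum_divide_distrib[symmetric]) simp
      also have "\<dots> \<le> ?M - (real N ^ 2 * ?M / 3) / real N ^ 2 / 2"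
        by (intro diff_left_mono divide_right_mono sum_squares_grid) auto
      also have "\<dots> = ?M * (5/6)" using Npos by simp
      finally show ?thesis .
    qed
    have "real (card ?B) * exp (- C) = (\<Sum>x\<in>?B. exp (- C))" by simp
    also have "\<dots> \<le> (\<Sum>x\<in>?B. \<Prod>i\<in>I. exp (- ((real_of_int (x i))\<^sup>2 / real N ^ 2)))"
    proof (rule sum_mono)
      fix x assume x: "x \<in> ?B"
      have "(\<Prod>i\<in>I. exp (- ((real_of_int (x i))\<^sup>2 / real N ^ 2))) = exp (\<Sum>i\<in>I. - ((real_of_int (x i))\<^sup>2 / real N ^ 2))"
        by (rule exp_sum[OF I(1), symmetric])
      also have "(\<Sum>i\<in>I. - ((real_of_int (x i))\<^sup>2 / real N ^ 2)) = - (ip I x x / real N ^ 2)"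
        by (simp add: ip_def sum_negf sum_divide_distrib power2_eq_square)
      finally have eq: "(\<Prod>i\<in>I. exp (- ((real_of_int (x i))\<^sup>2 / real N ^ 2))) = exp (- (ip I x x / real N ^ 2))" .
      have "ip I x x / real N ^ 2 \<le> C" using x Npos by (simp add: pos_divide_le_eq)
      then show "exp (- C) \<le> (\<Prod>i\<in>I. exp (- ((real_of_int (x i))\<^sup>2 / real N ^ 2)))" unfolding eq by simp
    qed
    also have "\<dots> \<le> (\<Sum>x\<in>?X. \<Prod>i\<in>I. exp (- ((real_of_int (x i))\<^sup>2 / real N ^ 2)))"
      using fX by (intro sum_mono2) (auto intro: prod_nonneg)
    also have "\<dots> = (\<Prod>i\<in>I. \<Sum>a\<in>grid N. exp (- ((real_of_int a)\<^sup>2 / real N ^ 2)))"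
      using I(1) by (intro prod_sum_PiE[symmetric]) auto
    also have "\<dots> \<le> (\<Prod>i\<in>I. ?M * (5/6))" by (intro prod_mono) (use one in \<open>auto intro: sum_nonneg\<close>)
    also have "\<dots> = real (card ?X) * (5/6) ^ card I"
      by (simp only: prod_constant card_funcsetE[OF I(1)] of_nat_power power_mult_distrib)
    also have "\<dots> \<le> real (card ?X) * (\<epsilon> / exp C)"
    proof (rule mult_left_mono)
      have "(5/6::real) ^ card I \<le> (5/6) ^ h0" by (rule power_decreasing[OF I(2)]) auto
      then show "(5/6::real) ^ card I \<le> \<epsilon> / exp C" using h0 by linarith
    qed simp
    finally have "real (card ?B) * exp (- C) \<le> real (card ?X) * (\<epsilon> / exp C)" .
    then show "real (card ?B) \<le> \<epsilon> * real (card ?X)"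
      by (simp add: exp_minus field_simps)
  qed
qed

section \<open>A discrete Bollobas--Erdos graph\<close>

text \<open>One condition at a time: \<open>\<phi> e0\<close> injects the part of \<open>A\<close>
  with \<open>S e0 < - m\<close> into the part with \<open>S e0 > m\<close> and does not disturb the
  conditions already imposed. So at least half of \<open>A\<close> survives, up to the points with
  \<open>\<bar>S e0\<bar> \<le> m\<close>.\<close>

lemma sign_flip_count:
  fixes S :: "'e \<Rightarrow> 'z \<Rightarrow> real"
  assumes fZ: "finite Z" and m: "0 \<le> m" and "finite F"
    and "\<forall>e\<in>F. inj_on (\<phi> e) Z \<and> \<phi> e ` Z \<subseteq> Z \<and> (\<forall>z\<in>Z. S e (\<phi> e z) = - S e z)"
    and "\<forall>e\<in>F. \<forall>e'\<in>F. e \<noteq> e' \<longrightarrow> (\<forall>z\<in>Z. S e' (\<phi> e z) = S e' z)"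
  shows "real (card Z) * (1/2) ^ card F - (\<Sum>e\<in>F. real (card {z \<in> Z. \<bar>S e z\<bar> \<le> m})) \<le>
    real (card {z \<in> Z. \<forall>e\<in>F. S e z > m})"
  using assms(3-)
proof (induction F rule: finite_induct)
  case empty
  then show ?case by simp
next
  case (insert e0 F)
  define A where "A = {z \<in> Z. \<forall>e\<in>F. S e z > m}"
  define P where "P = {z \<in> A. S e0 z > m}"
  define M where "M = {z \<in> A. S e0 z < - m}"
  define O0 where "O0 = {z \<in> A. \<bar>S e0 z\<bar> \<le> m}"
  have fA: "finite A" using fZ by (simp add: A_def)
  have IH: "real (card Z) * (1/2) ^ card F - (\<Sum>e\<in>F. real (card {z \<in> Z. \<bar>S e z\<bar> \<le> m})) \<le> real (card A)"
    unfolding A_def by (rule insert.IH) (use insert.prems in blast)+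
  have e0: "inj_on (\<phi> e0) Z" "\<phi> e0 ` Z \<subseteq> Z" "\<And>z. z \<in> Z \<Longrightarrow> S e0 (\<phi> e0 z) = - S e0 z"
    using insert.prems(1) by blast+
  have keep: "S e (\<phi> e0 z) = S e z" if "e \<in> F" "z \<in> Z" for e z
    using insert.prems(2) insert.hyps(2) that by (metis insertCI)
  have "card M \<le> card P"
  proof (rule card_inj_on_le[of "\<phi> e0"])
    show "inj_on (\<phi> e0) M" by (rule inj_on_subset[OF e0(1)]) (auto simp: M_def A_def)
    show "\<phi> e0 ` M \<subseteq> P"
    proof (rule image_subsetI)
      fix z assume z: "z \<in> M"
      then have zZ: "z \<in> Z" by (simp add: M_def A_def)
      have "\<phi> e0 z \<in> A" unfolding A_def using z e0(2) zZ keep by (auto simp: M_def A_def)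
      moreover have "S e0 (\<phi> e0 z) > m" using z e0(3)[OF zZ] by (simp add: M_def)
      ultimately show "\<phi> e0 z \<in> P" by (simp add: P_def)
    qed
    show "finite P" using fA by (simp add: P_def)
  qed
  moreover have "card A \<le> card P + card M + card O0"
  proof -
    have "A \<subseteq> (P \<union> M) \<union> O0" by (auto simp: P_def M_def O0_def)
    then have "card A \<le> card ((P \<union> M) \<union> O0)"
      using fA by (intro card_mono) (auto simp: P_def M_def O0_def)
    also have "\<dots> \<le> card (P \<union> M) + card O0" by (rule card_Un_le)
    also have "\<dots> \<le> card P + card M + card O0" using card_Un_le[of P M] by simp
    finally show ?thesis .
  qed
  moreover have "card O0 \<le> card {z \<in> Z. \<bar>S e0 z\<bar> \<le> m}"
    using fZ by (intro card_mono) (auto simp: O0_def A_def)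
  ultimately have "real (card A) \<le> 2 * real (card P) + real (card {z \<in> Z. \<bar>S e0 z\<bar> \<le> m})"
    by linarith
  moreover have "card {z \<in> Z. \<forall>e\<in>insert e0 F. S e z > m} = card P"
    by (rule arg_cong[of _ _ card]) (auto simp: P_def A_def)
  moreover have "0 \<le> real (card {z \<in> Z. \<bar>S e0 z\<bar> \<le> m})" by simp
  moreover have "real (card Z) * (1/2) ^ card (insert e0 F) = real (card Z) * (1/2) ^ card F / 2"
    using insert.hyps by simp
  moreover have "(\<Sum>e\<in>insert e0 F. real (card {z \<in> Z. \<bar>S e z\<bar> \<le> m})) =
      real (card {z \<in> Z. \<bar>S e0 z\<bar> \<le> m}) + (\<Sum>e\<in>F. real (card {z \<in> Z. \<bar>S e z\<bar> \<le> m}))"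
    by (rule sum.insert[OF insert.hyps])
  moreover have "0 \<le> (\<Sum>e\<in>F. real (card {z \<in> Z. \<bar>S e z\<bar> \<le> m}))" by (intro sum_nonneg) simp
  ultimately show ?case using IH by linarith
qed

text \<open>Two distinct coordinates of a uniform random tuple are a uniform random pair; the
  denominators are cleared.\<close>

lemma sum_PiE_marginal:
  fixes g :: "'a \<Rightarrow> 'a \<Rightarrow> real"
  assumes "finite (T :: 'b set)" "i \<in> T" "j \<in> T" "i \<noteq> j"
  shows "real (card X) ^ 2 * (\<Sum>z\<in>T \<rightarrow>\<^sub>E X. g (z i) (z j)) = real (card (T \<rightarrow>\<^sub>E X)) * (\<Sum>x\<in>X. \<Sum>y\<in>X. g x y)"
proof -
  define J where "J = T - {i, j}"
  have J: "T = insert i (insert j J)" "i \<notin> insert j J" "j \<notin> J" "finite J"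
    using assms by (auto simp: J_def)
  have "(\<Sum>z\<in>T \<rightarrow>\<^sub>E X. g (z i) (z j)) = (\<Sum>x\<in>X. \<Sum>y\<in>X. \<Sum>\<sigma>\<in>J \<rightarrow>\<^sub>E X. g x y)"
  proof -
    have "(\<sigma>(j := y, i := x)) i = x" "(\<sigma>(j := y, i := x)) j = y" for \<sigma> :: "'b \<Rightarrow> 'a" and x y
      using assms(4) by auto
    then show ?thesis by (simp only: J(1) sum_PiE_insert[OF J(2)] sum_PiE_insert[OF J(3)])
  qed
  also have "\<dots> = real (card X) ^ card J * (\<Sum>x\<in>X. \<Sum>y\<in>X. g x y)"
    by (simp add: card_funcsetE[OF J(4)] sum_distrib_left)
  finally have "(\<Sum>z\<in>T \<rightarrow>\<^sub>E X. g (z i) (z j)) = real (card X) ^ card J * (\<Sum>x\<in>X. \<Sum>y\<in>X. g x y)" .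
  moreover have "real (card (T \<rightarrow>\<^sub>E X)) = real (card X) ^ 2 * real (card X) ^ card J"
  proof -
    have "card T = 2 + card J" using J by simp
    then show ?thesis by (simp only: card_funcsetE[OF assms(1)] power_add of_nat_power of_nat_mult)
  qed
  ultimately show ?thesis by (simp only: mult.assoc)
qed

lemma ip_commute: "ip J x y = ip J y x"
  by (simp add: ip_def mult.commute)

lemma sqnorm_sum_commute: "sqnorm_sum J x y = sqnorm_sum J y x"
  by (simp add: sqnorm_sum_def add.commute)

text \<open>Cauchy--Schwarz applied to \<open>2 x = (x + y) + (x + z) - (y + z)\<close>.\<close>

lemma sqnorm_sum_triangle:
  "4 * ip I x x \<le> 3 * (sqnorm_sum I x y + sqnorm_sum I x z + sqnorm_sum I y z)"
proof -
  have "4 * ip I x x = (\<Sum>i\<in>I. 4 * (real_of_int (x i))\<^sup>2)"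
    by (simp add: ip_def sum_distrib_left power2_eq_square)
  also have "\<dots> \<le> (\<Sum>i\<in>I. 3 * ((real_of_int (x i + y i))\<^sup>2 + (real_of_int (x i + z i))\<^sup>2 + (real_of_int (y i + z i))\<^sup>2))"
  proof (rule sum_mono)
    fix i
    define a b c where "a = real_of_int (x i + y i)" "b = real_of_int (x i + z i)" "c = real_of_int (y i + z i)"
    have "2 * real_of_int (x i) = a + b - c" by (simp add: a_b_c_def)
    then have "4 * (real_of_int (x i))\<^sup>2 = (a + b - c)\<^sup>2" by (metis four_x_squared)
    moreover have "3 * (a\<^sup>2 + b\<^sup>2 + c\<^sup>2) - (a + b - c)\<^sup>2 = (a - b)\<^sup>2 + (a + c)\<^sup>2 + (b + c)\<^sup>2"
      by (simp add: power2_eq_square algebra_simps)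
    moreover have "0 \<le> (a - b)\<^sup>2 + (a + c)\<^sup>2 + (b + c)\<^sup>2" by simp
    ultimately show "4 * (real_of_int (x i))\<^sup>2 \<le> 3 * ((real_of_int (x i + y i))\<^sup>2 + (real_of_int (x i + z i))\<^sup>2 + (real_of_int (y i + z i))\<^sup>2)"
      unfolding a_b_c_def[symmetric] by linarith
  qed
  also have "\<dots> = 3 * (sqnorm_sum I x y + sqnorm_sum I x z + sqnorm_sum I y z)"
    by (simp only: sqnorm_sum_def sum.distrib[symmetric] sum_distrib_left)
  finally show ?thesis .
qed

text \<open>The four inner products add up to the one of \<open>x + x'\<close> and
  \<open>y + y'\<close>, to which \<open>2 * a * b \<le> a\<^sup>2 + b\<^sup>2\<close> applies in
  each coordinate; the squares outside \<open>J\<close> are added for free.\<close>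

lemma ip_quadrilateral:
  assumes "finite I" "J \<subseteq> I"
  shows "2 * (ip J x y + ip J x y' + ip J x' y + ip J x' y') \<le> sqnorm_sum I x x' + sqnorm_sum I y y'"
proof -
  have "2 * (ip J x y + ip J x y' + ip J x' y + ip J x' y') =
      (\<Sum>i\<in>J. 2 * (real_of_int (x i + x' i) * real_of_int (y i + y' i)))"
    by (simp add: ip_def sum.distrib[symmetric] sum_distrib_left algebra_simps)
  also have "\<dots> \<le> (\<Sum>i\<in>J. (real_of_int (x i + x' i))\<^sup>2 + (real_of_int (y i + y' i))\<^sup>2)"
    by (rule sum_mono) (metis mult.assoc sum_squares_bound)
  also have "\<dots> \<le> (\<Sum>i\<in>I. (real_of_int (x i + x' i))\<^sup>2 + (real_of_int (y i + y' i))\<^sup>2)"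
    by (rule sum_mono2[OF assms]) simp
  finally show ?thesis by (simp only: sqnorm_sum_def sum.distrib)
qed

section \<open>Construction from a weighted graph: no large clique, no heavy independent set\<close>

context
  fixes R :: "'v wgraph" and h N :: nat and r :: real
  assumes R: "weighted_graph R"
begin

text \<open>Indexing blocks by sets of vertices makes the block of a pair independent of its order,
  and distinct pairs get disjoint blocks. This disjointness lets the sign of one inner product be
  changed without affecting the others.\<close>

definition coords :: "('v set \<times> nat) set" where
  "coords = Pow (verts R) \<times> {..<h}"

definition points :: "('v set \<times> nat \<Rightarrow> int) set" where
  "points = coords \<rightarrow>\<^sub>E grid N"

definition block :: "'v \<Rightarrow> 'v \<Rightarrow> ('v set \<times> nat) set" where
  "block u v = {{u, v}} \<times> {..<h}"

text \<open>\<open>9 / 4\<close> is the value at which \<open>sqnorm_sum_triangle\<close> excludes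
  triangles: three sums of squared length at most \<open>r * N\<^sup>2\<close> would give
  \<open>4 * ip coords x x \<le> 9 * r * N\<^sup>2\<close>.\<close>

definition long :: "('v set \<times> nat \<Rightarrow> int) \<Rightarrow> bool" where
  "long x \<longleftrightarrow> ip coords x x > 9 / 4 * r * real N ^ 2"

definition near_antipodal :: "('v set \<times> nat \<Rightarrow> int) \<Rightarrow> ('v set \<times> nat \<Rightarrow> int) \<Rightarrow> bool" where
  "near_antipodal x y \<longleftrightarrow> x \<noteq> y \<and> long x \<and> long y \<and> sqnorm_sum coords x y \<le> r * real N ^ 2"

text \<open>With the threshold \<open>r / 4\<close>, four mutual adjacencies would make the left
  side of \<open>ip_quadrilateral\<close> exceed \<open>2 * r * N\<^sup>2\<close>, the bound for two
  near-antipodal pairs. Weights above \<open>1/2\<close> become complete bipartite.\<close>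

definition cross_adj :: "'v \<Rightarrow> ('v set \<times> nat \<Rightarrow> int) \<Rightarrow> 'v \<Rightarrow> ('v set \<times> nat \<Rightarrow> int) \<Rightarrow> bool" where
  "cross_adj u x v y \<longleftrightarrow> eweight R u v > 1/2 \<or> (eweight R u v > 0 \<and> ip (block u v) x y > r / 4 * real N ^ 2)"

definition be_rel :: "'v \<times> ('v set \<times> nat \<Rightarrow> int) \<Rightarrow> 'v \<times> ('v set \<times> nat \<Rightarrow> int) \<Rightarrow> bool" where
  "be_rel a b \<longleftrightarrow> (if fst a = fst b then near_antipodal (snd a) (snd b) else cross_adj (fst a) (snd a) (fst b) (snd b))"

definition be_verts :: "('v \<times> ('v set \<times> nat \<Rightarrow> int)) set" where
  "be_verts = verts R \<times> points"

definition be_edges :: "('v \<times> ('v set \<times> nat \<Rightarrow> int)) set set" where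
  "be_edges = {{a, b} | a b. a \<in> be_verts \<and> b \<in> be_verts \<and> be_rel a b}"

definition be_weight :: "'v \<times> ('v set \<times> nat \<Rightarrow> int) \<Rightarrow> real" where
  "be_weight a = vweight R (fst a) / real (card points)"

lemma finite_verts: "finite (verts R)"
  using R by (simp add: weighted_graph_def)

lemma eweight_sym: "u \<in> verts R \<Longrightarrow> v \<in> verts R \<Longrightarrow> eweight R u v = eweight R v u"
  using R by (simp add: weighted_graph_def)

lemma finite_coords: "finite coords"
  using finite_verts by (simp add: coords_def)

lemma card_coords: "card coords = 2 ^ card (verts R) * h"
  using finite_verts by (simp add: coords_def card_Pow)

lemma finite_points: "finite points"
  unfolding points_def using finite_coords by (intro finite_PiE) simp_all

lemma card_points_pos: "0 < card points"
  unfolding points_def using finite_coords by (simp add: card_funcsetE card_grid)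

lemma block_subset: "u \<in> verts R \<Longrightarrow> v \<in> verts R \<Longrightarrow> block u v \<subseteq> coords"
  by (auto simp: block_def coords_def)

lemma block_sym: "block u v = block v u"
  by (simp add: block_def insert_commute)

lemma card_block: "card (block u v) = h"
  by (simp add: block_def)

lemma be_rel_sym: "a \<in> be_verts \<Longrightarrow> b \<in> be_verts \<Longrightarrow> be_rel a b \<Longrightarrow> be_rel b a"
  unfolding be_rel_def near_antipodal_def cross_adj_def be_verts_def
  using eweight_sym[of "fst a" "fst b"] block_sym[of "fst a" "fst b"] ip_commute[of _ "snd a" "snd b"]
    sqnorm_sum_commute[of _ "snd a" "snd b"]
  by (auto simp: mem_Times_iff split: if_splits)

lemma be_edges_iff: "{a, b} \<in> be_edges \<longleftrightarrow> a \<in> be_verts \<and> b \<in> be_verts \<and> be_rel a b"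
proof
  assume "{a, b} \<in> be_edges"
  then obtain a' b' where ab: "{a, b} = {a', b'}" "a' \<in> be_verts" "b' \<in> be_verts" "be_rel a' b'"
    unfolding be_edges_def by blast
  from ab(1) consider "a = a'" "b = b'" | "a = b'" "b = a'" by (metis doubleton_eq_iff)
  then show "a \<in> be_verts \<and> b \<in> be_verts \<and> be_rel a b"
  proof cases
    case 1
    then show ?thesis using ab(2-4) by simp
  next
    case 2
    then show ?thesis using ab(2,3) be_rel_sym[OF ab(2-4)] by simp
  qed
qed (unfold be_edges_def, blast)

lemma simple_graph_be: "simple_graph be_verts be_edges"
  unfolding simple_graph_def
proof (intro conjI ballI)
  show "finite be_verts" unfolding be_verts_def using finite_verts finite_points by simp
  fix e assume "e \<in> be_edges"
  then obtain a b where ab: "e = {a, b}" "a \<in> be_verts" "b \<in> be_verts" "be_rel a b"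
    unfolding be_edges_def by blast
  have "a \<noteq> b" using ab(4) by (auto simp: be_rel_def near_antipodal_def)
  then show "e \<subseteq> be_verts" "card e = 2" using ab by auto
qed

lemma no_antipodal_triangle:
  assumes "near_antipodal x y" "near_antipodal x z" "near_antipodal y z"
  shows False
proof -
  have "4 * ip coords x x \<le> 3 * (sqnorm_sum coords x y + sqnorm_sum coords x z + sqnorm_sum coords y z)"
    by (rule sqnorm_sum_triangle)
  also have "\<dots> \<le> 9 * r * real N ^ 2" using assms by (simp add: near_antipodal_def)
  finally show False using assms(1) by (simp add: near_antipodal_def long_def)
qed

lemma no_cross_quadrilateral:
  assumes "near_antipodal x x'" "near_antipodal y y'" "u \<in> verts R" "v \<in> verts R"
    and "cross_adj u x v y" "cross_adj u x v y'" "cross_adj u x' v y" "cross_adj u x' v y'"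
  shows "eweight R u v > 1/2"
proof (rule ccontr)
  assume "\<not> ?thesis"
  then have "ip (block u v) x y > r / 4 * real N ^ 2" "ip (block u v) x y' > r / 4 * real N ^ 2"
    "ip (block u v) x' y > r / 4 * real N ^ 2" "ip (block u v) x' y' > r / 4 * real N ^ 2"
    using assms(5-) by (simp_all add: cross_adj_def)
  moreover have "2 * (ip (block u v) x y + ip (block u v) x y' + ip (block u v) x' y + ip (block u v) x' y')
      \<le> sqnorm_sum coords x x' + sqnorm_sum coords y y'"
    by (rule ip_quadrilateral[OF finite_coords block_subset[OF assms(3,4)]])
  moreover have "sqnorm_sum coords x x' \<le> r * real N ^ 2" "sqnorm_sum coords y y' \<le> r * real N ^ 2"
    using assms(1,2) by (simp_all add: near_antipodal_def)
  ultimately show False by simp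
qed

text \<open>A clique meets each copy in at most two points. The copies it meets form
  \<open>S1\<close>, those it meets twice form \<open>S2\<close>, and their sizes add up to the size
  of the clique.\<close>

lemma clique_free_be:
  assumes free: "weighted_clique_free t R" and t: "3 \<le> t"
  shows "clique_free t be_verts be_edges"
  unfolding clique_free_def
proof
  assume "\<exists>Q. is_clique be_verts be_edges Q \<and> card Q = t"
  then obtain Q where Q: "is_clique be_verts be_edges Q" "card Q = t" by blast
  have Qsub: "Q \<subseteq> be_verts" using Q(1) by (simp add: is_clique_def)
  have fQ: "finite Q" using Q(2) t by (intro card_ge_0_finite) simp
  have rel: "be_rel a b" if "a \<in> Q" "b \<in> Q" "a \<noteq> b" for a b
    using Q(1) that be_edges_iff by (simp add: is_clique_def)
  define L where "L u = {x. (u, x) \<in> Q}" for u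
  define S1 where "S1 = fst ` Q"
  define S2 where "S2 = {u \<in> S1. 2 \<le> card (L u)}"
  have fL: "finite (L u)" for u
  proof -
    have "L u \<subseteq> snd ` Q" by (force simp: L_def)
    then show ?thesis using fQ finite_subset by blast
  qed
  have S1sub: "S1 \<subseteq> verts R" using Qsub by (auto simp: S1_def be_verts_def)
  have fS1: "finite S1" using fQ by (simp add: S1_def)
  have anti: "near_antipodal x y" if "x \<in> L u" "y \<in> L u" "x \<noteq> y" for u x y
    using rel[of "(u, x)" "(u, y)"] that by (simp add: L_def be_rel_def)
  have cross: "cross_adj u x v y" if "x \<in> L u" "y \<in> L v" "u \<noteq> v" for u x v y
    using rel[of "(u, x)" "(v, y)"] that by (simp add: L_def be_rel_def)
  have le2: "card (L u) \<le> 2" for u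
  proof (rule ccontr)
    assume "\<not> ?thesis"
    then have "3 \<le> card (L u)" by simp
    then obtain T where T: "T \<subseteq> L u" "card T = 3" using obtain_subset_with_card_n by metis
    then obtain x y z where "T = {x, y, z}" "x \<noteq> y" "y \<noteq> z" "x \<noteq> z" by (metis card_3_iff)
    then show False using no_antipodal_triangle[of x y z] anti[of x u y] anti[of x u z] anti[of y u z] T(1) by auto
  qed
  have ge1: "1 \<le> card (L u)" if "u \<in> S1" for u
  proof -
    have "L u \<noteq> {}" using that by (force simp: S1_def L_def)
    then show ?thesis using fL[of u] by (simp add: Suc_le_eq card_gt_0_iff)
  qed
  have "Q = Sigma S1 L" by (force simp: S1_def L_def)
  then have "t = (\<Sum>u\<in>S1. card (L u))" using Q(2) fS1 fL by simp
  also have "\<dots> = (\<Sum>u\<in>S1. 1 + of_bool (u \<in> S2))"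
  proof (rule sum.cong[OF refl])
    fix u assume u: "u \<in> S1"
    show "card (L u) = 1 + of_bool (u \<in> S2)"
      using le2[of u] ge1[OF u] u by (simp add: S2_def)
  qed
  also have "\<dots> = card S1 + card S2"
  proof -
    have "(\<Sum>u\<in>S1. of_bool (u \<in> S2)) = card (S1 \<inter> {u. u \<in> S2})" using fS1 by simp
    also have "S1 \<inter> {u. u \<in> S2} = S2" by (auto simp: S2_def)
    finally show ?thesis by (simp only: sum.distrib card_eq_sum)
  qed
  finally have count: "card S1 + card S2 = t" by simp
  have S2sub: "S2 \<subseteq> S1" by (auto simp: S2_def)
  have pos: "eweight R u v > 0" if uv: "u \<in> S1" "v \<in> S1" "u \<noteq> v" for u v
  proof -
    obtain x y where "x \<in> L u" "y \<in> L v" using uv by (force simp: S1_def L_def)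
    from cross[OF this uv(3)] show ?thesis by (auto simp: cross_adj_def)
  qed
  have half: "eweight R u v > 1/2" if uv: "u \<in> S2" "v \<in> S2" "u \<noteq> v" for u v
  proof -
    obtain x x' where x: "x \<in> L u" "x' \<in> L u" "x \<noteq> x'"
      using uv(1) by (metis (mono_tags, lifting) S2_def card_le_Suc0_iff_eq fL mem_Collect_eq not_less_eq_eq numeral_2_eq_2)
    obtain y y' where y: "y \<in> L v" "y' \<in> L v" "y \<noteq> y'"
      using uv(2) by (metis (mono_tags, lifting) S2_def card_le_Suc0_iff_eq fL mem_Collect_eq not_less_eq_eq numeral_2_eq_2)
    have uvR: "u \<in> verts R" "v \<in> verts R" using uv S2sub S1sub by auto
    show ?thesis
      by (rule no_cross_quadrilateral[OF anti[OF x] anti[OF y] uvR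
          cross[OF x(1) y(1) uv(3)] cross[OF x(1) y(2) uv(3)] cross[OF x(2) y(1) uv(3)] cross[OF x(2) y(2) uv(3)]])
  qed
  have cl1: "is_clique (verts R) (threshold_edges R 0) S1"
    unfolding is_clique_def threshold_edges_def using S1sub pos by blast
  have cl2: "is_clique (verts R) (threshold_edges R (1/2)) S2"
    unfolding is_clique_def threshold_edges_def using S2sub S1sub half by blast
  have "weighted_cliques t R \<noteq> {}"
  proof (cases "S2 = {}")
    case False
    then have "1 \<le> card S2" using finite_subset[OF S2sub fS1] by (simp add: Suc_le_eq card_gt_0_iff)
    moreover have "1 \<le> card S1" using card_mono[OF fS1 S2sub] calculation by linarith
    ultimately have "(S1, S2) \<in> weighted_cliques t R"
      unfolding weighted_cliques_def using S2sub S1sub count cl1 cl2 by blast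
    then show ?thesis by blast
  next
    \<comment> \<open>Weighted cliques have a nonempty second set. If no copy is met twice, then
      \<open>S1\<close> has \<open>t\<close> elements; one of them is dropped and another one serves
      as the singleton: \<open>(t - 1) + 1 = t\<close>.\<close>
    case True
    then have c1: "card S1 = t" using count by simp
    then obtain v0 where v0: "v0 \<in> S1" using t by fastforce
    have "card (S1 - {v0}) = t - 1" using c1 v0 fS1 by simp
    then have c2: "card (S1 - {v0}) + 1 = t" "1 \<le> card (S1 - {v0})" using t by linarith+
    then obtain v1 where v1: "v1 \<in> S1 - {v0}" by (metis One_nat_def card.empty ex_in_conv not_one_le_zero)
    have "is_clique (verts R) (threshold_edges R 0) (S1 - {v0})" using cl1 by (auto simp: is_clique_def)
    moreover have "is_clique (verts R) (threshold_edges R (1/2)) {v1}" using v1 S1sub by (auto simp: is_clique_def)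
    ultimately have "(S1 - {v0}, {v1}) \<in> weighted_cliques t R"
      unfolding weighted_cliques_def using v1 S1sub c2 by auto
    then show ?thesis by blast
  qed
  then show False using free by (simp add: weighted_clique_free_def)
qed

lemma sum_be_weight: "(\<Sum>a\<in>be_verts. be_weight a) = 1"
proof -
  have "(\<Sum>a\<in>be_verts. be_weight a) = (\<Sum>u\<in>verts R. \<Sum>x\<in>points. vweight R u / real (card points))"
    by (simp only: be_verts_def be_weight_def sum.cartesian_product case_prod_unfold)
  also have "\<dots> = (\<Sum>u\<in>verts R. vweight R u)" using card_points_pos by simp
  finally show ?thesis using R by (simp add: weighted_graph_def)
qed

lemma independent_be:
  assumes \<theta>: "0 < \<theta>"
    and anti: "\<And>A. A \<subseteq> points \<Longrightarrow> \<theta> * real (card points) \<le> real (card A) \<Longrightarrow>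
      \<exists>x\<in>A. \<exists>y\<in>A. sqnorm_sum coords x y \<le> r * real N ^ 2"
    and short: "real (card {x \<in> points. \<not> long x}) \<le> \<theta> * real (card points)"
    and r: "0 < r" "1 \<le> N"
    and ind: "is_independent be_verts be_edges J"
  shows "(\<Sum>a\<in>J. be_weight a) \<le> 2 * \<theta>"
proof -
  define L where "L u = {x. (u, x) \<in> J}" for u
  have Jsub: "J \<subseteq> be_verts" using ind by (simp add: is_independent_def)
  have Lsub: "L u \<subseteq> points" for u using Jsub by (auto simp: L_def be_verts_def)
  have rpos: "0 < r * real N ^ 2" using r by simp
  \<comment> \<open>One \<open>\<theta>\<close> for the vectors that are not long, one for the long
    vectors of an independent set.\<close>
  have card_L: "real (card (L u)) \<le> 2 * \<theta> * real (card points)" if u: "u \<in> verts R" for u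
  proof -
    define A where "A = {x \<in> L u. long x}"
    have "real (card A) < \<theta> * real (card points)"
    proof (rule ccontr)
      assume "\<not> ?thesis"
      then obtain x y where xy: "x \<in> A" "y \<in> A" "sqnorm_sum coords x y \<le> r * real N ^ 2"
        using anti[of A] Lsub[of u] by (auto simp: A_def not_less subset_iff)
      \<comment> \<open>The pair supplied by \<open>anti\<close> could be degenerate, but
        \<open>x + x\<close> has squared length \<open>4 * ip coords x x\<close>, too much for a
        long \<open>x\<close>.\<close>
      have "x \<noteq> y"
      proof
        assume "x = y"
        have "4 * ip coords x x = sqnorm_sum coords x x"
          by (simp add: ip_def sqnorm_sum_def sum_distrib_left power2_eq_square)
        then have "4 * (9 / 4 * r * real N ^ 2) < r * real N ^ 2"
          using xy \<open>x = y\<close> by (simp add: A_def long_def)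
        then show False using rpos by simp
      qed
      then have "be_rel (u, x) (u, y)" using xy by (simp add: be_rel_def near_antipodal_def A_def)
      moreover have "(u, x) \<in> J" "(u, y) \<in> J" using xy by (simp_all add: A_def L_def)
      ultimately have "{(u, x), (u, y)} \<in> be_edges" using Jsub be_edges_iff by blast
      then show False using ind \<open>(u, x) \<in> J\<close> \<open>(u, y) \<in> J\<close> by (simp add: is_independent_def)
    qed
    moreover have "card (L u) \<le> card A + card {x \<in> points. \<not> long x}"
    proof -
      have "L u \<subseteq> A \<union> {x \<in> points. \<not> long x}" using Lsub[of u] by (auto simp: A_def)
      moreover have "finite A" using finite_subset[OF Lsub finite_points] by (simp add: A_def)
      ultimately have "card (L u) \<le> card (A \<union> {x \<in> points. \<not> long x})"
        using finite_points by (intro card_mono) auto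
      then show ?thesis using card_Un_le[of A "{x \<in> points. \<not> long x}"] by linarith
    qed
    ultimately show ?thesis using short by linarith
  qed
  have fL: "finite (L u)" for u using finite_subset[OF Lsub finite_points] .
  have "J = Sigma (verts R) L" using Jsub by (auto simp: L_def be_verts_def)
  then have "(\<Sum>a\<in>J. be_weight a) = (\<Sum>u\<in>verts R. \<Sum>x\<in>L u. be_weight (u, x))"
    using finite_verts fL by (simp add: sum.Sigma case_prod_unfold)
  also have "\<dots> = (\<Sum>u\<in>verts R. real (card (L u)) * (vweight R u / real (card points)))"
    by (simp add: be_weight_def)
  also have "\<dots> \<le> (\<Sum>u\<in>verts R. (2 * \<theta> * real (card points)) * (vweight R u / real (card points)))"
    using R by (intro sum_mono mult_right_mono card_L) (auto simp: weighted_graph_def)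
  also have "\<dots> = (\<Sum>u\<in>verts R. 2 * \<theta> * vweight R u)"
    using card_points_pos by (simp add: mult.assoc)
  also have "\<dots> = 2 * \<theta>" using R by (simp add: weighted_graph_def sum_distrib_left[symmetric])
  finally show ?thesis .
qed

section \<open>Clique density of the construction\<close>

definition flip_block :: "('v set \<times> nat) set \<Rightarrow> ('v set \<times> nat \<Rightarrow> int) \<Rightarrow> ('v set \<times> nat \<Rightarrow> int)" where
  "flip_block J x = (\<lambda>k. if k \<in> J then - x k else x k)"

lemma flip_block_points:
  assumes "J \<subseteq> coords" "x \<in> points"
  shows "flip_block J x \<in> points"
  unfolding points_def
proof (rule PiE_I)
  fix k assume "k \<in> coords"
  then have "x k \<in> grid N" using assms(2) by (auto simp: points_def)
  then show "flip_block J x k \<in> grid N" by (auto simp: flip_block_def grid_def)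
next
  fix k assume "k \<notin> coords"
  moreover have "x k = undefined" using PiE_arb[OF assms(2)[unfolded points_def] calculation] .
  ultimately show "flip_block J x k = undefined" using assms(1) by (auto simp: flip_block_def)
qed

lemma flip_block_flip_block: "flip_block J (flip_block J x) = x"
  by (rule ext) (simp add: flip_block_def)

lemma ip_flip_block: "ip J (flip_block J x) y = - ip J x y"
  by (simp add: ip_def flip_block_def sum_negf[symmetric])

lemma ip_flip_block_disjoint: "J \<inter> J' = {} \<Longrightarrow> ip J (flip_block J' x) y = ip J x y"
  unfolding ip_def by (rule sum.cong[OF refl]) (auto simp: flip_block_def)

lemma block_disjoint: "{u, v} \<noteq> {u', v'} \<Longrightarrow> block u v \<inter> block u' v' = {}"
  by (auto simp: block_def)

text \<open>For fixed vertices \<open>\<tau>\<close>, only the pairs of weight at most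
  \<open>1/2\<close> impose a condition on the vectors \<open>z\<close>. Their inner products use
  disjoint blocks, so \<open>sign_flip_count\<close> applies, with \<open>rare\<close> bounding the
  exceptional tuples.\<close>

lemma sum_tuples_ge:
  assumes r: "0 \<le> r" and \<eta>: "0 \<le> \<eta>"
    and rare: "\<And>u v. u \<in> verts R \<Longrightarrow> v \<in> verts R \<Longrightarrow>
      real (card {(x, y) \<in> points \<times> points. \<bar>ip (block u v) x y\<bar> \<le> r / 4 * real N ^ 2}) \<le> \<eta> * real (card points) ^ 2"
    and \<tau>: "\<tau> \<in> {1..s} \<rightarrow>\<^sub>E verts R"
  shows "real (card ({1..s} \<rightarrow>\<^sub>E points)) *
      ((\<Prod>e\<in>complete_edges s. eweight R (\<tau> (Min e)) (\<tau> (Max e))) - real (card (complete_edges s)) * \<eta>)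
    \<le> (\<Sum>z\<in>{1..s} \<rightarrow>\<^sub>E points. \<Prod>e\<in>complete_edges s.
        adj be_edges (\<tau> (Min e), z (Min e)) (\<tau> (Max e), z (Max e)))"
proof -
  let ?P = "complete_edges s" and ?Z = "{1..s} \<rightarrow>\<^sub>E points"
  define w where "w e = eweight R (\<tau> (Min e)) (\<tau> (Max e))" for e
  have \<tau>V: "\<tau> i \<in> verts R" if "i \<in> {1..s}" for i using \<tau> that by (rule PiE_mem)
  have \<tau>e: "\<tau> (Min e) \<in> verts R" "\<tau> (Max e) \<in> verts R" if "e \<in> ?P" for e
    using complete_edgesD(1,2)[OF that] by (auto intro: \<tau>V)
  have w01: "0 \<le> w e" "w e \<le> 1" if "e \<in> ?P" for e
    using R \<tau>e[OF that] by (auto simp: w_def weighted_graph_def)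
  show ?thesis
  proof (cases "\<exists>e\<in>?P. w e = 0")
    \<comment> \<open>A zero weight makes the left side nonpositive. Otherwise \<open>\<tau>\<close>
      is injective, since diagonal weights vanish, and then different pairs of indices own different
      blocks.\<close>
    case True
    then have "(\<Prod>e\<in>?P. w e) = 0" by (intro prod_zero) auto
    moreover have "0 \<le> real (card ?P) * \<eta>" using \<eta> by simp
    ultimately have "(\<Prod>e\<in>?P. w e) - real (card ?P) * \<eta> \<le> 0" by linarith
    then have "real (card ?Z) * ((\<Prod>e\<in>?P. w e) - real (card ?P) * \<eta>) \<le> 0" by (intro mult_nonneg_nonpos) auto
    also have "0 \<le> (\<Sum>z\<in>?Z. \<Prod>e\<in>?P. adj be_edges (\<tau> (Min e), z (Min e)) (\<tau> (Max e), z (Max e)))"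
      by (intro sum_nonneg prod_nonneg) auto
    finally show ?thesis unfolding w_def .
  next
    case False
    have wpos: "0 < w e" if "e \<in> ?P" for e using w01(1)[OF that] False that by (metis less_eq_real_def)
    have ne: "\<tau> (Min e) \<noteq> \<tau> (Max e)" if "e \<in> ?P" for e
    proof
      assume "\<tau> (Min e) = \<tau> (Max e)"
      then have "w e = 0" using R \<tau>e[OF that] by (simp add: w_def weighted_graph_def)
      then show False using wpos[OF that] by simp
    qed
    have inj: "inj_on \<tau> {1..s}"
    proof (rule inj_onI, rule ccontr)
      fix i j assume ij: "i \<in> {1..s}" "j \<in> {1..s}" "\<tau> i = \<tau> j" "i \<noteq> j"
      have "\<tau> (Min {i, j}) \<noteq> \<tau> (Max {i, j})" by (rule ne[OF pair_in_complete_edges[OF ij(1,2,4)]])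
      then show False using ij(3) by (simp add: min_def max_def split: if_splits)
    qed
    define F where "F = {e \<in> ?P. w e \<le> 1/2}"
    have FP: "F \<subseteq> ?P" by (auto simp: F_def)
    have fF: "finite F" by (rule finite_subset[OF FP]) simp
    define B where "B e = block (\<tau> (Min e)) (\<tau> (Max e))" for e
    define S where "S e z = ip (B e) (z (Min e)) (z (Max e))" for e :: "nat set" and z :: "nat \<Rightarrow> 'v set \<times> nat \<Rightarrow> int"
    \<comment> \<open>Only the vector at \<open>Min e\<close> is changed, and only on the block of
      \<open>e\<close>; pairs that share this vector read it on other blocks.\<close>
    define \<phi> where "\<phi> e z = z(Min e := flip_block (B e) (z (Min e)))" for e :: "nat set" and z :: "nat \<Rightarrow> 'v set \<times> nat \<Rightarrow> int"
    have Bsub: "B e \<subseteq> coords" if "e \<in> ?P" for e unfolding B_def by (rule block_subset[OF \<tau>e[OF that]])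
    have Bdisj: "B e \<inter> B e' = {}" if "e \<in> ?P" "e' \<in> ?P" "e \<noteq> e'" for e e'
      unfolding B_def
    proof (rule block_disjoint)
      show "{\<tau> (Min e), \<tau> (Max e)} \<noteq> {\<tau> (Min e'), \<tau> (Max e')}"
      proof
        assume "{\<tau> (Min e), \<tau> (Max e)} = {\<tau> (Min e'), \<tau> (Max e')}"
        then have "\<tau> ` {Min e, Max e} = \<tau> ` {Min e', Max e'}" by simp
        moreover have "{Min e, Max e} \<subseteq> {1..s}" "{Min e', Max e'} \<subseteq> {1..s}"
          using complete_edgesD(1,2)[OF that(1)] complete_edgesD(1,2)[OF that(2)] by auto
        ultimately have "{Min e, Max e} = {Min e', Max e'}" by (simp only: inj_on_image_eq_iff[OF inj])
        then show False using complete_edgesD(4)[OF that(1)] complete_edgesD(4)[OF that(2)] that(3) by metis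
      qed
    qed
    have minmax: "Min e \<noteq> Max e" if "e \<in> ?P" for e using complete_edgesD(3)[OF that] by simp
    define m where "m = r / 4 * real N ^ 2"
    have fZ: "finite ?Z" using finite_points by (intro finite_PiE) simp_all
    have flips: "inj_on (\<phi> e) ?Z \<and> \<phi> e ` ?Z \<subseteq> ?Z \<and> (\<forall>z\<in>?Z. S e (\<phi> e z) = - S e z)" if e: "e \<in> ?P" for e
    proof (intro conjI ballI)
      have "\<phi> e (\<phi> e z) = z" for z by (simp add: \<phi>_def flip_block_flip_block)
      then show "inj_on (\<phi> e) ?Z" by (intro inj_on_inverseI[where g = "\<phi> e"])
      show "\<phi> e ` ?Z \<subseteq> ?Z"
      proof (rule image_subsetI)
        fix z assume z: "z \<in> ?Z"
        have "flip_block (B e) (z (Min e)) \<in> points"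
          by (rule flip_block_points[OF Bsub[OF e] PiE_mem[OF z complete_edgesD(1)[OF e]]])
        from PiE_fun_upd[where x = "Min e" and T = "\<lambda>_. points", OF this z] show "\<phi> e z \<in> ?Z"
          using complete_edgesD(1)[OF e] unfolding \<phi>_def by (simp only: insert_absorb)
      qed
      fix z
      show "S e (\<phi> e z) = - S e z"
        using minmax[OF e] by (simp add: S_def \<phi>_def ip_flip_block)
    qed
    have keep: "S e' (\<phi> e z) = S e' z" if e: "e \<in> ?P" "e' \<in> ?P" "e \<noteq> e'" for e e' z
    proof -
      have d: "B e' \<inter> B e = {}" using Bdisj[OF e(2,1)] e(3) by auto
      have fl: "ip (B e') (flip_block (B e) x) y = ip (B e') x y" "ip (B e') y (flip_block (B e) x) = ip (B e') y x" for x y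
        using ip_flip_block_disjoint[OF d] ip_commute by metis+
      show ?thesis using minmax[OF e(2)] by (simp add: S_def \<phi>_def fl)
    qed
    have cZ: "real (card {z \<in> ?Z. \<bar>S e z\<bar> \<le> m}) \<le> \<eta> * real (card ?Z)" if e: "e \<in> ?P" for e
    proof -
      let ?g = "\<lambda>x y. of_bool (\<bar>ip (B e) x y\<bar> \<le> m) :: real"
      have "real (card {z \<in> ?Z. \<bar>S e z\<bar> \<le> m}) = (\<Sum>z\<in>?Z. ?g (z (Min e)) (z (Max e)))"
        using fZ by (simp add: S_def Int_def)
      then have "real (card points) ^ 2 * real (card {z \<in> ?Z. \<bar>S e z\<bar> \<le> m}) =
          real (card ?Z) * (\<Sum>x\<in>points. \<Sum>y\<in>points. ?g x y)"
        using sum_PiE_marginal[OF _ complete_edgesD(1,2)[OF e] minmax[OF e], of points ?g] by simp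
      also have "(\<Sum>x\<in>points. \<Sum>y\<in>points. ?g x y) = real (card {(x, y) \<in> points \<times> points. \<bar>ip (B e) x y\<bar> \<le> m})"
      proof -
        have "(\<Sum>x\<in>points. \<Sum>y\<in>points. ?g x y) = (\<Sum>q\<in>points \<times> points. of_bool (case q of (x, y) \<Rightarrow> \<bar>ip (B e) x y\<bar> \<le> m))"
          by (simp only: sum.cartesian_product) (rule sum.cong[OF refl], simp add: case_prod_unfold)
        also have "\<dots> = real (card (points \<times> points \<inter> {q. case q of (x, y) \<Rightarrow> \<bar>ip (B e) x y\<bar> \<le> m}))"
          by (rule sum_of_bool_eq) (simp_all add: finite_points)
        also have "points \<times> points \<inter> {q. case q of (x, y) \<Rightarrow> \<bar>ip (B e) x y\<bar> \<le> m} = {(x, y) \<in> points \<times> points. \<bar>ip (B e) x y\<bar> \<le> m}"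
          by auto
        finally show ?thesis .
      qed
      also have "real (card ?Z) * \<dots> \<le> real (card ?Z) * (\<eta> * real (card points) ^ 2)"
        unfolding B_def m_def by (rule mult_left_mono[OF rare[OF \<tau>e[OF e]]]) simp
      finally have "real (card points) ^ 2 * real (card {z \<in> ?Z. \<bar>S e z\<bar> \<le> m}) \<le> real (card points) ^ 2 * (\<eta> * real (card ?Z))"
        by (simp only: mult_ac)
      moreover have "0 < real (card points) ^ 2" using card_points_pos by simp
      ultimately show ?thesis by (simp only: mult_le_cancel_left_pos)
    qed
    have "real (card ?Z) * (1/2) ^ card F - (\<Sum>e\<in>F. real (card {z \<in> ?Z. \<bar>S e z\<bar> \<le> m})) \<le>
        real (card {z \<in> ?Z. \<forall>e\<in>F. S e z > m})"
    proof (rule sign_flip_count[OF fZ _ fF])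
      show "0 \<le> m" using r by (simp add: m_def)
      show "\<forall>e\<in>F. inj_on (\<phi> e) ?Z \<and> \<phi> e ` ?Z \<subseteq> ?Z \<and> (\<forall>z\<in>?Z. S e (\<phi> e z) = - S e z)"
        by (rule ballI, rule flips) (rule subsetD[OF FP])
      show "\<forall>e\<in>F. \<forall>e'\<in>F. e \<noteq> e' \<longrightarrow> (\<forall>z\<in>?Z. S e' (\<phi> e z) = S e' z)"
        by (intro ballI impI keep) (erule subsetD[OF FP])+
    qed
    moreover have "(\<Sum>e\<in>F. real (card {z \<in> ?Z. \<bar>S e z\<bar> \<le> m})) \<le> real (card ?P) * (\<eta> * real (card ?Z))"
    proof -
      have "(\<Sum>e\<in>F. real (card {z \<in> ?Z. \<bar>S e z\<bar> \<le> m})) \<le> (\<Sum>e\<in>F. \<eta> * real (card ?Z))"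
        by (rule sum_mono, rule cZ) (rule subsetD[OF FP])
      also have "\<dots> = real (card F) * (\<eta> * real (card ?Z))" by simp
      also have "\<dots> \<le> real (card ?P) * (\<eta> * real (card ?Z))"
        using \<eta> card_mono[OF finite_complete_edges FP] by (intro mult_right_mono) auto
      finally show ?thesis .
    qed
    \<comment> \<open>Here the weights are rounded up: to \<open>1/2\<close> for pairs in
      \<open>F\<close>, to \<open>1\<close> for all others.\<close>
    moreover have "real (card ?Z) * (\<Prod>e\<in>?P. w e) \<le> real (card ?Z) * (1/2) ^ card F"
    proof (rule mult_left_mono)
      have "(\<Prod>e\<in>?P. w e) \<le> (\<Prod>e\<in>?P. if e \<in> F then 1/2 else 1)"
        by (rule prod_mono) (use w01 in \<open>auto simp: F_def\<close>)
      also have "\<dots> = (\<Prod>e\<in>?P \<inter> F. 1/2)" by (rule prod.inter_restrict[symmetric]) simp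
      also have "?P \<inter> F = F" using FP by auto
      finally show "(\<Prod>e\<in>?P. w e) \<le> (1/2) ^ card F" by simp
    qed simp
    moreover have "real (card {z \<in> ?Z. \<forall>e\<in>F. S e z > m}) \<le>
        (\<Sum>z\<in>?Z. \<Prod>e\<in>?P. adj be_edges (\<tau> (Min e), z (Min e)) (\<tau> (Max e), z (Max e)))"
    proof -
      have "real (card {z \<in> ?Z. \<forall>e\<in>F. S e z > m}) = (\<Sum>z\<in>?Z. of_bool (\<forall>e\<in>F. S e z > m))"
        using fZ by (simp add: Int_def)
      also have "\<dots> \<le> (\<Sum>z\<in>?Z. \<Prod>e\<in>?P. adj be_edges (\<tau> (Min e), z (Min e)) (\<tau> (Max e), z (Max e)))"
      proof (rule sum_mono)
        fix z assume z: "z \<in> ?Z"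
        show "of_bool (\<forall>e\<in>F. S e z > m) \<le> (\<Prod>e\<in>?P. adj be_edges (\<tau> (Min e), z (Min e)) (\<tau> (Max e), z (Max e)))"
        proof (cases "\<forall>e\<in>F. S e z > m")
          case True
          have "adj be_edges (\<tau> (Min e), z (Min e)) (\<tau> (Max e), z (Max e)) = 1" if e: "e \<in> ?P" for e
          proof -
            have "cross_adj (\<tau> (Min e)) (z (Min e)) (\<tau> (Max e)) (z (Max e))"
            proof (cases "e \<in> F")
              case True
              then show ?thesis using \<open>\<forall>e\<in>F. S e z > m\<close> wpos[OF e]
                by (simp add: cross_adj_def S_def B_def m_def w_def)
            next
              case False
              then show ?thesis using e by (simp add: F_def cross_adj_def w_def)
            qed
            then have "be_rel (\<tau> (Min e), z (Min e)) (\<tau> (Max e), z (Max e))"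
              using ne[OF e] by (simp add: be_rel_def)
            moreover have "z (Min e) \<in> points" "z (Max e) \<in> points"
              using PiE_mem[OF z] complete_edgesD(1,2)[OF e] by blast+
            ultimately show ?thesis using \<tau>e[OF e] be_edges_iff by (simp add: adj_def be_verts_def)
          qed
          then show ?thesis by simp
        next
          case False
          have "0 \<le> (\<Prod>e\<in>?P. adj be_edges (\<tau> (Min e), z (Min e)) (\<tau> (Max e), z (Max e)))"
            by (intro prod_nonneg) auto
          moreover have "of_bool (\<forall>e\<in>F. S e z > m) = (0::real)" using False by (simp only: of_bool_def if_False)
          ultimately show ?thesis by linarith
        qed
      qed
      finally show ?thesis .
    qed
    moreover have "real (card ?Z) * ((\<Prod>e\<in>?P. w e) - real (card ?P) * \<eta>) =
        real (card ?Z) * (\<Prod>e\<in>?P. w e) - real (card ?P) * (\<eta> * real (card ?Z))"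
      by (simp add: algebra_simps)
    ultimately show ?thesis unfolding w_def by linarith
  qed
qed

lemma sum_PiE_Times:
  fixes \<psi> :: "('k \<Rightarrow> 'a \<times> 'b) \<Rightarrow> real"
  shows "(\<Sum>\<sigma>\<in>T \<rightarrow>\<^sub>E A \<times> B. \<psi> \<sigma>) = (\<Sum>\<tau>\<in>T \<rightarrow>\<^sub>E A. \<Sum>z\<in>T \<rightarrow>\<^sub>E B. \<psi> (\<lambda>i\<in>T. (\<tau> i, z i)))"
proof -
  have "(\<Sum>\<sigma>\<in>T \<rightarrow>\<^sub>E A \<times> B. \<psi> \<sigma>) =
      (\<Sum>q\<in>(T \<rightarrow>\<^sub>E A) \<times> (T \<rightarrow>\<^sub>E B). \<psi> (\<lambda>i\<in>T. (fst q i, snd q i)))"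
  proof (rule sum.reindex_bij_witness[where i = "\<lambda>q. \<lambda>i\<in>T. (fst q i, snd q i)" and
        j = "\<lambda>\<sigma>. (\<lambda>i\<in>T. fst (\<sigma> i), \<lambda>i\<in>T. snd (\<sigma> i))"])
    fix \<sigma> assume s: "\<sigma> \<in> T \<rightarrow>\<^sub>E A \<times> B"
    show eq: "(\<lambda>i\<in>T. (fst (\<lambda>i\<in>T. fst (\<sigma> i), \<lambda>i\<in>T. snd (\<sigma> i)) i, snd (\<lambda>i\<in>T. fst (\<sigma> i), \<lambda>i\<in>T. snd (\<sigma> i)) i)) = \<sigma>"
      using s by (intro extensionalityI[of _ T]) (auto simp: PiE_iff)
    show "(\<lambda>i\<in>T. fst (\<sigma> i), \<lambda>i\<in>T. snd (\<sigma> i)) \<in> (T \<rightarrow>\<^sub>E A) \<times> (T \<rightarrow>\<^sub>E B)"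
      using s by (auto simp: PiE_iff mem_Times_iff)
    show "\<psi> (\<lambda>i\<in>T. (fst (\<lambda>i\<in>T. fst (\<sigma> i), \<lambda>i\<in>T. snd (\<sigma> i)) i, snd (\<lambda>i\<in>T. fst (\<sigma> i), \<lambda>i\<in>T. snd (\<sigma> i)) i)) = \<psi> \<sigma>"
      by (simp only: eq)
  next
    fix q assume q: "q \<in> (T \<rightarrow>\<^sub>E A) \<times> (T \<rightarrow>\<^sub>E B)"
    show "(\<lambda>i\<in>T. (fst q i, snd q i)) \<in> T \<rightarrow>\<^sub>E A \<times> B"
      using q by (auto simp: PiE_iff mem_Times_iff)
    have "(\<lambda>i\<in>T. fst ((\<lambda>i\<in>T. (fst q i, snd q i)) i)) = fst q"
      using q by (intro extensionalityI[of _ T]) (auto simp: PiE_iff mem_Times_iff)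
    moreover have "(\<lambda>i\<in>T. snd ((\<lambda>i\<in>T. (fst q i, snd q i)) i)) = snd q"
      using q by (intro extensionalityI[of _ T]) (auto simp: PiE_iff mem_Times_iff)
    ultimately show "(\<lambda>i\<in>T. fst ((\<lambda>i\<in>T. (fst q i, snd q i)) i), \<lambda>i\<in>T. snd ((\<lambda>i\<in>T. (fst q i, snd q i)) i)) = q"
      by (simp only: prod.collapse)
  qed
  then show ?thesis by (simp only: sum.cartesian_product case_prod_unfold)
qed

lemma hom_sum_be:
  assumes r: "0 \<le> r" and \<eta>: "0 \<le> \<eta>"
    and rare: "\<And>u v. u \<in> verts R \<Longrightarrow> v \<in> verts R \<Longrightarrow>
      real (card {(x, y) \<in> points \<times> points. \<bar>ip (block u v) x y\<bar> \<le> r / 4 * real N ^ 2}) \<le> \<eta> * real (card points) ^ 2"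
  shows "hom_density s (complete_edges s) R - real (card (complete_edges s)) * \<eta> \<le> hom_sum s be_verts be_weight (adj be_edges)"
proof -
  let ?P = "complete_edges s" and ?Z = "{1..s} \<rightarrow>\<^sub>E points" and ?V = "{1..s} \<rightarrow>\<^sub>E verts R"
  define c where "c = real (card ?Z)"
  have c: "c = real (card points) ^ s" unfolding c_def by (simp add: card_funcsetE)
  have cpos: "0 < c" unfolding c using card_points_pos by simp
  define vp where "vp \<tau> = (\<Prod>i=1..s. vweight R (\<tau> i))" for \<tau> :: "nat \<Rightarrow> 'v"
  have vp0: "0 \<le> vp \<tau>" if "\<tau> \<in> ?V" for \<tau>
    unfolding vp_def using R that by (intro prod_nonneg) (auto simp: weighted_graph_def PiE_iff)
  have vp1: "(\<Sum>\<tau>\<in>?V. vp \<tau>) = 1"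
  proof -
    have "(\<Sum>\<tau>\<in>?V. vp \<tau>) = (\<Prod>i=1..s. \<Sum>v\<in>verts R. vweight R v)"
      unfolding vp_def by (rule prod_sum_PiE[symmetric]) (use finite_verts in auto)
    then show ?thesis using R by (simp add: weighted_graph_def)
  qed
  define a where "a \<tau> z = (\<Prod>e\<in>?P. adj be_edges (\<tau> (Min e), z (Min e)) (\<tau> (Max e), z (Max e)))"
    for \<tau> :: "nat \<Rightarrow> 'v" and z
  define wp where "wp \<tau> = (\<Prod>e\<in>?P. eweight R (\<tau> (Min e)) (\<tau> (Max e)))" for \<tau> :: "nat \<Rightarrow> 'v"
  have "hom_sum s be_verts be_weight (adj be_edges) = (\<Sum>\<tau>\<in>?V. \<Sum>z\<in>?Z. vp \<tau> / c * a \<tau> z)"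
    unfolding hom_sum_def be_verts_def sum_PiE_Times
  proof (intro sum.cong refl)
    fix \<tau> :: "nat \<Rightarrow> 'v" and z :: "nat \<Rightarrow> 'v set \<times> nat \<Rightarrow> int"
    let ?\<sigma> = "\<lambda>i\<in>{1..s}. (\<tau> i, z i)"
    have "(\<Prod>i=1..s. be_weight (?\<sigma> i)) = (\<Prod>i=1..s. vweight R (\<tau> i) / real (card points))"
      by (rule prod.cong[OF refl]) (simp add: be_weight_def)
    also have "\<dots> = vp \<tau> / c" by (simp add: vp_def c prod_dividef)
    finally have 1: "(\<Prod>i=1..s. be_weight (?\<sigma> i)) = vp \<tau> / c" .
    have 2: "(\<Prod>e\<in>?P. adj be_edges (?\<sigma> (Min e)) (?\<sigma> (Max e))) = a \<tau> z"
      unfolding a_def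
    proof (rule prod.cong[OF refl])
      fix e assume "e \<in> ?P"
      from complete_edgesD(1,2)[OF this]
      show "adj be_edges (?\<sigma> (Min e)) (?\<sigma> (Max e)) = adj be_edges (\<tau> (Min e), z (Min e)) (\<tau> (Max e), z (Max e))"
        by (simp only: restrict_apply if_True)
    qed
    show "(\<Prod>i=1..s. be_weight (?\<sigma> i)) * (\<Prod>e\<in>?P. adj be_edges (?\<sigma> (Min e)) (?\<sigma> (Max e))) = vp \<tau> / c * a \<tau> z"
      by (simp only: 1 2)
  qed
  also have "\<dots> = (\<Sum>\<tau>\<in>?V. vp \<tau> / c * (\<Sum>z\<in>?Z. a \<tau> z))" by (simp only: sum_distrib_left)
  also have "\<dots> \<ge> (\<Sum>\<tau>\<in>?V. vp \<tau> / c * (c * (wp \<tau> - real (card ?P) * \<eta>)))"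
  proof (rule sum_mono, rule mult_left_mono)
    fix \<tau> assume t: "\<tau> \<in> ?V"
    show "c * (wp \<tau> - real (card ?P) * \<eta>) \<le> (\<Sum>z\<in>?Z. a \<tau> z)"
      unfolding c_def wp_def a_def by (rule sum_tuples_ge[OF r \<eta> rare t])
    show "0 \<le> vp \<tau> / c" using vp0[OF t] cpos by simp
  qed
  also have "(\<Sum>\<tau>\<in>?V. vp \<tau> / c * (c * (wp \<tau> - real (card ?P) * \<eta>))) =
      (\<Sum>\<tau>\<in>?V. vp \<tau> * wp \<tau>) - real (card ?P) * \<eta> * (\<Sum>\<tau>\<in>?V. vp \<tau>)"
  proof -
    have "vp \<tau> / c * (c * (wp \<tau> - real (card ?P) * \<eta>)) = vp \<tau> * wp \<tau> - real (card ?P) * \<eta> * vp \<tau>" for \<tau>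
      using cpos by (simp add: algebra_simps)
    then show ?thesis by (simp only: sum_subtractf sum_distrib_left)
  qed
  also have "\<dots> = hom_density s ?P R - real (card ?P) * \<eta>"
    unfolding vp1 mult_1_right unfolding hom_density_def vp_def wp_def by (rule refl)
  finally show ?thesis .
qed

end

section \<open>The Ramsey--Turan density\<close>

lemma RT_ratio_ge_hom_density:
  fixes R :: "'v wgraph" and \<delta> \<epsilon> :: real
  assumes R: "weighted_graph R" "weighted_clique_free t R" and t: "3 \<le> t" and \<delta>: "0 < \<delta>" and \<epsilon>: "0 < \<epsilon>"
  shows "\<forall>\<^sub>F n in sequentially. RT_ratio s t \<delta> n > hom_density s (complete_edges s) R - \<epsilon>"
proof -
  \<comment> \<open>Independent sets weigh at most \<open>2 * \<theta>\<close>, and a strict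
    inequality with \<open>\<delta>\<close> is required.\<close>
  define \<theta> where "\<theta> = \<delta> / 4"
  have \<theta>: "0 < \<theta>" "2 * \<theta> < \<delta>" using \<delta> by (simp_all add: \<theta>_def)
  define r where "r = (1 + 5 / \<theta>)\<^sup>2 - 1"
  have r: "0 < r"
  proof -
    have "1 < 1 + 5 / \<theta>" using \<theta> by simp
    then have "1 < (1 + 5 / \<theta>)\<^sup>2" by (intro one_less_power) auto
    then show ?thesis by (simp add: r_def)
  qed
  define P where "P = real (card (complete_edges s))"
  define \<eta> where "\<eta> = \<epsilon> / (2 * (P + 1))"
  have P: "0 \<le> P" by (simp add: P_def)
  have \<eta>: "0 < \<eta>" using \<epsilon> P by (simp add: \<eta>_def)
  have P\<eta>: "P * \<eta> \<le> \<epsilon> / 2"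
  proof -
    have "P * \<eta> \<le> (P + 1) * \<eta>" using \<eta> by (intro mult_right_mono) auto
    also have "\<dots> = \<epsilon> / 2" using P by (simp add: \<eta>_def field_simps)
    finally show ?thesis .
  qed
  obtain h0 :: nat where h0: "\<And>(I :: ('v set \<times> nat) set) J N. finite I \<Longrightarrow> J \<subseteq> I \<Longrightarrow> h0 \<le> card J \<Longrightarrow> 1 \<le> N \<Longrightarrow>
    real (card {(x, y) \<in> (I \<rightarrow>\<^sub>E grid N) \<times> (I \<rightarrow>\<^sub>E grid N). \<bar>ip J x y\<bar> \<le> r / 4 * real N ^ 2}) \<le>
    \<eta> * real (card (I \<rightarrow>\<^sub>E grid N)) ^ 2"
    using ip_anticoncentration[OF \<eta>] by blast
  obtain h1 :: nat where h1: "\<And>(I :: ('v set \<times> nat) set) N. finite I \<Longrightarrow> h1 \<le> card I \<Longrightarrow> 1 \<le> N \<Longrightarrow>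
    real (card {x \<in> I \<rightarrow>\<^sub>E grid N. ip I x x \<le> 9 / 4 * r * real N ^ 2}) \<le> \<theta> * real (card (I \<rightarrow>\<^sub>E grid N))"
    using small_norm_rare[OF \<theta>(1)] by blast
  define h where "h = max h0 (max h1 1)"
  let ?I = "coords R h"
  \<comment> \<open>Taking the dimension itself as \<open>N\<close> gives
    \<open>card ?I \<le> N\<^sup>2\<close>. This can be done last because \<open>h0\<close> and
    \<open>h1\<close> serve every \<open>N \<ge> 1\<close>.\<close>
  define N where "N = card ?I"
  have "1 * h \<le> 2 ^ card (verts R) * h" by (intro mult_right_mono) auto
  then have hN: "h \<le> N" by (simp add: N_def card_coords[OF R(1)])
  then have N: "1 \<le> N" "h1 \<le> N" by (auto simp: h_def)
  have NN: "card ?I \<le> N ^ 2" using N(1) by (simp add: N_def power2_eq_square)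
  have fI: "finite ?I" by (rule finite_coords[OF R(1)])
  let ?W = "be_verts R h N" and ?E = "be_edges R h N r" and ?p = "be_weight R h N"
  have "\<forall>\<^sub>F n in sequentially. RT_ratio s t \<delta> n > hom_sum s ?W ?p (adj ?E) - \<epsilon> / 2"
  proof (rule RT_ratio_liminf)
    show "simple_graph ?W ?E" by (rule simple_graph_be[OF R(1)])
    show "clique_free t ?W ?E" by (rule clique_free_be[OF R t])
    show "0 \<le> ?p a" if "a \<in> ?W" for a
      using that R(1) by (auto simp: be_weight_def[OF R(1)] be_verts_def[OF R(1)] weighted_graph_def)
    show "(\<Sum>a\<in>?W. ?p a) = 1" by (rule sum_be_weight[OF R(1)])
    show "(\<Sum>a\<in>J. ?p a) < \<delta>" if "is_independent ?W ?E J" for J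
    proof -
      have "(\<Sum>a\<in>J. ?p a) \<le> 2 * \<theta>"
      proof (rule independent_be[OF R(1) \<theta>(1) _ _ r N(1) that])
        fix A assume "A \<subseteq> points R h N" "\<theta> * real (card (points R h N)) \<le> real (card A)"
        then show "\<exists>x\<in>A. \<exists>y\<in>A. sqnorm_sum ?I x y \<le> r * real N ^ 2"
          unfolding r_def points_def[OF R(1)] by (rule grid_antipodal[OF fI N(1) NN \<theta>(1)])
      next
        have "{x \<in> points R h N. \<not> long R h N r x} = {x \<in> ?I \<rightarrow>\<^sub>E grid N. ip ?I x x \<le> 9 / 4 * r * real N ^ 2}"
          by (simp add: points_def[OF R(1)] long_def[OF R(1)] not_less)
        then show "real (card {x \<in> points R h N. \<not> long R h N r x}) \<le> \<theta> * real (card (points R h N))"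
          using h1[OF fI _ N(1)] N(2) by (simp add: N_def points_def[OF R(1)])
      qed
      then show ?thesis using \<theta>(2) by linarith
    qed
  qed (use \<epsilon> in simp)
  moreover have "hom_density s (complete_edges s) R - P * \<eta> \<le> hom_sum s ?W ?p (adj ?E)"
    unfolding P_def
  proof (rule hom_sum_be[OF R(1)])
    fix u v assume uv: "u \<in> verts R" "v \<in> verts R"
    show "real (card {(x, y) \<in> points R h N \<times> points R h N. \<bar>ip (block h u v) x y\<bar> \<le> r / 4 * real N ^ 2})
        \<le> \<eta> * real (card (points R h N)) ^ 2"
      unfolding points_def[OF R(1)]
      by (rule h0[OF fI block_subset[OF R(1) uv] _ N(1)]) (simp add: card_block[OF R(1)] h_def)
  qed (use r \<eta> in simp_all)
  ultimately show ?thesis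
    by (elim eventually_mono) (use P\<eta> in linarith)
qed

text \<open>Guards the \<open>Sup\<close> in \<open>weighted_turan_density\<close> against the empty
  set. A single vertex gives \<open>card S1 + card S2 \<le> 2 < t\<close>.\<close>

lemma weighted_turan_density_nonempty:
  assumes "3 \<le> t"
  shows "\<exists>R :: nat wgraph. weighted_graph R \<and> weighted_clique_free t R"
proof -
  define R where "R = \<lparr>verts = {0::nat}, vweight = \<lambda>_. 1, eweight = \<lambda>_ _. 0\<rparr>"
  have "weighted_graph R" by (simp add: weighted_graph_def R_def)
  moreover have "weighted_clique_free t R"
    unfolding weighted_clique_free_def
  proof (rule ccontr)
    assume "weighted_cliques t R \<noteq> {}"
    then obtain S1 S2 :: "nat set" where S: "S2 \<subseteq> S1" "S1 \<subseteq> {0}" "card S1 + card S2 = t"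
      by (auto simp: weighted_cliques_def R_def)
    have "card S1 \<le> card {0::nat}" by (rule card_mono) (use S in auto)
    moreover have "card S2 \<le> card {0::nat}" by (rule card_mono) (use S in auto)
    ultimately show False using S(3) assms by simp
  qed
  ultimately show ?thesis by blast
qed

lemma weighted_turan_density_le_lim:
  assumes t: "3 \<le> t" and \<delta>: "0 < \<delta>"
  shows "weighted_turan_density s t \<le> lim (RT_ratio s t \<delta>)"
  unfolding weighted_turan_density_def
proof (rule cSup_least)
  show "{hom_density s (complete_edges s) R | R :: nat wgraph. weighted_graph R \<and> weighted_clique_free t R} \<noteq> {}"
    using weighted_turan_density_nonempty[OF t] by blast
  fix d assume "d \<in> {hom_density s (complete_edges s) R | R :: nat wgraph. weighted_graph R \<and> weighted_clique_free t R}"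
  then obtain R :: "nat wgraph" where R: "d = hom_density s (complete_edges s) R" "weighted_graph R" "weighted_clique_free t R"
    by blast
  have lim: "RT_ratio s t \<delta> \<longlonglongrightarrow> lim (RT_ratio s t \<delta>)"
    using convergent_RT_ratio convergent_LIMSEQ_iff by blast
  show "d \<le> lim (RT_ratio s t \<delta>)"
  proof (rule field_le_epsilon)
    fix \<epsilon> :: real assume "0 < \<epsilon>"
    from RT_ratio_ge_hom_density[OF R(2,3) t \<delta> this, of s]
    have "\<forall>\<^sub>F n in sequentially. d - \<epsilon> \<le> RT_ratio s t \<delta> n"
      unfolding R(1) by (rule eventually_mono) (rule less_imp_le)
    then have "d - \<epsilon> \<le> lim (RT_ratio s t \<delta>)" by (rule tendsto_lowerbound[OF lim]) simp
    then show "d \<le> lim (RT_ratio s t \<delta>) + \<epsilon>" by linarith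
  qed
qed

lemma weighted_turan_density_nonneg:
  assumes "3 \<le> t"
  shows "0 \<le> weighted_turan_density s t"
proof -
  obtain R :: "nat wgraph" where R: "weighted_graph R" "weighted_clique_free t R"
    using weighted_turan_density_nonempty[OF assms] by blast
  have "0 \<le> hom_density s (complete_edges s) R"
    unfolding hom_density_eq_hom_sum by (rule hom_sum_nonneg) (use R(1) in \<open>auto simp: weighted_graph_def\<close>)
  then show ?thesis using hom_density_le_weighted_turan_density[OF R, of s] by linarith
qed

lemma lim_RT_ratio_le:
  assumes t: "3 \<le> t" and e: "0 < e"
  obtains \<delta>0 where "0 < \<delta>0" "\<And>\<delta>. \<delta> \<le> \<delta>0 \<Longrightarrow> lim (RT_ratio s t \<delta>) \<le> weighted_turan_density s t + e"
proof -
  obtain \<delta>0 N where \<delta>0: "0 < \<delta>0" and up: "\<And>n E. N \<le> n \<Longrightarrow> simple_graph {..<n} E \<Longrightarrow> clique_free t {..<n} E \<Longrightarrow>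
    real (independence_number {..<n} E) < \<delta>0 * real n \<Longrightarrow>
    hom_sum s {..<n} (\<lambda>_. 1 / real n) (adj E) \<le> weighted_turan_density s t + e"
    using hom_sum_le_weighted_turan_density[OF t e, of s] by blast
  let ?c = "weighted_turan_density s t + e"
  have c0: "0 \<le> ?c" using weighted_turan_density_nonneg[OF t, of s] e by linarith
  define q where "q n = real n ^ s / (fact s * real (n choose s))" for n
  have "lim (RT_ratio s t \<delta>) \<le> ?c" if \<delta>: "\<delta> \<le> \<delta>0" for \<delta>
  proof -
    have lim: "RT_ratio s t \<delta> \<longlonglongrightarrow> lim (RT_ratio s t \<delta>)"
      using convergent_RT_ratio convergent_LIMSEQ_iff by blast
    have limc: "(\<lambda>n. ?c * q n) \<longlonglongrightarrow> ?c * 1"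
      unfolding q_def by (intro tendsto_mult tendsto_const tendsto_pow_over_binomial)
    have "RT_ratio s t \<delta> n \<le> ?c * q n" if n: "max N 1 \<le> n" for n
    proof (cases "RT n s t (\<delta> * real n) = 0")
      \<comment> \<open>If \<open>RT\<close> is \<open>0\<close> there may be no admissible graph to
        which the upper bound applies; nonnegativity of the right side settles this case.\<close>
      case True
      have "0 \<le> q n" by (simp add: q_def)
      then show ?thesis using True c0 by (simp add: RT_ratio_def)
    next
      case False
      obtain E where E: "simple_graph {..<n} E" "clique_free t {..<n} E"
        "real (independence_number {..<n} E) < \<delta> * real n" "clique_count s {..<n} E = RT n s t (\<delta> * real n)"
        using RT_attained[OF False] by blast
      have "\<delta> * real n \<le> \<delta>0 * real n" using \<delta> by (intro mult_right_mono) auto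
      then have "real (independence_number {..<n} E) < \<delta>0 * real n" using E(3) by linarith
      then have "hom_sum s {..<n} (\<lambda>_. 1 / real n) (adj E) \<le> ?c" using n by (intro up E) auto
      then have "fact s * real (RT n s t (\<delta> * real n)) * (1 / real n) ^ s \<le> ?c"
        by (simp only: hom_sum_adj_uniform[OF E(1)] E(4))
      then have "fact s * real (RT n s t (\<delta> * real n)) * (1 / real n) ^ s * q n \<le> ?c * q n"
        by (rule mult_right_mono) (simp add: q_def)
      moreover have "fact s * real (RT n s t (\<delta> * real n)) * (1 / real n) ^ s * q n = RT_ratio s t \<delta> n"
        using n by (simp add: q_def RT_ratio_def field_simps)
      ultimately show ?thesis by linarith
    qed
    then have "lim (RT_ratio s t \<delta>) \<le> ?c * 1"
      by (intro LIMSEQ_le[OF lim limc] exI[of _ "max N 1"]) blast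
    then show ?thesis by simp
  qed
  then show ?thesis using that[OF \<delta>0] by blast
qed

theorem theorem2p4:
  fixes s t :: nat
  assumes "2 \<le> s" and "s \<le> t - 1"
  shows "(\<forall>\<delta>>0. convergent (\<lambda>n. RT_ratio s t \<delta> n)) \<and>
         (\<exists>L. ((\<lambda>\<delta>. lim (\<lambda>n. RT_ratio s t \<delta> n)) \<longlongrightarrow> L) (at_right 0)) \<and>
         RT_density s t = weighted_turan_density s t"
proof -
  have t: "3 \<le> t" using assms by linarith
  have lim: "((\<lambda>\<delta>. lim (\<lambda>n. RT_ratio s t \<delta> n)) \<longlongrightarrow> weighted_turan_density s t) (at_right 0)"
  proof (rule tendstoI)
    fix e :: real assume "0 < e"
    then have e2: "0 < e / 2" by simp
    obtain \<delta>0 where \<delta>0: "0 < \<delta>0" "\<And>\<delta>. \<delta> \<le> \<delta>0 \<Longrightarrow> lim (RT_ratio s t \<delta>) \<le> weighted_turan_density s t + e / 2"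
      using lim_RT_ratio_le[OF t e2, of s] by blast
    show "\<forall>\<^sub>F \<delta> in at_right 0. dist (lim (\<lambda>n. RT_ratio s t \<delta> n)) (weighted_turan_density s t) < e"
    proof (rule eventually_at_rightI[OF _ \<delta>0(1)])
      fix \<delta> assume "\<delta> \<in> {0<..<\<delta>0}"
      then have "lim (RT_ratio s t \<delta>) \<le> weighted_turan_density s t + e / 2"
        "weighted_turan_density s t \<le> lim (RT_ratio s t \<delta>)"
        using \<delta>0(2) weighted_turan_density_le_lim[OF t] by auto
      then show "dist (lim (\<lambda>n. RT_ratio s t \<delta> n)) (weighted_turan_density s t) < e"
        using \<open>0 < e\<close> by (simp add: dist_real_def)
    qed
  qed
  moreover have "RT_density s t = weighted_turan_density s t"
    unfolding RT_density_def by (rule tendsto_Lim[OF trivial_limit_at_right_real lim])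
  ultimately show ?thesis using convergent_RT_ratio[of s t] by auto
qed

end
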